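(* (i) For any $M\ge 0$, $\mu\in\mathrm{Sign}_M^+$, and $u_1,\dots,u_M\in\mathbb{C}$, $$F_\mu(u_1,\dots,u_M)=\frac{(1-q)^M}{\prod_{i=1}^M(1-su_i)}\sum_{\sigma\in S_M}\sigma\left(\prod_{1\le i<j\le M}\frac{u_i-qu_j}{u_i-u_j}\cdot\prod_{i=1}^M\left(\frac{u_i-s}{1-su_i}\right)^{\mu_i}\right).$$ (ii) Fix $n\ge 0$, $\nu\in\mathrm{Sign}_n^+$, and let $k\ge 0$ be the number of zero coordinates of $\nu$ (so exactly the last $k$ coordinates are zero: $\nu_{n-k+1}=\dots=\nu_n=0$). Then for any $N\ge n-k$, $$G_\nu(v_1,\dots,v_N)=\frac{(1-q)^N(s^2;q)_n}{(q;q)_{N-n+k}(s^2;q)_k}\sum_{\sigma\in S_N}\sigma\left(\prod_{1\le i<j\le N}\frac{v_i-qv_j}{v_i-v_j}\cdot\prod_{i=1}^{n-k}\frac{v_i}{(1-sv_i)(v_i-s)}\left(\frac{v_i-s}{1-sv_i}\right)^{\nu_i}\cdot\prod_{j=n-k+1}^N\frac{1-q^ksv_j}{1-sv_j}\right).$$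
   Context: Throughout, $q,s$ are fixed generic complex parameters, and identities are understood for values of the variables at which no denominator vanishes (equivalently, as identities of rational functions). $S_n$ is the symmetric group; for $\sigma\in S_n$ and a function $f$ of $n$ variables, $\sigma(f)(x_1,\dots,x_n)=f(x_{\sigma(1)},\dots,x_{\sigma(n)})$. $(a;q)_n=\prod_{r=0}^{n-1}(1-aq^r)$ for $n\ge1$, and $(a;q)_0=1$. Signatures: a signature of length $L$ is a string of integers $\lambda=(\lambda_1\ge\dots\ge\lambda_L)$; $\mathrm{Sign}_L$ is the set of all of them, $\mathrm{Sign}_L^+$ the set of those with nonnegative entries; $\mathrm{Sign}_0=\mathrm{Sign}_0^+=\{\varnothing\}$. Vertex weights: for $u\in\mathbb{C}$ and integers $m\ge 0$, $w_u(m,0;m,0)=\frac{1-sq^mu}{1-su}$, $w_u(m,1;m,1)=\frac{u-sq^m}{1-su}$, $w_u(m+1,0;m,1)=\frac{(1-s^2q^m)u}{1-su}$, $w_u(m,1;m+1,0)=\frac{1-q^{m+1}}{1-su}$, and $w_u(i_1,j_1;i_2,j_2)=0$ for all other nonnegative integers $i_1,j_1,i_2,j_2$. Path weights: in the square grid, assign to each vertex $(i,j)$ the variable $u_j$ (constant along rows). A vertex is interior to an up-right path if it lies on the path and is not its beginning or ending vertex. The weight of a finite collection of up-right paths is the product, over all vertices interior to the paths of the collection, of $w_{u_j}(i_1,j_1;i_2,j_2)$, where $u_j$ is the variable of the vertex and $i_1,j_1,i_2,j_2$ are the numbers of paths of the collection containing the South, West, North, East edge at the vertex, respectively (weight $1$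 if there are no interior vertices). Two collections are identified if they have the same interior vertices and the same numbers $(i_1,j_1,i_2,j_2)$ at each of them. $F$: for $L\ge M\ge0$, $\lambda\in\mathrm{Sign}^+_L$, $\mu\in\mathrm{Sign}^+_M$, $F_{\lambda/\mu}(u_1,\dots,u_{L-M})$ is the sum of weights of all collections of $L$ up-right paths that start with the vertical edges $(\mu_m,0)\to(\mu_m,1)$, $1\le m\le M$, and the horizontal edges $(-1,j)\to(0,j)$, $1\le j\le L-M$, and end with the vertical edges $(\lambda_l,L-M)\to(\lambda_l,L-M+1)$, $1\le l\le L$. $F_\lambda:=F_{\lambda/\varnothing}$. $G$: for $L,k\ge0$, $\lambda,\nu\in\mathrm{Sign}_L$, $G_{\lambda/\nu}(u_1,\dots,u_k)$ is the sum of weights of all collections of $L$ up-right paths that start with the vertical edges $(\nu_n,0)\to(\nu_n,1)$, $1\le n\le L$, and end with the vertical edges $(\lambda_l,k)\to(\lambda_l,k+1)$, $1\le l\le L$. $G_\lambda:=G_{\lambda/(0,\dots,0)}$ (with $L$ zeros). *)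

theory Defs
  imports Complex_Main "HOL-Library.Multiset" "HOL-Combinatorics.Permutations"
begin

definition qpoch :: "complex \<Rightarrow> complex \<Rightarrow> nat \<Rightarrow> complex" where
  "qpoch a q n = (\<Prod>r<n. 1 - a * q ^ r)"

definition perm_act :: "(nat \<Rightarrow> nat) \<Rightarrow> ((nat \<Rightarrow> complex) \<Rightarrow> complex) \<Rightarrow> (nat \<Rightarrow> complex) \<Rightarrow> complex" where
  "perm_act \<sigma> f = (\<lambda>x. f (\<lambda>i. x (\<sigma> i)))"

definition Sign :: "nat \<Rightarrow> int list set" where
  "Sign L = {la. length la = L \<and> sorted_wrt (\<ge>) la}"

definition Sign_plus :: "nat \<Rightarrow> int list set" where
  "Sign_plus L = {la \<in> Sign L. \<forall>x \<in> set la. 0 \<le> x}"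

definition vertex_weight ::
  "complex \<Rightarrow> complex \<Rightarrow> complex \<Rightarrow> nat \<Rightarrow> nat \<Rightarrow> nat \<Rightarrow> nat \<Rightarrow> complex" where
  "vertex_weight q s u i1 j1 i2 j2 =
     (if j1 = 0 \<and> j2 = 0 \<and> i1 = i2 then (1 - s * q ^ i1 * u) / (1 - s * u)
      else if j1 = 1 \<and> j2 = 1 \<and> i1 = i2 then (u - s * q ^ i1) / (1 - s * u)
      else if j1 = 0 \<and> j2 = 1 \<and> i1 = i2 + 1 then (1 - s\<^sup>2 * q ^ i2) * u / (1 - s * u)
      else if j1 = 1 \<and> j2 = 0 \<and> i2 = i1 + 1 then (1 - q ^ (i1 + 1)) / (1 - s * u)
      else 0)"

type_synonym vertex = "int \<times> int"
type_synonym edge = "vertex \<times> vertex"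

definition up_right_step :: "vertex \<Rightarrow> vertex \<Rightarrow> bool" where
  "up_right_step v w \<longleftrightarrow> w = (fst v + 1, snd v) \<or> w = (fst v, snd v + 1)"

text \<open>A path is the list of its vertices. It has at least one edge, and its first and last edge
  may be the same edge.\<close>

definition up_right_path :: "vertex list \<Rightarrow> bool" where
  "up_right_path p \<longleftrightarrow> 2 \<le> length p \<and> successively up_right_step p"

definition path_edges :: "vertex list \<Rightarrow> edge set" where
  "path_edges p = set (zip p (tl p))"

definition first_edge :: "vertex list \<Rightarrow> edge" where
  "first_edge p = (p ! 0, p ! 1)"

definition last_edge :: "vertex list \<Rightarrow> edge" where
  "last_edge p = (p ! (length p - 2), p ! (length p - 1))"

definition path_interior :: "vertex list \<Rightarrow> vertex set" where
  "path_interior p = set p - {hd p, last p}"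

text \<open>Collections are multisets of paths, since distinct paths may share edges and several of
  them may have the same starting edge. No correspondence between starting and
  ending edges is prescribed.\<close>

definition collections :: "edge multiset \<Rightarrow> edge multiset \<Rightarrow> vertex list multiset set" where
  "collections starts ends =
     {P. (\<forall>p \<in># P. up_right_path p) \<and>
         image_mset first_edge P = starts \<and> image_mset last_edge P = ends}"

definition edge_count :: "vertex list multiset \<Rightarrow> edge \<Rightarrow> nat" where
  "edge_count P e = size {#p \<in># P. e \<in> path_edges p#}"

text \<open>The numbers of paths through the South, West, North and East edge at each interior vertex,
  and \<open>None\<close> at all other vertices. Two collections are identified iff they have the same
  \<open>local_config\<close>.\<close>

definition local_config ::
  "vertex list multiset \<Rightarrow> vertex \<Rightarrow> (nat \<times> nat \<times> nat \<times> nat) option" where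
  "local_config P = (\<lambda>(x, y).
     if (x, y) \<in> (\<Union>p \<in> set_mset P. path_interior p)
     then Some (edge_count P ((x, y - 1), (x, y)),
                edge_count P ((x - 1, y), (x, y)),
                edge_count P ((x, y), (x, y + 1)),
                edge_count P ((x, y), (x + 1, y)))
     else None)"

definition config_weight ::
  "complex \<Rightarrow> complex \<Rightarrow> (nat \<Rightarrow> complex) \<Rightarrow>
   (vertex \<Rightarrow> (nat \<times> nat \<times> nat \<times> nat) option) \<Rightarrow> complex" where
  "config_weight q s u c =
     (\<Prod>v \<in> dom c. case the (c v) of (i1, j1, i2, j2) \<Rightarrow>
        vertex_weight q s (u (nat (snd v))) i1 j1 i2 j2)"

text \<open>Summing over the image under \<open>local_config\<close> counts identified collections once. The sum is
  finite by \<open>finite_collections\<close> below.\<close>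

definition path_sum ::
  "complex \<Rightarrow> complex \<Rightarrow> (nat \<Rightarrow> complex) \<Rightarrow> edge multiset \<Rightarrow> edge multiset \<Rightarrow> complex" where
  "path_sum q s u starts ends =
     (\<Sum>c \<in> local_config ` collections starts ends. config_weight q s u c)"

definition vertical_edges :: "int list \<Rightarrow> int \<Rightarrow> edge multiset" where
  "vertical_edges la y = mset (map (\<lambda>x. ((x, y), (x, y + 1))) la)"

text \<open>The variables are a function on \<open>nat\<close> of which only the values at the row numbers
  \<open>1, \<dots>, length la - length mu\<close> (for \<open>F\<close>) or \<open>1, \<dots>, k\<close> (for \<open>G\<close>) are used.\<close>

definition F_skew ::
  "complex \<Rightarrow> complex \<Rightarrow> int list \<Rightarrow> int list \<Rightarrow> (nat \<Rightarrow> complex) \<Rightarrow> complex" where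
  "F_skew q s la mu u =
     path_sum q s u
       (vertical_edges mu 0 +
        mset (map (\<lambda>j. ((-1, int j), (0, int j))) [1..<Suc (length la - length mu)]))
       (vertical_edges la (int (length la - length mu)))"

definition F_fun :: "complex \<Rightarrow> complex \<Rightarrow> int list \<Rightarrow> (nat \<Rightarrow> complex) \<Rightarrow> complex" where
  "F_fun q s la u = F_skew q s la [] u"

definition G_skew ::
  "complex \<Rightarrow> complex \<Rightarrow> nat \<Rightarrow> int list \<Rightarrow> int list \<Rightarrow> (nat \<Rightarrow> complex) \<Rightarrow> complex" where
  "G_skew q s k la nu u = path_sum q s u (vertical_edges nu 0) (vertical_edges la (int k))"

definition G_fun :: "complex \<Rightarrow> complex \<Rightarrow> nat \<Rightarrow> int list \<Rightarrow> (nat \<Rightarrow> complex) \<Rightarrow> complex" where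
  "G_fun q s k la u = G_skew q s k la (replicate (length la) 0) u"

lemma up_right_box:
  assumes "successively up_right_step p" "p \<noteq> []"
  shows "(\<forall>v \<in> set p. v \<in> {fst (hd p)..fst (last p)} \<times> {snd (hd p)..snd (last p)}) \<and>
    int (length p) = fst (last p) + snd (last p) - fst (hd p) - snd (hd p) + 1"
  using assms
proof (induction p)
  case (Cons a p)
  show ?case
  proof (cases "p = []")
    case False
    then have st: "up_right_step a (hd p)" and "successively up_right_step p"
      using Cons.prems by (auto simp: successively_Cons)
    with Cons.IH False have
      *: "\<forall>v \<in> set p. v \<in> {fst (hd p)..fst (last p)} \<times> {snd (hd p)..snd (last p)}"
      "int (length p) = fst (last p) + snd (last p) - fst (hd p) - snd (hd p) + 1" by auto
    from False have "hd p \<in> set p" by simp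
    with *(1) have "hd p \<in> {fst (hd p)..fst (last p)} \<times> {snd (hd p)..snd (last p)}"
      by (rule bspec)
    then have "fst (hd p) \<le> fst (last p)" "snd (hd p) \<le> snd (last p)"
      by (auto simp: mem_Times_iff)
    moreover have "fst a \<le> fst (hd p)" "snd a \<le> snd (hd p)"
      "fst (hd p) + snd (hd p) = fst a + snd a + 1"
      using st by (auto simp: up_right_step_def)
    ultimately have "fst a \<le> fst (last p)" "snd a \<le> snd (last p)"
      "int (length (a # p)) = fst (last p) + snd (last p) - fst a - snd a + 1"
      "\<forall>v \<in> set p. v \<in> {fst a..fst (last p)} \<times> {snd a..snd (last p)}"
      using * by (force simp: mem_Times_iff)+
    then show ?thesis
      using False by (simp add: mem_Times_iff)
  qed (auto simp: mem_Times_iff)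
qed simp

lemma finite_collections: "finite (collections starts ends)"
proof -
  define B where "B = {p. up_right_path p \<and> first_edge p \<in># starts \<and> last_edge p \<in># ends}"
  define C where "C a b = {p. set p \<subseteq> {fst a..fst b} \<times> {snd a..snd b} \<and>
    length p = nat (fst b + snd b - fst a - snd a + 1)}" for a b :: vertex
  have "finite (C a b)" for a b
    unfolding C_def by (rule finite_lists_length_eq) simp
  then have fin: "finite (\<Union>e \<in> set_mset starts. \<Union>f \<in> set_mset ends. C (fst e) (snd f))"
    by (intro finite_UN_I finite_set_mset)
  have "B \<subseteq> (\<Union>e \<in> set_mset starts. \<Union>f \<in> set_mset ends. C (fst e) (snd f))"
  proof
    fix p assume "p \<in> B"
    then have p: "2 \<le> length p" "successively up_right_step p"
      "first_edge p \<in># starts" "last_edge p \<in># ends"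
      by (auto simp: B_def up_right_path_def)
    then have "p \<noteq> []" by auto
    then have "p \<in> C (hd p) (last p)"
      using up_right_box[OF p(2)] by (auto simp: C_def)
    moreover have "fst (first_edge p) = hd p" "snd (last_edge p) = last p"
      using \<open>p \<noteq> []\<close> by (auto simp: first_edge_def last_edge_def hd_conv_nth last_conv_nth)
    ultimately show "p \<in> (\<Union>e \<in> set_mset starts. \<Union>f \<in> set_mset ends. C (fst e) (snd f))"
      using p(3,4) by (intro UN_I[of "first_edge p"] UN_I[of "last_edge p"]) simp_all
  qed
  then have "finite B"
    using fin by (rule finite_subset)
  then have "finite (mset ` {xs. set xs \<subseteq> B \<and> length xs = size starts})"
    by (intro finite_imageI finite_lists_length_eq)
  moreover have "collections starts ends \<subseteq> mset ` {xs. set xs \<subseteq> B \<and> length xs = size starts}"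
  proof
    fix P assume P: "P \<in> collections starts ends"
    obtain xs where xs: "P = mset xs" by (metis ex_mset)
    from P have "set xs \<subseteq> B" "length xs = size starts"
      by (auto simp: collections_def B_def xs)
    then show "P \<in> mset ` {xs. set xs \<subseteq> B \<and> length xs = size starts}"
      using xs by blast
  qed
  ultimately show ?thesis by (rule finite_subset[rotated])
qed

end

theory Submission
  imports Defs "HOL-Combinatorics.Multiset_Permutations"
begin

text \<open>Both functions are computed row by row: adding a row is a linear operator on functions of the
  occupation numbers of the columns. Sorting the permutations by the set of variables attached to the
  zero coordinates, the right-hand side of (i) satisfies a recursion that removes one column. A row
  operator also factors over the columns, so its action on the right-hand side of (i) can be determined
  by induction on the number of columns: with an incoming path it adds the variable of the row to the
  set of variables, and without one it multiplies by a constant and adds terms in which one variable is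
  exchanged. Each induction step compares coefficients, which is a partial fraction identity in the new
  variable; no Yang-Baxter equation is needed. For (ii) only column 0 is treated separately: to its
  right the configuration is again generated from the empty one by rows with or without an incoming
  path. On the combinatorial side a collection is determined by its edge counts, and the weight of a
  row vanishes unless every horizontal edge is used at most once.\<close>

section \<open>Partial fractions\<close>

text \<open>Symmetry in the row variables, usually a consequence of the Yang-Baxter equation, is
  built in from the start: the variables are pairwise distinct and enter only as a set, so a new row
  merely has to insert one element. Rows with an incoming path cannot be treated by themselves,
  because the path may stop in a column, and the columns to its right then see a row without
  incoming path. The form of the exchange terms is forced by poles: the row operator has none at
  \<open>w = i\<close>, whereas the diagonal factor does, and the coefficient (1-q)w/(w-i) is the
  one that cancels it. Vertex weights and symmetrized sums fit together because symmetrizing over m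
  equal coordinates gives (q;q)_m/(1-q)^m, which matches the weights \<open>1 - q ^ m\<close> of
  paths stopping in a column; this is also the origin of the factor (1-q)^M. An
  \<open>hl_factor\<close> is never divided by, so that for (i) only coinciding variables and zeros
  of \<open>1 - s * u i\<close> have to be excluded.\<close>

definition hl_factor :: "complex \<Rightarrow> complex \<Rightarrow> complex \<Rightarrow> complex" where
  "hl_factor q x y = (x - q * y) / (x - y)"

lemma prod_remove_insert:
  assumes "finite I" "v \<notin> I" "i \<in> I"
  shows "(\<Prod>j\<in>insert v I - {i}. f j) = f v * (\<Prod>j\<in>I - {i}. f j)"
proof -
  have "insert v I - {i} = insert v (I - {i})" using assms by auto
  then show ?thesis using assms by simp
qed

text \<open>Partial fractions in \<open>w\<close>: the residue at \<open>w = i\<close> is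
  \<open>(1 - q) * i\<close> times the product over \<open>I - {i}\<close>. Since the poles appear
  as \<open>w / (w - i)\<close>, the constant term is the value at \<open>w = 0\<close>, where every
  factor with nonzero \<open>i\<close> is \<open>q\<close>. The induction uses its hypothesis at
  \<open>w\<close> and at the new element \<open>v\<close>, hence the arbitrary
  \<open>w\<close>.\<close>

lemma prod_hl_factor_expand:
  assumes "finite I" "w \<notin> I"
  shows "(\<Prod>i\<in>I. hl_factor q w i) =
    q ^ card I + (\<Sum>i\<in>I. (1 - q) * w / (w - i) * (\<Prod>j\<in>I - {i}. hl_factor q i j))"
  using assms
proof (induction I arbitrary: w rule: finite_induct)
  case (insert v I)
  define A where "A i = (\<Prod>j\<in>I - {i}. hl_factor q i j)" for i
  from insert have wv: "w \<noteq> v" "w \<notin> I" by auto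
  \<comment> \<open>The sum over \<open>insert v I\<close> consists of the pole at \<open>v\<close>,
    whose residue is expanded again by the hypothesis, and the poles at \<open>i\<close>. Matching
    the terms with the same \<open>i\<close> makes the new sum a multiple of the old one; the
    following lemmas work in the same way.\<close>
  have t: "(1 - q) * w / (w - v) * ((1 - q) * v / (v - i) * A i)
      + (1 - q) * w / (w - i) * (hl_factor q i v * A i) = hl_factor q w v * ((1 - q) * w / (w - i) * A i)"
    if "i \<in> I" for i
  proof -
    have "i \<noteq> v" "i \<noteq> w" using that insert.hyps wv by auto
    then show ?thesis using wv unfolding hl_factor_def
      by (simp add: divide_simps) (simp add: algebra_simps)
  qed
  have "(\<Sum>i\<in>insert v I. (1 - q) * w / (w - i) * (\<Prod>j\<in>insert v I - {i}. hl_factor q i j))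
     = (1 - q) * w / (w - v) * (\<Prod>j\<in>I. hl_factor q v j)
       + (\<Sum>i\<in>I. (1 - q) * w / (w - i) * (hl_factor q i v * A i))"
    using insert.hyps by (simp add: prod_remove_insert A_def)
  also have "\<dots> = (1 - q) * w / (w - v) * q ^ card I +
      (\<Sum>i\<in>I. (1 - q) * w / (w - v) * ((1 - q) * v / (v - i) * A i)
        + (1 - q) * w / (w - i) * (hl_factor q i v * A i))"
    by (subst insert.IH[OF insert.hyps(2)])
      (simp add: sum.distrib sum_distrib_left distrib_left A_def)
  also have "\<dots> = (1 - q) * w / (w - v) * q ^ card I +
      hl_factor q w v * (\<Sum>i\<in>I. (1 - q) * w / (w - i) * A i)"
    by (simp only: t sum_distrib_left cong: sum.cong)
  finally have s: "(\<Sum>i\<in>insert v I. (1 - q) * w / (w - i) * (\<Prod>j\<in>insert v I - {i}. hl_factor q i j)) =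
      (1 - q) * w / (w - v) * q ^ card I + hl_factor q w v * ((\<Prod>i\<in>I. hl_factor q w i) - q ^ card I)"
    by (simp add: insert.IH[OF wv(2)] A_def)
  have "q ^ card (insert v I) + (1 - q) * w / (w - v) * q ^ card I = hl_factor q w v * q ^ card I"
    using insert.hyps wv unfolding hl_factor_def by (simp add: divide_simps) (simp add: algebra_simps)
  then show ?case using insert.hyps unfolding s by (simp add: algebra_simps)
qed simp

text \<open>This is \<open>prod_hl_factor_expand\<close> as \<open>w\<close> tends to infinity,
  where each factor tends to 1. Induction replaces the limit.\<close>

lemma sum_prod_hl_factor:
  assumes "finite I"
  shows "(1 - q) * (\<Sum>i\<in>I. \<Prod>j\<in>I - {i}. hl_factor q i j) = 1 - q ^ card I"
  using assms
proof (induction I rule: finite_induct)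
  case (insert v I)
  define A where "A i = (\<Prod>j\<in>I - {i}. hl_factor q i j)" for i
  have t: "(1 - q) * v / (v - i) * A i + hl_factor q i v * A i = A i" if "i \<in> I" for i
  proof -
    have "i \<noteq> v" using that insert.hyps by auto
    then show ?thesis unfolding hl_factor_def
      by (simp add: divide_simps) (simp add: algebra_simps)
  qed
  have "(\<Sum>i\<in>insert v I. \<Prod>j\<in>insert v I - {i}. hl_factor q i j)
     = (\<Prod>j\<in>I. hl_factor q v j) + (\<Sum>i\<in>I. hl_factor q i v * A i)"
    using insert.hyps by (simp add: prod_remove_insert A_def)
  also have "\<dots> = q ^ card I + (\<Sum>i\<in>I. (1 - q) * v / (v - i) * A i + hl_factor q i v * A i)"
    by (simp add: prod_hl_factor_expand[OF insert.hyps(1,2)] sum.distrib A_def)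
  also have "\<dots> = q ^ card I + (\<Sum>i\<in>I. A i)" by (simp only: t sum_distrib_left cong: sum.cong)
  finally have "(1 - q) * (\<Sum>i\<in>insert v I. \<Prod>j\<in>insert v I - {i}. hl_factor q i j) =
     (1 - q) * q ^ card I + (1 - q) * (\<Sum>i\<in>I. A i)" by (simp only: algebra_simps)
  also have "(1 - q) * (\<Sum>i\<in>I. A i) = 1 - q ^ card I" using insert.IH by (simp add: A_def)
  finally show ?case using insert.hyps by (simp add: algebra_simps)
qed simp

text \<open>With the arguments exchanged, each factor with nonzero \<open>i\<close> is 1 at
  \<open>w = 0\<close>, which gives the constant term, and the residues change sign.\<close>

lemma prod_hl_factor_expand_converse:
  assumes "finite I" "w \<notin> I"
  shows "(\<Prod>i\<in>I. hl_factor q i w) =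
    1 - (\<Sum>i\<in>I. (1 - q) * w / (w - i) * (\<Prod>j\<in>I - {i}. hl_factor q j i))"
  using assms
proof (induction I arbitrary: w rule: finite_induct)
  case (insert v I)
  define A where "A i = (\<Prod>j\<in>I - {i}. hl_factor q j i)" for i
  from insert have wv: "w \<noteq> v" "w \<notin> I" by auto
  have t: "(1 - q) * w / (w - i) * (hl_factor q v i * A i) - (1 - q) * w / (w - v) * ((1 - q) * v / (v - i) * A i)
      = hl_factor q v w * ((1 - q) * w / (w - i) * A i)"
    if "i \<in> I" for i
  proof -
    have "i \<noteq> v" "i \<noteq> w" using that insert.hyps wv by auto
    then show ?thesis using wv unfolding hl_factor_def
      by (simp add: divide_simps) (simp add: algebra_simps)
  qed
  have "(\<Sum>i\<in>insert v I. (1 - q) * w / (w - i) * (\<Prod>j\<in>insert v I - {i}. hl_factor q j i))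
     = (1 - q) * w / (w - v) * (\<Prod>j\<in>I. hl_factor q j v)
       + (\<Sum>i\<in>I. (1 - q) * w / (w - i) * (hl_factor q v i * A i))"
    using insert.hyps by (simp add: prod_remove_insert A_def)
  also have "\<dots> = (1 - q) * w / (w - v) +
      (\<Sum>i\<in>I. (1 - q) * w / (w - i) * (hl_factor q v i * A i) - (1 - q) * w / (w - v) * ((1 - q) * v / (v - i) * A i))"
    by (subst insert.IH[OF insert.hyps(2)])
      (simp add: sum_subtractf sum_distrib_left right_diff_distrib A_def)
  also have "\<dots> = (1 - q) * w / (w - v) + hl_factor q v w * (\<Sum>i\<in>I. (1 - q) * w / (w - i) * A i)"
    by (simp only: t sum_distrib_left cong: sum.cong)
  finally have s: "(\<Sum>i\<in>insert v I. (1 - q) * w / (w - i) * (\<Prod>j\<in>insert v I - {i}. hl_factor q j i)) =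
      (1 - q) * w / (w - v) + hl_factor q v w * (1 - (\<Prod>i\<in>I. hl_factor q i w))"
    by (simp add: insert.IH[OF wv(2)] A_def)
  have "1 - (1 - q) * w / (w - v) = hl_factor q v w"
    using wv unfolding hl_factor_def by (simp add: divide_simps) (simp add: algebra_simps)
  then show ?case using insert.hyps unfolding s by (simp add: algebra_simps)
qed simp

text \<open>The behaviour of \<open>prod_hl_factor_expand_converse\<close> as \<open>w\<close> tends
  to infinity, where each factor tends to \<open>q\<close>.\<close>

lemma sum_prod_hl_factor_converse:
  assumes "finite I"
  shows "(1 - q) * (\<Sum>i\<in>I. \<Prod>j\<in>I - {i}. hl_factor q j i) = 1 - q ^ card I"
  using assms
proof (induction I rule: finite_induct)
  case (insert v I)
  define A where "A i = (\<Prod>j\<in>I - {i}. hl_factor q j i)" for i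
  have t: "hl_factor q v i * A i - (1 - q) * v / (v - i) * A i = q * A i" if "i \<in> I" for i
  proof -
    have "i \<noteq> v" using that insert.hyps by auto
    then show ?thesis unfolding hl_factor_def
      by (simp add: divide_simps) (simp add: algebra_simps)
  qed
  have "(\<Sum>i\<in>insert v I. \<Prod>j\<in>insert v I - {i}. hl_factor q j i)
     = (\<Prod>j\<in>I. hl_factor q j v) + (\<Sum>i\<in>I. hl_factor q v i * A i)"
    using insert.hyps by (simp add: prod_remove_insert A_def)
  also have "\<dots> = 1 + (\<Sum>i\<in>I. hl_factor q v i * A i - (1 - q) * v / (v - i) * A i)"
    by (simp add: prod_hl_factor_expand_converse[OF insert.hyps(1,2)] sum_subtractf A_def)
  also have "\<dots> = 1 + q * (\<Sum>i\<in>I. A i)" by (simp only: t sum_distrib_left cong: sum.cong)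
  finally have "(1 - q) * (\<Sum>i\<in>insert v I. \<Prod>j\<in>insert v I - {i}. hl_factor q j i) =
     1 - q + q * ((1 - q) * (\<Sum>i\<in>I. A i))" by (simp only: algebra_simps mult_1_left mult_1_right)
  also have "(1 - q) * (\<Sum>i\<in>I. A i) = 1 - q ^ card I" using insert.IH by (simp add: A_def)
  finally show ?case using insert.hyps by (simp add: algebra_simps)
qed simp

text \<open>Dividing by the full product of the \<open>hl_factor q w i\<close> replaces
  \<open>w - i\<close> by \<open>w - q * i\<close>: the identity is the partial fraction expansion
  of the reciprocal product, normalized at \<open>w = 0\<close>. The form chosen here avoids
  denominators that may vanish.\<close>

lemma sum_hl_factor_mixed:
  assumes "finite I" "w \<notin> I"
  shows "(\<Sum>i\<in>I. (1 - q) * w / (w - i) * (\<Prod>j\<in>I - {i}. hl_factor q j i) * (\<Prod>j\<in>I - {i}. hl_factor q w j)) =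
    (\<Prod>i\<in>I. hl_factor q w i) - q ^ card I"
  using assms
proof (induction I rule: finite_induct)
  case (insert v I)
  define A where "A i = (\<Prod>j\<in>I - {i}. hl_factor q j i)" for i
  define C where "C i = (\<Prod>j\<in>I - {i}. hl_factor q w j)" for i
  define Q where "Q = (\<Prod>i\<in>I. hl_factor q w i)"
  from insert have wv: "w \<noteq> v" "w \<notin> I" by auto
  have Q: "Q = hl_factor q w i * C i" if "i \<in> I" for i
    using insert.hyps that by (simp add: Q_def C_def prod.remove)
  have t: "(1 - q) * w / (w - i) * (hl_factor q v i * A i) * (hl_factor q w v * C i)
      - (1 - q) * w / (w - v) * ((1 - q) * v / (v - i) * A i) * Q
      = q * ((1 - q) * w / (w - i) * A i * C i)"
    if "i \<in> I" for i
  proof -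
    have "i \<noteq> v" "i \<noteq> w" using that insert.hyps wv by auto
    then show ?thesis using wv unfolding hl_factor_def Q[OF that]
      by (simp add: divide_simps) (simp add: algebra_simps)
  qed
  have "(\<Sum>i\<in>insert v I. (1 - q) * w / (w - i) * (\<Prod>j\<in>insert v I - {i}. hl_factor q j i)
        * (\<Prod>j\<in>insert v I - {i}. hl_factor q w j))
     = (1 - q) * w / (w - v) * (\<Prod>j\<in>I. hl_factor q j v) * Q
       + (\<Sum>i\<in>I. (1 - q) * w / (w - i) * (hl_factor q v i * A i) * (hl_factor q w v * C i))"
    using insert.hyps by (simp add: prod_remove_insert A_def C_def Q_def)
  also have "\<dots> = (1 - q) * w / (w - v) * Q +
      (\<Sum>i\<in>I. (1 - q) * w / (w - i) * (hl_factor q v i * A i) * (hl_factor q w v * C i)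
      - (1 - q) * w / (w - v) * ((1 - q) * v / (v - i) * A i) * Q)"
    by (subst prod_hl_factor_expand_converse[OF insert.hyps(1,2)])
      (simp add: sum_subtractf sum_distrib_left sum_distrib_right right_diff_distrib left_diff_distrib A_def)
  also have "\<dots> = (1 - q) * w / (w - v) * Q + q * (\<Sum>i\<in>I. (1 - q) * w / (w - i) * A i * C i)"
    by (simp only: t sum_distrib_left cong: sum.cong)
  also have "\<dots> = (1 - q) * w / (w - v) * Q + q * (Q - q ^ card I)"
    using insert.IH[OF wv(2)] by (simp add: A_def C_def Q_def)
  also have "\<dots> = ((1 - q) * w / (w - v) + q) * Q - q ^ Suc (card I)"
    by (simp add: algebra_simps)
  also have "(1 - q) * w / (w - v) + q = hl_factor q w v"
    using wv unfolding hl_factor_def by (simp add: divide_simps) (simp add: algebra_simps)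
  finally show ?case using insert.hyps by (simp add: Q_def)
qed simp

text \<open>The same expansion of the reciprocal product, normalized at infinity instead. For empty
  \<open>I\<close> the truncated exponent is harmless, as the other factor is 0.\<close>

lemma sum_hl_factor_mixed_shift:
  assumes "finite I" "w \<notin> I"
  shows "(\<Sum>i\<in>I. (1 - q) * i / (w - i) * (\<Prod>j\<in>I - {i}. hl_factor q j i) * (\<Prod>j\<in>I - {i}. hl_factor q w j)) =
    q ^ (card I - 1) * ((\<Prod>i\<in>I. hl_factor q w i) - 1)"
  using assms
proof (induction I rule: finite_induct)
  case (insert v I)
  define A where "A i = (\<Prod>j\<in>I - {i}. hl_factor q j i)" for i
  define C where "C i = (\<Prod>j\<in>I - {i}. hl_factor q w j)" for i
  define Q where "Q = (\<Prod>i\<in>I. hl_factor q w i)"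
  from insert have wv: "w \<noteq> v" "w \<notin> I" by auto
  have Q: "Q = hl_factor q w i * C i" if "i \<in> I" for i
    using insert.hyps that by (simp add: Q_def C_def prod.remove)
  have t: "(1 - q) * i / (w - i) * (hl_factor q v i * A i) * (hl_factor q w v * C i)
      - (1 - q) * v / (w - v) * ((1 - q) * i / (v - i) * A i) * Q
      = q * ((1 - q) * i / (w - i) * A i * C i)"
    if "i \<in> I" for i
  proof -
    have "i \<noteq> v" "i \<noteq> w" using that insert.hyps wv by auto
    then show ?thesis using wv unfolding hl_factor_def Q[OF that]
      by (simp add: divide_simps) (simp add: algebra_simps)
  qed
  have "(1 - q) * v / (v - i) * A i = (1 - q) * i / (v - i) * A i + (1 - q) * A i" if "i \<in> I" for i
  proof -
    have "i \<noteq> v" using that insert.hyps by auto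
    then show ?thesis by (simp add: divide_simps) (simp add: algebra_simps)
  qed
  \<comment> \<open>The expansion at \<open>v\<close> is renormalized at infinity:
    \<open>v / (v - i) = 1 + i / (v - i)\<close>, and the constants add up by
    \<open>sum_prod_hl_factor_converse\<close>.\<close>
  then have Bv: "(\<Prod>j\<in>I. hl_factor q j v) = q ^ card I - (\<Sum>i\<in>I. (1 - q) * i / (v - i) * A i)"
    using sum_prod_hl_factor_converse[OF insert.hyps(1), of q]
    by (simp add: prod_hl_factor_expand_converse[OF insert.hyps(1,2)] sum.distrib flip: A_def sum_distrib_left)
  have "(\<Sum>i\<in>insert v I. (1 - q) * i / (w - i) * (\<Prod>j\<in>insert v I - {i}. hl_factor q j i)
        * (\<Prod>j\<in>insert v I - {i}. hl_factor q w j))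
     = (1 - q) * v / (w - v) * (\<Prod>j\<in>I. hl_factor q j v) * Q
       + (\<Sum>i\<in>I. (1 - q) * i / (w - i) * (hl_factor q v i * A i) * (hl_factor q w v * C i))"
    using insert.hyps by (simp add: prod_remove_insert A_def C_def Q_def)
  also have "\<dots> = (1 - q) * v / (w - v) * q ^ card I * Q +
      (\<Sum>i\<in>I. (1 - q) * i / (w - i) * (hl_factor q v i * A i) * (hl_factor q w v * C i)
      - (1 - q) * v / (w - v) * ((1 - q) * i / (v - i) * A i) * Q)"
    by (subst Bv)
      (simp add: sum_subtractf sum_distrib_left sum_distrib_right right_diff_distrib left_diff_distrib)
  also have "\<dots> = (1 - q) * v / (w - v) * q ^ card I * Q + q * (\<Sum>i\<in>I. (1 - q) * i / (w - i) * A i * C i)"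
    by (simp only: t sum_distrib_left cong: sum.cong)
  also have "\<dots> = (1 - q) * v / (w - v) * q ^ card I * Q + q * (q ^ (card I - 1) * (Q - 1))"
    using insert.IH[OF wv(2)] by (simp add: A_def C_def Q_def)
  also have "q * (q ^ (card I - 1) * (Q - 1)) = q ^ card I * (Q - 1)"
    using insert.hyps by (cases "card I") (auto simp: Q_def)
  also have "(1 - q) * v / (w - v) * q ^ card I * Q + q ^ card I * (Q - 1)
      = q ^ card I * (((1 - q) * v / (w - v) + 1) * Q - 1)"
    by (simp add: algebra_simps)
  also have "(1 - q) * v / (w - v) + 1 = hl_factor q w v"
    using wv unfolding hl_factor_def by (simp add: divide_simps) (simp add: algebra_simps)
  finally show ?case using insert.hyps by (simp add: Q_def)
qed simp

text \<open>Partial fractions of the product of the \<open>hl_factor q w j\<close> divided by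
  \<open>1 - a * w\<close>. The additional pole at \<open>w = 1 / a\<close>, where
  \<open>hl_factor q w j\<close> equals \<open>(1 - a * q * j) / (1 - a * j)\<close>, produces the
  product outside the sum. Column 0 will need this with \<open>a = q ^ k * s\<close>.\<close>

lemma prod_hl_factor_expand_linear:
  assumes "finite I" "w \<notin> I"
  shows "(1 - a * w) * (\<Sum>i\<in>I. (1 - q) * i / (w - i) * (\<Prod>j\<in>I - {i}. hl_factor q i j) * (\<Prod>j\<in>I - {i}. 1 - a * j))
     + (\<Prod>j\<in>I. 1 - a * q * j) = (\<Prod>j\<in>I. 1 - a * j) * (\<Prod>j\<in>I. hl_factor q w j)"
  using assms
proof (induction I arbitrary: w rule: finite_induct)
  case (insert v I)
  define A where "A i = (\<Prod>j\<in>I - {i}. hl_factor q i j)" for i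
  define C where "C i = (\<Prod>j\<in>I - {i}. 1 - a * j)" for i
  define E where "E = (\<Prod>j\<in>I. 1 - a * q * j)"
  define S where "S = (\<Sum>i\<in>I. (1 - q) * i / (w - i) * A i * C i)"
  from insert have wv: "w \<noteq> v" "w \<notin> I" by auto
  have t: "(1 - q) * i / (w - i) * (hl_factor q i v * A i) * ((1 - a * v) * C i)
      + (1 - q) * v / (w - v) * ((1 - a * v) * ((1 - q) * i / (v - i) * A i * C i))
      = (1 - a * v) * hl_factor q w v * ((1 - q) * i / (w - i) * A i * C i)"
    if "i \<in> I" for i
  proof -
    have "i \<noteq> v" "i \<noteq> w" using that insert.hyps wv by auto
    then have "(1 - q) * i / (w - i) * hl_factor q i v + (1 - q) * v / (w - v) * ((1 - q) * i / (v - i))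
       = hl_factor q w v * ((1 - q) * i / (w - i))" using wv unfolding hl_factor_def
      by (simp add: divide_simps) (simp add: algebra_simps)
    from arg_cong[OF this, of "\<lambda>z. (1 - a * v) * A i * C i * z"] show ?thesis
      by (simp only: algebra_simps)
  qed
  have "(\<Sum>i\<in>insert v I. (1 - q) * i / (w - i) * (\<Prod>j\<in>insert v I - {i}. hl_factor q i j)
        * (\<Prod>j\<in>insert v I - {i}. 1 - a * j))
     = (1 - q) * v / (w - v) * ((\<Prod>j\<in>I. 1 - a * j) * (\<Prod>j\<in>I. hl_factor q v j))
       + (\<Sum>i\<in>I. (1 - q) * i / (w - i) * (hl_factor q i v * A i) * ((1 - a * v) * C i))"
    using insert.hyps by (simp add: prod_remove_insert A_def C_def)
  also have "\<dots> = (1 - q) * v / (w - v) * E +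
      (\<Sum>i\<in>I. (1 - q) * i / (w - i) * (hl_factor q i v * A i) * ((1 - a * v) * C i)
      + (1 - q) * v / (w - v) * ((1 - a * v) * ((1 - q) * i / (v - i) * A i * C i)))"
    by (subst insert.IH[OF insert.hyps(2), symmetric])
      (simp add: sum.distrib sum_distrib_left distrib_left A_def C_def E_def)
  also have "\<dots> = (1 - q) * v / (w - v) * E + (1 - a * v) * hl_factor q w v * S"
    by (simp only: t sum_distrib_left S_def cong: sum.cong)
  finally have s: "(\<Sum>i\<in>insert v I. (1 - q) * i / (w - i) * (\<Prod>j\<in>insert v I - {i}. hl_factor q i j)
        * (\<Prod>j\<in>insert v I - {i}. 1 - a * j)) = (1 - q) * v / (w - v) * E + (1 - a * v) * hl_factor q w v * S" .
  have e: "(1 - a * w) * ((1 - q) * v / (w - v)) + (1 - a * q * v) = (1 - a * v) * hl_factor q w v"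
    using wv unfolding hl_factor_def by (simp add: divide_simps) (simp add: algebra_simps)
  have "(1 - a * w) * ((1 - q) * v / (w - v) * E + (1 - a * v) * hl_factor q w v * S) + (1 - a * q * v) * E
     = ((1 - a * w) * ((1 - q) * v / (w - v)) + (1 - a * q * v)) * E + (1 - a * v) * hl_factor q w v * ((1 - a * w) * S)"
    by (simp add: algebra_simps)
  also have "\<dots> = (1 - a * v) * hl_factor q w v * ((1 - a * w) * S + E)"
    unfolding e by (simp add: algebra_simps)
  also have "(1 - a * w) * S + E = (\<Prod>j\<in>I. 1 - a * j) * (\<Prod>j\<in>I. hl_factor q w j)"
    using insert.IH[OF wv(2)] by (simp add: S_def A_def C_def E_def)
  finally show ?case unfolding s using insert.hyps by (simp add: E_def algebra_simps)
qed simp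

section \<open>The row operator\<close>

definition swap_coeff :: "complex \<Rightarrow> complex \<Rightarrow> complex \<Rightarrow> complex" where
  "swap_coeff q w i = (1 - q) * w / (w - i)"

text \<open>The split \<open>i - s = (w - s) - (w - i)\<close> leaves one sum with the pole and one
  in which the pole cancels.\<close>

lemma sum_swap_coeff_prod_hl_factor:
  assumes "finite I" "w \<notin> I"
  shows "(\<Sum>i\<in>I. swap_coeff q w i * (i - s) * (\<Prod>j\<in>I - {i}. hl_factor q i j)) =
    (w - s) * (\<Prod>i\<in>I. hl_factor q w i) - w + s * q ^ card I"
proof -
  define A where "A i = (\<Prod>j\<in>I - {i}. hl_factor q i j)" for i
  have t: "swap_coeff q w i * (i - s) * A i = (w - s) * ((1 - q) * w / (w - i) * A i) - w * ((1 - q) * A i)"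
    if "i \<in> I" for i
  proof -
    have "i \<noteq> w" using that assms by auto
    then show ?thesis by (simp add: swap_coeff_def divide_simps) (simp add: algebra_simps)
  qed
  have "(\<Sum>i\<in>I. swap_coeff q w i * (i - s) * A i) =
     (w - s) * (\<Sum>i\<in>I. (1 - q) * w / (w - i) * A i) - w * ((1 - q) * (\<Sum>i\<in>I. A i))"
    by (simp only: t sum_subtractf sum_distrib_left cong: sum.cong)
  also have "\<dots> = (w - s) * ((\<Prod>i\<in>I. hl_factor q w i) - q ^ card I) - w * (1 - q ^ card I)"
    using prod_hl_factor_expand[OF assms, of q] sum_prod_hl_factor[OF assms(1), of q] by (simp add: A_def)
  finally show ?thesis by (simp add: A_def algebra_simps)
qed

text \<open>Here the pole is separated by
  \<open>1 - s * i = (1 - s * w) + s * (w - i)\<close>.\<close>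

lemma sum_swap_coeff_prod_hl_factor_converse:
  assumes "finite I" "w \<notin> I"
  shows "(\<Sum>i\<in>I. swap_coeff q w i * (1 - s * i) * (\<Prod>j\<in>I - {i}. hl_factor q j i)) =
    (1 - s * q ^ card I * w) - (1 - s * w) * (\<Prod>i\<in>I. hl_factor q i w)"
proof -
  define A where "A i = (\<Prod>j\<in>I - {i}. hl_factor q j i)" for i
  have t: "swap_coeff q w i * (1 - s * i) * A i = (1 - s * w) * ((1 - q) * w / (w - i) * A i) + s * w * ((1 - q) * A i)"
    if "i \<in> I" for i
  proof -
    have "i \<noteq> w" using that assms by auto
    then show ?thesis by (simp add: swap_coeff_def divide_simps) (simp add: algebra_simps)
  qed
  have "(\<Sum>i\<in>I. swap_coeff q w i * (1 - s * i) * A i) =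
     (1 - s * w) * (\<Sum>i\<in>I. (1 - q) * w / (w - i) * A i) + s * w * ((1 - q) * (\<Sum>i\<in>I. A i))"
    by (simp only: t sum.distrib sum_distrib_left cong: sum.cong)
  also have "\<dots> = (1 - s * w) * (1 - (\<Prod>i\<in>I. hl_factor q i w)) + s * w * (1 - q ^ card I)"
    using prod_hl_factor_expand_converse[OF assms, of q] sum_prod_hl_factor_converse[OF assms(1), of q] by (simp add: A_def)
  finally show ?thesis by (simp add: A_def algebra_simps)
qed

text \<open>The two terms of \<open>1 - s * i\<close> lead to the two normalizations of the
  expansion of the reciprocal product.\<close>

lemma sum_swap_coeff_prod_hl_factor_both:
  assumes "finite I" "w \<notin> I"
  shows "(\<Sum>i\<in>I. swap_coeff q w i * (1 - s * i) * (\<Prod>j\<in>I - {i}. hl_factor q j i) * (\<Prod>j\<in>I - {i}. hl_factor q w j)) =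
    (\<Prod>i\<in>I. hl_factor q w i) - q ^ card I - s * w * q ^ (card I - 1) * ((\<Prod>i\<in>I. hl_factor q w i) - 1)"
proof -
  define A where "A i = (\<Prod>j\<in>I - {i}. hl_factor q j i) * (\<Prod>j\<in>I - {i}. hl_factor q w j)" for i
  have t: "swap_coeff q w i * (1 - s * i) * A i = (1 - q) * w / (w - i) * A i - s * w * ((1 - q) * i / (w - i) * A i)"
    if "i \<in> I" for i
  proof -
    have "i \<noteq> w" using that assms by auto
    then show ?thesis by (simp add: swap_coeff_def divide_simps) (simp add: algebra_simps)
  qed
  have "(\<Sum>i\<in>I. swap_coeff q w i * (1 - s * i) * A i) =
     (\<Sum>i\<in>I. (1 - q) * w / (w - i) * A i) - s * w * (\<Sum>i\<in>I. (1 - q) * i / (w - i) * A i)"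
    by (simp only: t sum_subtractf sum_distrib_left cong: sum.cong)
  also have "(\<Sum>i\<in>I. (1 - q) * w / (w - i) * A i) = (\<Prod>i\<in>I. hl_factor q w i) - q ^ card I"
    using sum_hl_factor_mixed[OF assms, of q] by (simp add: A_def mult.assoc)
  also have "(\<Sum>i\<in>I. (1 - q) * i / (w - i) * A i) = q ^ (card I - 1) * ((\<Prod>i\<in>I. hl_factor q w i) - 1)"
    using sum_hl_factor_mixed_shift[OF assms, of q] by (simp add: A_def mult.assoc)
  finally show ?thesis by (simp add: A_def mult.assoc)
qed

section \<open>Sums over subsets and their elements\<close>

lemma sum_Pow_insert:
  assumes "finite U" "w \<notin> U"
  shows "(\<Sum>K\<in>Pow (insert w U). g K) = (\<Sum>K\<in>Pow U. g K) + (\<Sum>K\<in>Pow U. g (insert w K))"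
proof -
  have "inj_on (insert w) (Pow U)"
    using assms by (intro inj_on_inverseI[of _ "\<lambda>x. x - {w}"]) auto
  moreover have "Pow U \<inter> insert w ` Pow U = {}" using assms by auto
  ultimately show ?thesis
    using assms by (simp add: Pow_insert sum.union_disjoint sum.reindex)
qed

text \<open>The substitution \<open>K = J - {i}\<close> collects exchange terms, which remove
  \<open>i\<close> from \<open>J\<close>, by the set that remains.\<close>

lemma sum_Pow_elem:
  assumes "finite U"
  shows "(\<Sum>J\<in>Pow U. \<Sum>i\<in>J. g J i) = (\<Sum>K\<in>Pow U. \<Sum>i\<in>U - K. g (insert i K) i)"
proof -
  have fin: "finite J" if "J \<in> Pow U" for J using that assms finite_subset by auto
  have "(\<Sum>J\<in>Pow U. \<Sum>i\<in>J. g J i) = (\<Sum>(J, i)\<in>(SIGMA J:Pow U. J). g J i)"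
    using assms fin by (subst sum.Sigma) auto
  also have "\<dots> = (\<Sum>(K, i)\<in>(SIGMA K:Pow U. U - K). g (insert i K) i)"
    by (rule sum.reindex_bij_witness[of _ "\<lambda>(K, i). (insert i K, i)" "\<lambda>(J, i). (J - {i}, i)"])
      (auto simp: insert_absorb)
  also have "\<dots> = (\<Sum>K\<in>Pow U. \<Sum>i\<in>U - K. g (insert i K) i)"
    using assms by (subst sum.Sigma) auto
  finally show ?thesis .
qed

lemma sum_elem_Pow:
  assumes "finite U"
  shows "(\<Sum>i\<in>U. \<Sum>K\<in>Pow (U - {i}). g K i) = (\<Sum>K\<in>Pow U. \<Sum>i\<in>U - K. g K i)"
proof -
  have "(\<Sum>i\<in>U. \<Sum>K\<in>Pow (U - {i}). g K i) = (\<Sum>(i, K)\<in>(SIGMA i:U. Pow (U - {i})). g K i)"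
    using assms by (subst sum.Sigma) auto
  also have "\<dots> = (\<Sum>(K, i)\<in>(SIGMA K:Pow U. U - K). g K i)"
    by (rule sum.reindex_bij_witness[of _ "\<lambda>(K, i). (i, K)" "\<lambda>(i, K). (K, i)"]) auto
  also have "\<dots> = (\<Sum>K\<in>Pow U. \<Sum>i\<in>U - K. g K i)"
    using assms by (subst sum.Sigma) auto
  finally show ?thesis .
qed

text \<open>A configuration of vertical edges between two rows is the list of its occupation numbers, column
  by column. The operator adds a row on top: \<open>a\<close> paths enter it from the left and none leaves it on the
  right. In each column the occupation number \<open>m\<close> above and the number \<open>b\<close> of paths leaving to the East
  determine the occupation number \<open>m + b - a\<close> below.\<close>

primrec row_op :: "complex \<Rightarrow> complex \<Rightarrow> complex \<Rightarrow> nat \<Rightarrow> (nat list \<Rightarrow> complex) \<Rightarrow> nat list \<Rightarrow> complex" where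
  "row_op q s w a \<Phi> [] = (if a = 0 then \<Phi> [] else 0)"
| "row_op q s w a \<Phi> (m # ms) = (\<Sum>b\<in>{0, 1}. if a \<le> m + b then
     vertex_weight q s w (m + b - a) a m b * row_op q s w b (\<lambda>ks. \<Phi> ((m + b - a) # ks)) ms else 0)"

lemma vertex_weight_simps:
  "vertex_weight q s w m 0 m 0 = (1 - s * q ^ m * w) / (1 - s * w)"
  "vertex_weight q s w m (Suc 0) m (Suc 0) = (w - s * q ^ m) / (1 - s * w)"
  "vertex_weight q s w (Suc m) 0 m (Suc 0) = (1 - s\<^sup>2 * q ^ m) * w / (1 - s * w)"
  "vertex_weight q s w m (Suc 0) (Suc m) 0 = (1 - q ^ Suc m) / (1 - s * w)"
  by (simp_all add: vertex_weight_def)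

lemma row_op_0_Cons:
  "row_op q s w 0 \<Phi> (m # ms) =
     (1 - s * q ^ m * w) / (1 - s * w) * row_op q s w 0 (\<lambda>ks. \<Phi> (m # ks)) ms +
     (1 - s\<^sup>2 * q ^ m) * w / (1 - s * w) * row_op q s w (Suc 0) (\<lambda>ks. \<Phi> (Suc m # ks)) ms"
  by (simp add: vertex_weight_simps)

lemma row_op_1_Cons:
  "row_op q s w (Suc 0) \<Phi> (m # ms) =
     (if m = 0 then 0 else (1 - q ^ m) / (1 - s * w) * row_op q s w 0 (\<lambda>ks. \<Phi> ((m - 1) # ks)) ms) +
     (w - s * q ^ m) / (1 - s * w) * row_op q s w (Suc 0) (\<lambda>ks. \<Phi> (m # ks)) ms"
  by (cases m) (simp_all add: vertex_weight_simps)

lemma row_op_sum: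
  "row_op q s w a (\<lambda>ks. \<Sum>J\<in>S. c J * \<Phi> J ks) ms = (\<Sum>J\<in>S. c J * row_op q s w a (\<Phi> J) ms)"
proof (induction ms arbitrary: a \<Phi>)
  case (Cons m ms)
  have *: "(if a \<le> m + b then vertex_weight q s w (m + b - a) a m b *
       row_op q s w b (\<lambda>ks. \<Sum>J\<in>S. c J * \<Phi> J ((m + b - a) # ks)) ms else 0) =
     (\<Sum>J\<in>S. c J * (if a \<le> m + b then vertex_weight q s w (m + b - a) a m b *
       row_op q s w b (\<lambda>ks. \<Phi> J ((m + b - a) # ks)) ms else 0))" for b
    using Cons[of b "\<lambda>J ks. \<Phi> J ((m + b - a) # ks)"]
    by (simp add: sum_distrib_left mult.left_commute)
  show ?case
    unfolding row_op.simps * sum_distrib_left by (rule sum.swap)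
qed simp

section \<open>One column of the symmetrized sum\<close>

definition cross :: "complex \<Rightarrow> complex set \<Rightarrow> complex set \<Rightarrow> complex" where
  "cross q K I = (\<Prod>j\<in>K. \<Prod>i\<in>I. hl_factor q j i)"

lemma cross_remove:
  assumes "finite I" "i \<in> I"
  shows "cross q K I = cross q K (I - {i}) * (\<Prod>j\<in>K. hl_factor q j i)"
  using assms by (simp add: cross_def prod.remove[of I i] prod.distrib mult.commute)

lemma cross_insert:
  assumes "finite K" "w \<notin> K"
  shows "cross q (insert w K) I = (\<Prod>i\<in>I. hl_factor q w i) * cross q K I"
  using assms by (simp add: cross_def)

text \<open>The contribution of one column up to the factor \<open>qpoch q q m\<close>. The
  variables in \<open>I\<close> belong to coordinates equal to this column and contribute their part
  of the prefactor of (i); those in \<open>K\<close> belong to larger coordinates and receive one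
  more factor of their power. Larger coordinates come first, so \<open>cross\<close> has the pairs
  with first element in \<open>K\<close>.\<close>

definition psi_base :: "complex \<Rightarrow> complex \<Rightarrow> complex set \<Rightarrow> complex set \<Rightarrow> complex" where
  "psi_base q s K I = (\<Prod>i\<in>I. 1 / (1 - s * i)) * (\<Prod>j\<in>K. (j - s) / (1 - s * j)) * cross q K I"

text \<open>The right-hand side of (i) as a function of a set \<open>U\<close> of variables and of the occupation numbers of
  \<open>\<mu>\<close>, computed column by column: \<open>J\<close> consists of the variables that the permutation assigns to the
  coordinates beyond the current column.\<close>

primrec psi :: "complex \<Rightarrow> complex \<Rightarrow> complex set \<Rightarrow> nat list \<Rightarrow> complex" where
  "psi q s U [] = (if U = {} then 1 else 0)"
| "psi q s U (m # ms) = (\<Sum>J\<in>Pow U. (if card (U - J) = m then qpoch q q m * psi_base q s J (U - J) else 0)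
     * psi q s J ms)"

lemma psi_base_remove:
  assumes "finite I" "i \<in> I" "1 - s * i \<noteq> 0"
  shows "(\<Prod>j\<in>K. hl_factor q j i) * psi_base q s K (I - {i}) = psi_base q s K I * (1 - s * i)"
  using assms by (simp add: psi_base_def cross_remove[of I i] prod.remove[of I i])

lemma psi_base_insert_left:
  assumes "finite K" "w \<notin> K"
  shows "psi_base q s (insert w K) I = psi_base q s K I * ((w - s) / (1 - s * w)) * (\<Prod>i\<in>I. hl_factor q w i)"
  using assms by (simp add: psi_base_def cross_insert)

lemma psi_base_insert_right:
  assumes "finite I" "w \<notin> I"
  shows "psi_base q s K (insert w I) = psi_base q s K I / (1 - s * w) * (\<Prod>j\<in>K. hl_factor q j w)"
  using assms cross_remove[of "insert w I" w q K] by (simp add: psi_base_def)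

text \<open>On both sides \<open>i\<close> is paired with all of \<open>K\<close> and of
  \<open>I - {i}\<close>. Keeping the product over \<open>K\<close> on the left avoids division by
  an \<open>hl_factor\<close>, which may vanish.\<close>

lemma psi_base_move:
  assumes "finite I" "finite K" "i \<in> I" "i \<notin> K" "1 - s * i \<noteq> 0"
  shows "psi_base q s (insert i K) (I - {i}) * (\<Prod>j\<in>K. hl_factor q j i) =
    psi_base q s K I * (i - s) * (\<Prod>j\<in>I - {i}. hl_factor q i j)"
proof -
  have "psi_base q s (insert i K) (I - {i}) * (\<Prod>j\<in>K. hl_factor q j i) =
     ((\<Prod>j\<in>K. hl_factor q j i) * psi_base q s K (I - {i})) * ((i - s) / (1 - s * i)) * (\<Prod>j\<in>I - {i}. hl_factor q i j)"
    using assms by (simp add: psi_base_insert_left)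
  also have "\<dots> = psi_base q s K I * (i - s) * (\<Prod>j\<in>I - {i}. hl_factor q i j)"
    using assms by (simp add: psi_base_remove)
  finally show ?thesis .
qed

lemma qpoch_Suc: "qpoch a q (Suc n) = qpoch a q n * (1 - a * q ^ n)"
  by (simp add: qpoch_def)

section \<open>Coefficient identities for one column of \<open>psi\<close>\<close>

context
  fixes q s w :: complex and K I :: "complex set"
  assumes fin: "finite I" "finite K" and disj: "I \<inter> K = {}" and w: "w \<notin> I" "w \<notin> K" "1 - s * w \<noteq> 0"
    and nz: "\<And>i. i \<in> I \<Longrightarrow> 1 - s * i \<noteq> 0"
begin

text \<open>The entering path stops in this column, so \<open>w\<close> joins the variables of the
  column and the weight supplies the next factor of \<open>qpoch q q\<close>.\<close>

lemma psi_coeff_one_keep: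
  "(1 - q ^ Suc (card I)) / (1 - s * w) * (qpoch q q (card I) * psi_base q s K I * (\<Prod>j\<in>K. hl_factor q j w)) =
     qpoch q q (Suc (card I)) * psi_base q s K (insert w I)"
  using fin w by (simp add: psi_base_insert_right qpoch_Suc)

lemma sum_psi_base_move:
  "(\<Sum>i\<in>I. psi_base q s (insert i K) (I - {i}) * (swap_coeff q w i * (\<Prod>j\<in>K. hl_factor q j i))) =
     psi_base q s K I * ((w - s) * (\<Prod>i\<in>I. hl_factor q w i) - w + s * q ^ card I)"
proof -
  have t: "psi_base q s (insert i K) (I - {i}) * (swap_coeff q w i * (\<Prod>j\<in>K. hl_factor q j i)) =
    psi_base q s K I * (swap_coeff q w i * (i - s) * (\<Prod>j\<in>I - {i}. hl_factor q i j))" if "i \<in> I" for i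
    using psi_base_move[of I K i s q] that fin disj nz by (auto simp: mult_ac)
  show ?thesis
    unfolding sum_swap_coeff_prod_hl_factor[OF fin(1) w(1), symmetric] by (simp only: t sum_distrib_left cong: sum.cong)
qed

text \<open>There are two ways for \<open>w\<close> to be passed on: the path stops here and the
  rest of the row exchanges some \<open>i\<close> for \<open>w\<close>, or the path goes on to the
  East. For empty \<open>I\<close> the weight \<open>1 - q ^ 0\<close> removes the first, so the
  truncated \<open>card I - 1\<close> is harmless.\<close>

lemma psi_coeff_one_insert:
  "(1 - q ^ card I) / (1 - s * w) * (\<Sum>i\<in>I. qpoch q q (card I - 1) * psi_base q s (insert i K) (I - {i})
       * (swap_coeff q w i * (\<Prod>j\<in>K. hl_factor q j i))) +
     (w - s * q ^ card I) / (1 - s * w) * (qpoch q q (card I) * psi_base q s K I) =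
     qpoch q q (card I) * psi_base q s (insert w K) I"
proof (cases "card I")
  case 0
  then show ?thesis using fin w by (simp add: psi_base_insert_left)
next
  case (Suc m)
  define Q where "Q = qpoch q q (card I)"
  have Q: "Q = qpoch q q (card I - 1) * (1 - q ^ card I)"
    using Suc by (simp add: Q_def qpoch_Suc)
  have "(1 - q ^ card I) / (1 - s * w) * (\<Sum>i\<in>I. qpoch q q (card I - 1) * psi_base q s (insert i K) (I - {i})
       * (swap_coeff q w i * (\<Prod>j\<in>K. hl_factor q j i))) = Q / (1 - s * w) *
       (\<Sum>i\<in>I. psi_base q s (insert i K) (I - {i}) * (swap_coeff q w i * (\<Prod>j\<in>K. hl_factor q j i)))"
    by (simp add: Q mult.assoc flip: sum_distrib_left)
  also have "\<dots> + (w - s * q ^ card I) / (1 - s * w) * (Q * psi_base q s K I) = Q * psi_base q s (insert w K) I"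
    unfolding sum_psi_base_move using fin w
    by (simp add: psi_base_insert_left divide_simps) (simp add: algebra_simps)
  finally show ?thesis by (simp add: Q_def)
qed

text \<open>The variables passed on remain \<open>K\<close>. On the right this comes from the
  diagonal term and from those exchanges in which \<open>w\<close> takes the place of a variable of
  this column and stays there.\<close>

lemma psi_coeff_zero_keep:
  "(1 - s * q ^ card I * w) / (1 - s * w) * (qpoch q q (card I) * psi_base q s K I * (\<Prod>j\<in>K. hl_factor q j w)) =
   (\<Prod>j\<in>K. hl_factor q j w) * (\<Prod>j\<in>I. hl_factor q j w) * (qpoch q q (card I) * psi_base q s K I) +
   (\<Sum>i\<in>I. swap_coeff q w i * ((\<Prod>j\<in>K. hl_factor q j i) * (\<Prod>j\<in>I - {i}. hl_factor q j i)) *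
      (qpoch q q (card I) * psi_base q s K (insert w (I - {i}))))"
proof -
  define C where "C = qpoch q q (card I) * psi_base q s K I * (\<Prod>j\<in>K. hl_factor q j w)"
  have t: "swap_coeff q w i * ((\<Prod>j\<in>K. hl_factor q j i) * (\<Prod>j\<in>I - {i}. hl_factor q j i)) *
      (qpoch q q (card I) * psi_base q s K (insert w (I - {i}))) =
      C / (1 - s * w) * (swap_coeff q w i * (1 - s * i) * (\<Prod>j\<in>I - {i}. hl_factor q j i))" if "i \<in> I" for i
  proof -
    have "swap_coeff q w i * ((\<Prod>j\<in>K. hl_factor q j i) * (\<Prod>j\<in>I - {i}. hl_factor q j i)) *
      (qpoch q q (card I) * psi_base q s K (insert w (I - {i}))) =
      swap_coeff q w i * (\<Prod>j\<in>I - {i}. hl_factor q j i) * qpoch q q (card I) *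
       ((\<Prod>j\<in>K. hl_factor q j i) * psi_base q s K (I - {i})) / (1 - s * w) * (\<Prod>j\<in>K. hl_factor q j w)"
      using fin w by (simp add: psi_base_insert_right)
    then show ?thesis
      by (simp add: psi_base_remove[OF fin(1) that nz[OF that]] C_def)
  qed
  have "(\<Sum>i\<in>I. swap_coeff q w i * ((\<Prod>j\<in>K. hl_factor q j i) * (\<Prod>j\<in>I - {i}. hl_factor q j i)) *
      (qpoch q q (card I) * psi_base q s K (insert w (I - {i})))) =
     C / (1 - s * w) * ((1 - s * q ^ card I * w) - (1 - s * w) * (\<Prod>i\<in>I. hl_factor q i w))"
    by (simp only: t sum_swap_coeff_prod_hl_factor_converse[OF fin(1) w(1), symmetric] sum_distrib_left cong: sum.cong)
  then show ?thesis using w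
    by (simp add: C_def divide_simps) (simp add: algebra_simps)
qed

text \<open>Now \<open>w\<close> is passed on, either because the rest of the row exchanges some
  \<open>i\<close> for it or because a path turns East here, so that \<open>Suc m\<close> paths were
  below. On the right both kinds of products occur, which is where the expansion of the reciprocal
  product enters.\<close>

lemma psi_coeff_zero_insert:
  assumes "card I = Suc m"
  shows
  "(1 - s * q ^ m * w) / (1 - s * w) * (\<Sum>i\<in>I. qpoch q q m * psi_base q s (insert i K) (I - {i})
       * (swap_coeff q w i * (\<Prod>j\<in>K. hl_factor q j i))) +
   (1 - s\<^sup>2 * q ^ m) * w / (1 - s * w) * (qpoch q q (Suc m) * psi_base q s K I) =
   (\<Sum>i\<in>I. swap_coeff q w i * ((\<Prod>j\<in>K. hl_factor q j i) * (\<Prod>j\<in>I - {i}. hl_factor q j i)) *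
      (qpoch q q m * psi_base q s (insert w K) (I - {i})))"
proof -
  define C where "C = qpoch q q m * psi_base q s K I"
  define P where "P = (\<Prod>i\<in>I. hl_factor q w i)"
  have t: "swap_coeff q w i * ((\<Prod>j\<in>K. hl_factor q j i) * (\<Prod>j\<in>I - {i}. hl_factor q j i)) *
      (qpoch q q m * psi_base q s (insert w K) (I - {i})) =
      C * ((w - s) / (1 - s * w)) * (swap_coeff q w i * (1 - s * i) * (\<Prod>j\<in>I - {i}. hl_factor q j i) * (\<Prod>j\<in>I - {i}. hl_factor q w j))"
      if "i \<in> I" for i
  proof -
    have "swap_coeff q w i * ((\<Prod>j\<in>K. hl_factor q j i) * (\<Prod>j\<in>I - {i}. hl_factor q j i)) *
      (qpoch q q m * psi_base q s (insert w K) (I - {i})) =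
      swap_coeff q w i * (\<Prod>j\<in>I - {i}. hl_factor q j i) * qpoch q q m *
       ((\<Prod>j\<in>K. hl_factor q j i) * psi_base q s K (I - {i})) * ((w - s) / (1 - s * w)) * (\<Prod>j\<in>I - {i}. hl_factor q w j)"
      using fin w by (simp add: psi_base_insert_left)
    then show ?thesis
      by (simp add: psi_base_remove[OF fin(1) that nz[OF that]] C_def)
  qed
  have r: "(\<Sum>i\<in>I. swap_coeff q w i * ((\<Prod>j\<in>K. hl_factor q j i) * (\<Prod>j\<in>I - {i}. hl_factor q j i)) *
      (qpoch q q m * psi_base q s (insert w K) (I - {i}))) =
     C * ((w - s) / (1 - s * w)) * (P - q ^ Suc m - s * w * q ^ m * (P - 1))"
    using sum_swap_coeff_prod_hl_factor_both[OF fin(1) w(1), of q s] unfolding assms P_def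
    by (simp only: t sum_distrib_left[symmetric] cong: sum.cong) simp
  have "(\<Sum>i\<in>I. qpoch q q m * psi_base q s (insert i K) (I - {i})
       * (swap_coeff q w i * (\<Prod>j\<in>K. hl_factor q j i))) = C * ((w - s) * P - w + s * q ^ Suc m)"
    using sum_psi_base_move unfolding assms P_def C_def
    by (simp add: mult.assoc flip: sum_distrib_left)
  moreover have "qpoch q q (Suc m) * psi_base q s K I = C * (1 - q ^ Suc m)"
    by (simp add: C_def qpoch_Suc)
  ultimately show ?thesis unfolding r using w
    by (simp add: divide_simps) (simp add: algebra_simps power2_eq_square)
qed

end

text \<open>Linearity, followed by regrouping the exchange terms by the old variables
  \<open>K\<close> that remain. The coefficients \<open>c\<close> are arbitrary, so that both
  \<open>psi\<close> and \<open>gam\<close> are covered.\<close>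

lemma row_op_0_sum_psi:
  assumes "finite U"
    and row_op_psi: "\<And>J. J \<subseteq> U \<Longrightarrow> row_op q s w 0 (psi q s J) ms =
      (\<Prod>j\<in>J. hl_factor q j w) * psi q s J ms +
      (\<Sum>i\<in>J. swap_coeff q w i * (\<Prod>j\<in>J - {i}. hl_factor q j i) * psi q s (insert w (J - {i})) ms)"
  shows "row_op q s w 0 (\<lambda>ks. \<Sum>J\<in>Pow U. c J * psi q s J ks) ms =
    (\<Sum>K\<in>Pow U. c K * (\<Prod>j\<in>K. hl_factor q j w) * psi q s K ms) +
    (\<Sum>K\<in>Pow U. (\<Sum>i\<in>U - K. c (insert i K) * (swap_coeff q w i * (\<Prod>j\<in>K. hl_factor q j i))) * psi q s (insert w K) ms)"
proof -
  have "row_op q s w 0 (\<lambda>ks. \<Sum>J\<in>Pow U. c J * psi q s J ks) ms = (\<Sum>J\<in>Pow U. c J * row_op q s w 0 (psi q s J) ms)"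
    by (simp add: row_op_sum)
  also have "\<dots> = (\<Sum>J\<in>Pow U. c J * (\<Prod>j\<in>J. hl_factor q j w) * psi q s J ms) +
     (\<Sum>J\<in>Pow U. \<Sum>i\<in>J. c J * (swap_coeff q w i * (\<Prod>j\<in>J - {i}. hl_factor q j i) * psi q s (insert w (J - {i})) ms))"
    by (simp add: row_op_psi distrib_left sum.distrib sum_distrib_left mult.assoc)
  also have "(\<Sum>J\<in>Pow U. \<Sum>i\<in>J. c J * (swap_coeff q w i * (\<Prod>j\<in>J - {i}. hl_factor q j i) * psi q s (insert w (J - {i})) ms)) =
    (\<Sum>K\<in>Pow U. \<Sum>i\<in>U - K. c (insert i K) * (swap_coeff q w i * (\<Prod>j\<in>insert i K - {i}. hl_factor q j i)
       * psi q s (insert w (insert i K - {i})) ms))"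
    using sum_Pow_elem[OF assms(1)] .
  also have "\<dots> = (\<Sum>K\<in>Pow U. (\<Sum>i\<in>U - K. c (insert i K) * (swap_coeff q w i * (\<Prod>j\<in>K. hl_factor q j i))) * psi q s (insert w K) ms)"
    unfolding sum_distrib_right
  proof (intro sum.cong refl)
    fix K i assume "i \<in> U - K"
    then have "insert i K - {i} = K" by auto
    then show "c (insert i K) * (swap_coeff q w i * (\<Prod>j\<in>insert i K - {i}. hl_factor q j i) * psi q s (insert w (insert i K - {i})) ms) =
      c (insert i K) * (swap_coeff q w i * (\<Prod>j\<in>K. hl_factor q j i)) * psi q s (insert w K) ms"
      by (simp only: mult.assoc)
  qed
  finally show ?thesis .
qed

lemma card_Diff_insert_eq_iff:
  assumes "finite U" "i \<in> U - K"
  shows "card (U - insert i K) = m \<longleftrightarrow> card (U - K) = Suc m"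
proof -
  have "U - insert i K = U - K - {i}" by auto
  moreover have "Suc (card (U - K - {i})) = card (U - K)"
    using assms by (intro card_Suc_Diff1) auto
  ultimately show ?thesis by (metis nat.inject)
qed

lemma row_op_0_psi_Cons:
  assumes "finite U"
    and row_op_psi: "\<And>J. J \<subseteq> U \<Longrightarrow> row_op q s w 0 (psi q s J) ms =
      (\<Prod>j\<in>J. hl_factor q j w) * psi q s J ms +
      (\<Sum>i\<in>J. swap_coeff q w i * (\<Prod>j\<in>J - {i}. hl_factor q j i) * psi q s (insert w (J - {i})) ms)"
  shows "row_op q s w 0 (\<lambda>ks. psi q s U (m # ks)) ms =
    (\<Sum>K\<in>Pow U. (if card (U - K) = m then qpoch q q m * psi_base q s K (U - K) * (\<Prod>j\<in>K. hl_factor q j w) else 0)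
       * psi q s K ms) +
    (\<Sum>K\<in>Pow U. (if card (U - K) = Suc m then (\<Sum>i\<in>U - K. qpoch q q m * psi_base q s (insert i K) (U - K - {i})
       * (swap_coeff q w i * (\<Prod>j\<in>K. hl_factor q j i))) else 0) * psi q s (insert w K) ms)"
proof -
  define c where "c J = (if card (U - J) = m then qpoch q q m * psi_base q s J (U - J) else 0)" for J
  have r1: "c J * (\<Prod>j\<in>J. hl_factor q j w) =
    (if card (U - J) = m then qpoch q q m * psi_base q s J (U - J) * (\<Prod>j\<in>J. hl_factor q j w) else 0)" for J
    by (simp add: c_def)
  have r2: "(\<Sum>i\<in>U - K. c (insert i K) * (swap_coeff q w i * (\<Prod>j\<in>K. hl_factor q j i))) =
    (if card (U - K) = Suc m then (\<Sum>i\<in>U - K. qpoch q q m * psi_base q s (insert i K) (U - K - {i})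
       * (swap_coeff q w i * (\<Prod>j\<in>K. hl_factor q j i))) else 0)" for K
  proof -
    have "c (insert i K) = (if card (U - K) = Suc m then qpoch q q m * psi_base q s (insert i K) (U - K - {i}) else 0)"
      if "i \<in> U - K" for i
    proof -
      have "U - insert i K = U - K - {i}" by auto
      then show ?thesis
        by (simp only: c_def card_Diff_insert_eq_iff[OF assms(1) that, symmetric])
    qed
    note c = this
    show ?thesis
      by (cases "card (U - K) = Suc m") (simp_all only: c if_True if_False simp_thms mult_zero_left sum.neutral_const cong: sum.cong)
  qed
  show ?thesis
    using row_op_0_sum_psi[OF assms, of c] unfolding r1 r2 unfolding c_def psi.simps .
qed

lemma row_op_1_psi_Cons:
  assumes IH: "\<And>J. J \<subseteq> U \<Longrightarrow> row_op q s w (Suc 0) (psi q s J) ms = psi q s (insert w J) ms"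
  shows "row_op q s w (Suc 0) (\<lambda>ks. psi q s U (m # ks)) ms =
    (\<Sum>K\<in>Pow U. (if card (U - K) = m then qpoch q q m * psi_base q s K (U - K) else 0) * psi q s (insert w K) ms)"
  by (simp add: row_op_sum IH)

lemma psi_insert_Cons:
  assumes "finite U" "w \<notin> U"
  shows "psi q s (insert w U) (m # ms) =
    (\<Sum>K\<in>Pow U. (if Suc (card (U - K)) = m then qpoch q q m * psi_base q s K (insert w (U - K)) else 0) * psi q s K ms) +
    (\<Sum>K\<in>Pow U. (if card (U - K) = m then qpoch q q m * psi_base q s (insert w K) (U - K) else 0) * psi q s (insert w K) ms)"
proof -
  have 1: "insert w U - K = insert w (U - K)" "card (insert w (U - K)) = Suc (card (U - K))"
    "insert w U - insert w K = U - K" if "K \<in> Pow U" for K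
    using that assms by auto
  show ?thesis
    unfolding psi.simps sum_Pow_insert[OF assms]
    by (intro arg_cong2[of _ _ _ _ "(+)"] sum.cong refl) (simp_all only: 1)
qed

text \<open>The exchange terms of \<open>row_op_psi\<close> are sorted by the old variables
  \<open>K\<close> that are passed on: in the first sum \<open>w\<close> stays in the column, in the
  second it is passed on as well.\<close>

lemma psi_remove_insert_sum:
  assumes "finite U" "w \<notin> U"
  shows "(\<Sum>i\<in>U. swap_coeff q w i * (\<Prod>j\<in>U - {i}. hl_factor q j i) * psi q s (insert w (U - {i})) (m # ms)) =
    (\<Sum>K\<in>Pow U. (if card (U - K) = m then (\<Sum>i\<in>U - K. swap_coeff q w i * ((\<Prod>j\<in>K. hl_factor q j i) * (\<Prod>j\<in>U - K - {i}. hl_factor q j i)) *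
       (qpoch q q m * psi_base q s K (insert w (U - K - {i})))) else 0) * psi q s K ms) +
    (\<Sum>K\<in>Pow U. (if card (U - K) = Suc m then (\<Sum>i\<in>U - K. swap_coeff q w i * ((\<Prod>j\<in>K. hl_factor q j i) * (\<Prod>j\<in>U - K - {i}. hl_factor q j i)) *
       (qpoch q q m * psi_base q s (insert w K) (U - K - {i}))) else 0) * psi q s (insert w K) ms)"
proof -
  define g where "g i = swap_coeff q w i * (\<Prod>j\<in>U - {i}. hl_factor q j i)" for i
  define a where "a K i = g i * (if Suc (card (U - {i} - K)) = m then qpoch q q m * psi_base q s K (insert w (U - {i} - K)) else 0)" for K i
  define b where "b K i = g i * (if card (U - {i} - K) = m then qpoch q q m * psi_base q s (insert w K) (U - {i} - K) else 0)" for K i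
  have e: "g i * psi q s (insert w (U - {i})) (m # ms) =
     (\<Sum>K\<in>Pow (U - {i}). a K i * psi q s K ms + b K i * psi q s (insert w K) ms)" for i
  proof -
    have 1: "finite (U - {i})" "w \<notin> U - {i}" using assms by auto
    show ?thesis
      by (simp only: psi_insert_Cons[OF 1] a_def b_def distrib_left sum.distrib sum_distrib_left mult.assoc)
  qed
  have "(\<Sum>i\<in>U. g i * psi q s (insert w (U - {i})) (m # ms)) =
     (\<Sum>K\<in>Pow U. (\<Sum>i\<in>U - K. a K i) * psi q s K ms) + (\<Sum>K\<in>Pow U. (\<Sum>i\<in>U - K. b K i) * psi q s (insert w K) ms)"
    unfolding e sum_elem_Pow[OF assms(1)] by (simp only: sum.distrib sum_distrib_right)
  moreover have "(\<Sum>i\<in>U - K. a K i) = (if card (U - K) = m then (\<Sum>i\<in>U - K. swap_coeff q w i * ((\<Prod>j\<in>K. hl_factor q j i) * (\<Prod>j\<in>U - K - {i}. hl_factor q j i)) *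
       (qpoch q q m * psi_base q s K (insert w (U - K - {i})))) else 0)"
    "(\<Sum>i\<in>U - K. b K i) = (if card (U - K) = Suc m then (\<Sum>i\<in>U - K. swap_coeff q w i * ((\<Prod>j\<in>K. hl_factor q j i) * (\<Prod>j\<in>U - K - {i}. hl_factor q j i)) *
       (qpoch q q m * psi_base q s (insert w K) (U - K - {i}))) else 0)"
    if K: "K \<in> Pow U" for K
  proof -
    have f: "U - {i} - K = U - K - {i}" for i by auto
    have c: "Suc (card (U - K - {i})) = card (U - K)" "card (U - K - {i}) = m \<longleftrightarrow> card (U - K) = Suc m"
      if "i \<in> U - K" for i
      using that assms(1) card_Suc_Diff1[of "U - K" i] by auto
    have g: "g i = swap_coeff q w i * ((\<Prod>j\<in>K. hl_factor q j i) * (\<Prod>j\<in>U - K - {i}. hl_factor q j i))" if "i \<in> U - K" for i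
    proof -
      have "U - {i} = K \<union> (U - K - {i})" "K \<inter> (U - K - {i}) = {}" using that K by auto
      moreover have "finite K" using K assms(1) finite_subset by auto
      ultimately show ?thesis unfolding g_def using assms(1)
        by (metis finite_Diff prod.union_disjoint)
    qed
    show "(\<Sum>i\<in>U - K. a K i) = (if card (U - K) = m then (\<Sum>i\<in>U - K. swap_coeff q w i * ((\<Prod>j\<in>K. hl_factor q j i) * (\<Prod>j\<in>U - K - {i}. hl_factor q j i)) *
       (qpoch q q m * psi_base q s K (insert w (U - K - {i})))) else 0)"
      unfolding a_def f by (cases "card (U - K) = m") (simp_all only: c g if_True if_False simp_thms mult_zero_right sum.neutral_const cong: sum.cong)
    show "(\<Sum>i\<in>U - K. b K i) = (if card (U - K) = Suc m then (\<Sum>i\<in>U - K. swap_coeff q w i * ((\<Prod>j\<in>K. hl_factor q j i) * (\<Prod>j\<in>U - K - {i}. hl_factor q j i)) *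
       (qpoch q q m * psi_base q s (insert w K) (U - K - {i}))) else 0)"
      unfolding b_def f by (cases "card (U - K) = Suc m") (simp_all only: c g if_True if_False simp_thms mult_zero_right sum.neutral_const cong: sum.cong)
  qed
  ultimately show ?thesis by (simp add: g_def)
qed

text \<open>Without an incoming path, \<open>w\<close> either stays outside or takes the place of one of the variables, as
  in the algebraic Bethe ansatz. The two statements have to be proved together: expanding one column
  and comparing the coefficients of each \<open>psi K\<close> reduces them to the partial fraction identities.\<close>

lemma row_op_psi:
  assumes "finite U" "w \<notin> U" "1 - s * w \<noteq> 0" "\<And>i. i \<in> U \<Longrightarrow> 1 - s * i \<noteq> 0"
  shows "row_op q s w (Suc 0) (psi q s U) ms = psi q s (insert w U) ms \<and>
    row_op q s w 0 (psi q s U) ms = (\<Prod>j\<in>U. hl_factor q j w) * psi q s U ms +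
      (\<Sum>i\<in>U. swap_coeff q w i * (\<Prod>j\<in>U - {i}. hl_factor q j i) * psi q s (insert w (U - {i})) ms)"
  using assms
proof (induction ms arbitrary: U)
  case Nil
  then show ?case by auto
next
  case (Cons m ms)
  have sub: "finite J" "w \<notin> J" "\<And>i. i \<in> J \<Longrightarrow> 1 - s * i \<noteq> 0" if "J \<subseteq> U" for J
    using that Cons.prems finite_subset by auto
  have IH1: "row_op q s w (Suc 0) (psi q s J) ms = psi q s (insert w J) ms" if "J \<subseteq> U" for J
    using Cons.IH[OF sub(1,2)[OF that] Cons.prems(3) sub(3)[OF that]] by simp
  have IH0: "row_op q s w 0 (psi q s J) ms = (\<Prod>j\<in>J. hl_factor q j w) * psi q s J ms +
      (\<Sum>i\<in>J. swap_coeff q w i * (\<Prod>j\<in>J - {i}. hl_factor q j i) * psi q s (insert w (J - {i})) ms)" if "J \<subseteq> U" for J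
    using Cons.IH[OF sub(1,2)[OF that] Cons.prems(3) sub(3)[OF that]] by simp
  note expand0 = row_op_0_psi_Cons[OF Cons.prems(1) IH0]
  note expand1 = row_op_1_psi_Cons[OF IH1]
  have coeff: "finite (U - K)" "finite K" "(U - K) \<inter> K = {}" "w \<notin> U - K" "w \<notin> K" "1 - s * w \<noteq> 0"
    "\<And>i. i \<in> U - K \<Longrightarrow> 1 - s * i \<noteq> 0" if "K \<in> Pow U" for K
    using that Cons.prems finite_subset by auto
  have B: "row_op q s w (Suc 0) (psi q s U) (m # ms) = psi q s (insert w U) (m # ms)"
  proof (cases m)
    \<comment> \<open>With no path above the row in this column, the entering path has to go on to
      the East.\<close>
    case 0
    have "(w - s * q ^ m) / (1 - s * w) * (if card (U - K) = m then qpoch q q m * psi_base q s K (U - K) else 0)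
      = (if card (U - K) = m then qpoch q q m * psi_base q s (insert w K) (U - K) else 0)" if "K \<in> Pow U" for K
      using psi_coeff_one_insert[where q = q, OF coeff[OF that]] 0 by auto
    note b2 = this
    have "row_op q s w (Suc 0) (psi q s U) (m # ms) = (\<Sum>K\<in>Pow U. ((w - s * q ^ m) / (1 - s * w) *
       (if card (U - K) = m then qpoch q q m * psi_base q s K (U - K) else 0)) * psi q s (insert w K) ms)"
      unfolding row_op_1_Cons by (simp only: 0 simp_thms if_True expand1 sum_distrib_left mult.assoc add_0_left)
    also have "\<dots> = psi q s (insert w U) (m # ms)"
      unfolding psi_insert_Cons[OF Cons.prems(1,2)] by (simp only: b2 cong: sum.cong) (simp add: 0)
    finally show ?thesis .
  next
    case (Suc n)
    have n: "m - 1 = n" "(m = 0) = False" using Suc by auto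
    have b1: "(1 - q ^ m) / (1 - s * w) * (if card (U - K) = n then qpoch q q n * psi_base q s K (U - K) * (\<Prod>j\<in>K. hl_factor q j w) else 0)
       = (if Suc (card (U - K)) = m then qpoch q q m * psi_base q s K (insert w (U - K)) else 0)" if "K \<in> Pow U" for K
      using psi_coeff_one_keep[where q = q, OF coeff[OF that]] Suc by auto
    have b2: "(1 - q ^ m) / (1 - s * w) * (if card (U - K) = Suc n then (\<Sum>i\<in>U - K. qpoch q q n * psi_base q s (insert i K) (U - K - {i})
       * (swap_coeff q w i * (\<Prod>j\<in>K. hl_factor q j i))) else 0) + (w - s * q ^ m) / (1 - s * w) * (if card (U - K) = m then qpoch q q m * psi_base q s K (U - K) else 0)
      = (if card (U - K) = m then qpoch q q m * psi_base q s (insert w K) (U - K) else 0)" if "K \<in> Pow U" for K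
      using psi_coeff_one_insert[where q = q, OF coeff[OF that]] Suc by auto
    define t1 t0 where "t1 = (1 - q ^ m) / (1 - s * w)" and "t0 = (w - s * q ^ m) / (1 - s * w)"
    have "row_op q s w (Suc 0) (psi q s U) (m # ms) =
      (\<Sum>K\<in>Pow U. (t1 * (if card (U - K) = n then qpoch q q n * psi_base q s K (U - K) * (\<Prod>j\<in>K. hl_factor q j w) else 0)) * psi q s K ms) +
      (\<Sum>K\<in>Pow U. (t1 * (if card (U - K) = Suc n then (\<Sum>i\<in>U - K. qpoch q q n * psi_base q s (insert i K) (U - K - {i})
       * (swap_coeff q w i * (\<Prod>j\<in>K. hl_factor q j i))) else 0) + t0 *
         (if card (U - K) = m then qpoch q q m * psi_base q s K (U - K) else 0)) * psi q s (insert w K) ms)"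
      unfolding row_op_1_Cons n if_False t0_def[symmetric] t1_def[symmetric]
      by (simp only: expand0 expand1 distrib_left distrib_right sum.distrib sum_distrib_left mult.assoc add.assoc)
    also have "\<dots> = psi q s (insert w U) (m # ms)"
      unfolding psi_insert_Cons[OF Cons.prems(1,2)] t0_def t1_def by (simp only: b1 b2 cong: sum.cong)
    finally show ?thesis .
  qed
  have "(1 - s * q ^ m * w) / (1 - s * w) * (if card (U - K) = m then qpoch q q m * psi_base q s K (U - K) * (\<Prod>j\<in>K. hl_factor q j w) else 0) =
     (\<Prod>j\<in>U. hl_factor q j w) * (if card (U - K) = m then qpoch q q m * psi_base q s K (U - K) else 0) +
     (if card (U - K) = m then (\<Sum>i\<in>U - K. swap_coeff q w i * ((\<Prod>j\<in>K. hl_factor q j i) * (\<Prod>j\<in>U - K - {i}. hl_factor q j i)) *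
       (qpoch q q m * psi_base q s K (insert w (U - K - {i})))) else 0)" if K: "K \<in> Pow U" for K
  proof -
    have "(\<Prod>j\<in>U. hl_factor q j w) = (\<Prod>j\<in>K. hl_factor q j w) * (\<Prod>j\<in>U - K. hl_factor q j w)"
      using K Cons.prems(1) by (simp add: prod.subset_diff mult.commute)
    then show ?thesis using psi_coeff_zero_keep[where q = q, OF coeff[OF K]] by auto
  qed
  note d1 = this
  have "(1 - s * q ^ m * w) / (1 - s * w) * (if card (U - K) = Suc m then (\<Sum>i\<in>U - K. qpoch q q m * psi_base q s (insert i K) (U - K - {i})
       * (swap_coeff q w i * (\<Prod>j\<in>K. hl_factor q j i))) else 0) + (1 - s\<^sup>2 * q ^ m) * w / (1 - s * w) *
      (if card (U - K) = Suc m then qpoch q q (Suc m) * psi_base q s K (U - K) else 0) =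
    (if card (U - K) = Suc m then (\<Sum>i\<in>U - K. swap_coeff q w i * ((\<Prod>j\<in>K. hl_factor q j i) * (\<Prod>j\<in>U - K - {i}. hl_factor q j i)) *
       (qpoch q q m * psi_base q s (insert w K) (U - K - {i}))) else 0)" if "K \<in> Pow U" for K
    using psi_coeff_zero_insert[where q = q and m = m, OF coeff[OF that]] by auto
  note d2 = this
  define t0 t1 where "t0 = (1 - s * q ^ m * w) / (1 - s * w)" and "t1 = (1 - s\<^sup>2 * q ^ m) * w / (1 - s * w)"
  have "row_op q s w 0 (psi q s U) (m # ms) =
    (\<Sum>K\<in>Pow U. (t0 * (if card (U - K) = m then qpoch q q m * psi_base q s K (U - K) * (\<Prod>j\<in>K. hl_factor q j w) else 0)) * psi q s K ms) +
    (\<Sum>K\<in>Pow U. (t0 * (if card (U - K) = Suc m then (\<Sum>i\<in>U - K. qpoch q q m * psi_base q s (insert i K) (U - K - {i})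
       * (swap_coeff q w i * (\<Prod>j\<in>K. hl_factor q j i))) else 0) + t1 *
      (if card (U - K) = Suc m then qpoch q q (Suc m) * psi_base q s K (U - K) else 0)) * psi q s (insert w K) ms)"
    unfolding row_op_0_Cons t0_def[symmetric] t1_def[symmetric]
    by (simp only: expand0 expand1 distrib_left distrib_right sum.distrib sum_distrib_left mult.assoc add.assoc)
  also have "\<dots> = (\<Prod>j\<in>U. hl_factor q j w) * psi q s U (m # ms) +
      (\<Sum>i\<in>U. swap_coeff q w i * (\<Prod>j\<in>U - {i}. hl_factor q j i) * psi q s (insert w (U - {i})) (m # ms))"
    unfolding psi_remove_insert_sum[OF Cons.prems(1,2)] t0_def t1_def
    by (simp only: d1 d2 psi.simps cong: sum.cong) (simp only: distrib_right sum.distrib sum_distrib_left mult.assoc add.assoc)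
  finally show ?case using B by blast
qed

text \<open>The right-hand side of (ii). All \<open>n\<close> paths start in column 0, so the columns to its right are
  reached from the empty configuration; \<open>J\<close> is the set of rows in which a path leaves column 0.\<close>

definition gam_coeff :: "complex \<Rightarrow> complex \<Rightarrow> nat \<Rightarrow> nat \<Rightarrow> complex set \<Rightarrow> complex set \<Rightarrow> complex" where
  "gam_coeff q s n k J I = (\<Prod>r=k..<n. 1 - s\<^sup>2 * q ^ r) * (\<Prod>j\<in>J. j / (1 - s * j)) *
     (\<Prod>i\<in>I. (1 - q ^ k * s * i) / (1 - s * i)) * cross q J I"

primrec gam :: "complex \<Rightarrow> complex \<Rightarrow> nat \<Rightarrow> complex set \<Rightarrow> nat list \<Rightarrow> complex" where
  "gam q s n U [] = 0"
| "gam q s n U (k # ks) =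
     (\<Sum>J\<in>Pow U. (if card J + k = n then gam_coeff q s n k J (U - J) else 0) * psi q s J ks)"

section \<open>Coefficient identities for column 0\<close>

context
  fixes q s w :: complex and K I :: "complex set"
  assumes fin: "finite I" "finite K" and disj: "I \<inter> K = {}" and w: "w \<notin> I" "w \<notin> K" "1 - s * w \<noteq> 0"
    and nz: "\<And>i. i \<in> I \<Longrightarrow> 1 - s * i \<noteq> 0"
begin

text \<open>No path leaves column 0 in the row of \<open>w\<close>; the product over
  \<open>K\<close> is the diagonal factor of the columns to the right.\<close>

lemma gam_coeff_insert_right:
  "(1 - s * q ^ k * w) / (1 - s * w) * (gam_coeff q s n k K I * (\<Prod>j\<in>K. hl_factor q j w)) = gam_coeff q s n k K (insert w I)"
proof -
  have "cross q K (insert w I) = cross q K I * (\<Prod>j\<in>K. hl_factor q j w)"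
    using cross_remove[of "insert w I" w q K] fin w by simp
  then show ?thesis using fin w by (simp add: gam_coeff_def mult_ac)
qed

text \<open>A path leaves column 0 in the row of \<open>w\<close>, or an exchange further right has
  the same effect. With \<open>a = q ^ k * s\<close>, the occupation \<open>Suc k\<close> below the
  row turns \<open>a\<close> into \<open>a * q\<close>, which is the shape of
  \<open>prod_hl_factor_expand_linear\<close>.\<close>

lemma gam_coeff_insert_left:
  assumes "k < n"
  shows "(1 - s * q ^ k * w) / (1 - s * w) * (\<Sum>i\<in>I. gam_coeff q s n k (insert i K) (I - {i}) * (swap_coeff q w i * (\<Prod>j\<in>K. hl_factor q j i))) +
     (1 - s\<^sup>2 * q ^ k) * w / (1 - s * w) * gam_coeff q s n (Suc k) K I = gam_coeff q s n k (insert w K) I"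
proof -
  define a where "a = q ^ k * s"
  define C where "C = (\<Prod>r=k..<n. 1 - s\<^sup>2 * q ^ r) * (\<Prod>j\<in>K. j / (1 - s * j)) * (\<Prod>i\<in>I. 1 / (1 - s * i)) * cross q K I"
  have "gam_coeff q s n k (insert i K) (I - {i}) * (swap_coeff q w i * (\<Prod>j\<in>K. hl_factor q j i)) =
     C * w * ((1 - q) * i / (w - i) * (\<Prod>j\<in>I - {i}. hl_factor q i j) * (\<Prod>j\<in>I - {i}. 1 - a * j))" if i: "i \<in> I" for i
  proof -
    have iK: "i \<notin> K" using i disj by auto
    have "(\<Prod>j\<in>I. 1 / (1 - s * j)) = 1 / (1 - s * i) * (\<Prod>j\<in>I - {i}. 1 / (1 - s * j))"
      using fin i by (simp add: prod.remove)
    moreover have "(\<Prod>j\<in>I - {i}. (1 - a * j) / (1 - s * j)) = (\<Prod>j\<in>I - {i}. 1 - a * j) * (\<Prod>j\<in>I - {i}. 1 / (1 - s * j))"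
      by (simp flip: prod.distrib)
    moreover have "cross q K I = cross q K (I - {i}) * (\<Prod>j\<in>K. hl_factor q j i)"
      using fin(1) i by (rule cross_remove)
    ultimately show ?thesis
      unfolding gam_coeff_def C_def swap_coeff_def cross_insert[OF fin(2) iK] prod.insert[OF fin(2) iK] a_def[symmetric]
      by (simp only:) simp
  qed
  note t = this
  have C: "(\<Prod>r=k..<n. 1 - s\<^sup>2 * q ^ r) = (1 - s\<^sup>2 * q ^ k) * (\<Prod>r=Suc k..<n. 1 - s\<^sup>2 * q ^ r)"
    using assms by (simp add: prod.atLeast_Suc_lessThan del: prod.op_ivl_Suc)
  have p: "(\<Prod>i\<in>I. (1 - b * i) / (1 - s * i)) = (\<Prod>i\<in>I. 1 - b * i) * (\<Prod>i\<in>I. 1 / (1 - s * i))" for b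
    by (simp flip: prod.distrib)
  have 2: "(1 - s\<^sup>2 * q ^ k) * w / (1 - s * w) * gam_coeff q s n (Suc k) K I = C * w / (1 - s * w) * (\<Prod>j\<in>I. 1 - a * q * j)"
    unfolding gam_coeff_def C_def C p by (simp add: a_def mult_ac)
  have 3: "gam_coeff q s n k (insert w K) I = C * w / (1 - s * w) * ((\<Prod>j\<in>I. 1 - a * j) * (\<Prod>j\<in>I. hl_factor q w j))"
    unfolding gam_coeff_def C_def p cross_insert[OF fin(2) w(2)] prod.insert[OF fin(2) w(2)] by (simp add: a_def)
  define S where "S = (\<Sum>i\<in>I. (1 - q) * i / (w - i) * (\<Prod>j\<in>I - {i}. hl_factor q i j) * (\<Prod>j\<in>I - {i}. 1 - a * j))"
  have "(\<Sum>i\<in>I. gam_coeff q s n k (insert i K) (I - {i}) * (swap_coeff q w i * (\<Prod>j\<in>K. hl_factor q j i))) = C * w * S"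
    unfolding S_def by (simp only: t sum_distrib_left cong: sum.cong)
  then show ?thesis
    unfolding 2 3 prod_hl_factor_expand_linear[OF fin(1) w(1), of a q, symmetric] S_def[symmetric]
    by (simp add: a_def add_divide_distrib distrib_left mult_ac)
qed

end

text \<open>Unlike for \<open>psi\<close>, no exchange terms remain: \<open>gam\<close> sums over
  all \<open>J\<close>, so each exchange is absorbed into the coefficient of a set containing
  \<open>w\<close>.\<close>

lemma row_op_gam:
  assumes "finite U" "w \<notin> U" "1 - s * w \<noteq> 0" "\<And>i. i \<in> U \<Longrightarrow> 1 - s * i \<noteq> 0"
  shows "row_op q s w 0 (gam q s n U) (k # ks) = gam q s n (insert w U) (k # ks)"
proof -
  define t0 t1 where "t0 = (1 - s * q ^ k * w) / (1 - s * w)" and "t1 = (1 - s\<^sup>2 * q ^ k) * w / (1 - s * w)"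
  define c where "c l J = (if card J + l = n then gam_coeff q s n l J (U - J) else 0)" for l J
  have sub: "finite J" "w \<notin> J" "1 - s * w \<noteq> 0" "\<And>i. i \<in> J \<Longrightarrow> 1 - s * i \<noteq> 0" if "J \<subseteq> U" for J
    using that assms finite_subset by auto
  have coeff: "finite (U - K)" "finite K" "(U - K) \<inter> K = {}" "w \<notin> U - K" "w \<notin> K" "1 - s * w \<noteq> 0"
    "\<And>i. i \<in> U - K \<Longrightarrow> 1 - s * i \<noteq> 0" if "K \<in> Pow U" for K
    using that assms finite_subset by auto
  have ins: "insert w U - K = insert w (U - K)" "insert w U - insert w K = U - K"
    and ins_card: "card (insert w K) = Suc (card K)"
    if "K \<in> Pow U" for K
    using that assms(2) card_insert_disjoint[OF coeff(2,5)[OF that]] by auto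
  have e0: "row_op q s w 0 (\<lambda>ks. gam q s n U (k # ks)) ks =
    (\<Sum>K\<in>Pow U. c k K * (\<Prod>j\<in>K. hl_factor q j w) * psi q s K ks) +
    (\<Sum>K\<in>Pow U. (\<Sum>i\<in>U - K. c k (insert i K) * (swap_coeff q w i * (\<Prod>j\<in>K. hl_factor q j i))) * psi q s (insert w K) ks)"
    unfolding gam.simps c_def[symmetric]
    by (rule row_op_0_sum_psi[OF assms(1) conjunct2[OF row_op_psi[OF sub]]])
  have e1: "row_op q s w (Suc 0) (\<lambda>ks. gam q s n U (Suc k # ks)) ks = (\<Sum>K\<in>Pow U. c (Suc k) K * psi q s (insert w K) ks)"
    unfolding gam.simps c_def[symmetric] row_op_sum
    by (intro sum.cong refl arg_cong2[of _ _ _ _ "(*)"] conjunct1[OF row_op_psi[OF sub]]) auto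
  have g1: "t0 * (c k K * (\<Prod>j\<in>K. hl_factor q j w)) = (if card K + k = n then gam_coeff q s n k K (insert w U - K) else 0)"
    if K: "K \<in> Pow U" for K
    using gam_coeff_insert_right[where q = q and k = k and n = n, OF coeff[OF K]] ins[OF K] by (auto simp: c_def t0_def)
  have g2: "t0 * (\<Sum>i\<in>U - K. c k (insert i K) * (swap_coeff q w i * (\<Prod>j\<in>K. hl_factor q j i))) + t1 * c (Suc k) K =
     (if card (insert w K) + k = n then gam_coeff q s n k (insert w K) (insert w U - insert w K) else 0)"
    if K: "K \<in> Pow U" for K
  proof -
    have "c k (insert i K) = (if Suc (card K) + k = n then gam_coeff q s n k (insert i K) (U - K - {i}) else 0)"
      if "i \<in> U - K" for i
    proof -
      have "U - insert i K = U - K - {i}" "card (insert i K) = Suc (card K)" using that coeff[OF K] by auto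
      then show ?thesis by (simp only: c_def)
    qed
    note c = this
    show ?thesis
    proof (cases "Suc (card K) + k = n")
      case True
      then have "k < n" by simp
      then show ?thesis
        using gam_coeff_insert_left[where q = q and k = k and n = n, OF coeff[OF K]] True
        by (simp only: c ins[OF K] ins_card[OF K] cong: sum.cong) (simp add: c_def t0_def t1_def)
    next
      case False
      then show ?thesis
        by (simp only: c ins[OF K] ins_card[OF K] cong: sum.cong) (simp add: c_def)
    qed
  qed
  define d where "d K = (\<Sum>i\<in>U - K. c k (insert i K) * (swap_coeff q w i * (\<Prod>j\<in>K. hl_factor q j i)))" for K
  have "row_op q s w 0 (gam q s n U) (k # ks) =
     (\<Sum>K\<in>Pow U. (t0 * (c k K * (\<Prod>j\<in>K. hl_factor q j w))) * psi q s K ks) +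
     (\<Sum>K\<in>Pow U. (t0 * d K + t1 * c (Suc k) K)
        * psi q s (insert w K) ks)"
    unfolding row_op_0_Cons t0_def[symmetric] t1_def[symmetric]
    by (simp only: e0[folded d_def] e1 distrib_left distrib_right sum.distrib sum_distrib_left mult.assoc add.assoc)
  also have "\<dots> = gam q s n (insert w U) (k # ks)"
    by (simp only: g1 g2[folded d_def] cong: sum.cong) (simp only: gam.simps sum_Pow_insert[OF assms(1,2)])
  finally show ?thesis .
qed

section \<open>Symmetrization\<close>

text \<open>Symmetrization over all orderings of \<open>U\<close>, expanded by the first element;
  this makes induction on the list of one-variable factors possible.\<close>

primrec symsum :: "complex \<Rightarrow> complex set \<Rightarrow> (complex \<Rightarrow> complex) list \<Rightarrow> complex" where
  "symsum q U [] = (if U = {} then 1 else 0)"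
| "symsum q U (h # hs) = (\<Sum>x\<in>U. (\<Prod>y\<in>U - {x}. hl_factor q x y) * h x * symsum q (U - {x}) hs)"

primrec pairprod :: "complex \<Rightarrow> complex list \<Rightarrow> complex" where
  "pairprod q [] = 1"
| "pairprod q (x # xs) = (\<Prod>y\<in>set xs. hl_factor q x y) * pairprod q xs"

lemma symsum_eq_sum_permutations_of_set:
  assumes "finite U" "length hs = card U"
  shows "symsum q U hs = (\<Sum>xs\<in>permutations_of_set U. pairprod q xs * prod_list (map2 (\<lambda>h x. h x) hs xs))"
  using assms
proof (induction hs arbitrary: U)
  case Nil
  then show ?case by simp
next
  case (Cons h hs)
  from Cons.prems(2) have "U \<noteq> {}" by auto
  have "(\<Sum>xs\<in>permutations_of_set U. pairprod q xs * prod_list (map2 (\<lambda>h x. h x) (h # hs) xs)) =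
     (\<Sum>x\<in>U. \<Sum>xs\<in>(#) x ` permutations_of_set (U - {x}). pairprod q xs * prod_list (map2 (\<lambda>h x. h x) (h # hs) xs))"
    unfolding permutations_of_set_nonempty[OF \<open>U \<noteq> {}\<close>]
    by (rule sum.UNION_disjoint) (use Cons.prems(1) in auto)
  also have "\<dots> = (\<Sum>x\<in>U. \<Sum>xs\<in>permutations_of_set (U - {x}). (\<Prod>y\<in>U - {x}. hl_factor q x y) * h x *
      (pairprod q xs * prod_list (map2 (\<lambda>h x. h x) hs xs)))"
  proof (rule sum.cong[OF refl])
    fix x assume "x \<in> U"
    have "inj_on ((#) x) (permutations_of_set (U - {x}))" by simp
    moreover have "pairprod q (x # xs) * prod_list (map2 (\<lambda>h x. h x) (h # hs) (x # xs)) =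
      (\<Prod>y\<in>U - {x}. hl_factor q x y) * h x * (pairprod q xs * prod_list (map2 (\<lambda>h x. h x) hs xs))"
      if "xs \<in> permutations_of_set (U - {x})" for xs
      using permutations_of_setD(1)[OF that] by simp
    ultimately show "(\<Sum>xs\<in>(#) x ` permutations_of_set (U - {x}). pairprod q xs * prod_list (map2 (\<lambda>h x. h x) (h # hs) xs)) =
      (\<Sum>xs\<in>permutations_of_set (U - {x}). (\<Prod>y\<in>U - {x}. hl_factor q x y) * h x *
      (pairprod q xs * prod_list (map2 (\<lambda>h x. h x) hs xs)))"
      by (simp only: sum.reindex o_def cong: sum.cong)
  qed
  also have "\<dots> = (\<Sum>x\<in>U. (\<Prod>y\<in>U - {x}. hl_factor q x y) * h x * symsum q (U - {x}) hs)"
  proof (rule sum.cong[OF refl])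
    fix x assume "x \<in> U"
    then have "length hs = card (U - {x})" using Cons.prems by simp
    from Cons.IH[OF _ this] Cons.prems(1)
    show "(\<Sum>xs\<in>permutations_of_set (U - {x}). (\<Prod>y\<in>U - {x}. hl_factor q x y) * h x *
      (pairprod q xs * prod_list (map2 (\<lambda>h x. h x) hs xs))) = (\<Prod>y\<in>U - {x}. hl_factor q x y) * h x * symsum q (U - {x}) hs"
      by (simp flip: sum_distrib_left)
  qed
  finally show ?case by (simp only: symsum.simps)
qed

lemma pairprod_map_upt:
  assumes "inj_on f {m..<n}"
  shows "pairprod q (map f [m..<n]) = (\<Prod>(i, j)\<in>{(i, j). m \<le> i \<and> i < j \<and> j < n}. hl_factor q (f i) (f j))"
  using assms
proof (induction "n - m" arbitrary: m)
  case 0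
  then have "{(i, j). m \<le> i \<and> i < j \<and> j < n} = {}" by auto
  moreover have "[m..<n] = []" using 0 by simp
  ultimately show ?case by (simp only: list.map pairprod.simps prod.empty)
next
  case (Suc d)
  then have mn: "m < n" by simp
  have inj: "inj_on f {Suc m..<n}" using Suc.prems by (rule inj_on_subset) auto
  have fin: "finite {(i, j). Suc m \<le> i \<and> i < j \<and> j < n}"
    by (rule finite_subset[of _ "{..<n} \<times> {..<n}"]) auto
  have set_eq: "{(i, j). m \<le> i \<and> i < j \<and> j < n} = Pair m ` {Suc m..<n} \<union> {(i, j). Suc m \<le> i \<and> i < j \<and> j < n}"
    using mn by auto
  have "(\<Prod>(i, j)\<in>{(i, j). m \<le> i \<and> i < j \<and> j < n}. hl_factor q (f i) (f j)) =
    (\<Prod>(i, j)\<in>Pair m ` {Suc m..<n}. hl_factor q (f i) (f j)) *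
    (\<Prod>(i, j)\<in>{(i, j). Suc m \<le> i \<and> i < j \<and> j < n}. hl_factor q (f i) (f j))"
    unfolding set_eq by (rule prod.union_disjoint) (use fin in auto)
  also have "(\<Prod>(i, j)\<in>Pair m ` {Suc m..<n}. hl_factor q (f i) (f j)) = (\<Prod>j\<in>{Suc m..<n}. hl_factor q (f m) (f j))"
    by (subst prod.reindex) (auto simp: inj_on_def)
  also have "\<dots> = (\<Prod>y\<in>f ` {Suc m..<n}. hl_factor q (f m) y)"
    using inj by (simp add: prod.reindex)
  finally show ?case
    using Suc.hyps(1)[of "Suc m"] Suc.hyps(2) inj mn by (simp add: upt_conv_Cons)
qed

text \<open>As \<open>u\<close> is injective, permutations of the indices correspond to orderings of
  the set of values.\<close>

lemma sum_permutes_eq_symsum: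
  assumes "inj_on u {1..M}"
  shows "(\<Sum>\<sigma> | \<sigma> permutes {1..M}. (\<Prod>(i, j)\<in>{(i, j). 1 \<le> i \<and> i < j \<and> j \<le> M}. hl_factor q (u (\<sigma> i)) (u (\<sigma> j))) *
      (\<Prod>i=1..M. h i (u (\<sigma> i)))) = symsum q (u ` {1..M}) (map h [1..<Suc M])"
proof -
  define g where "g \<sigma> = map (\<lambda>i. u (\<sigma> i)) [1..<Suc M]" for \<sigma> :: "nat \<Rightarrow> nat"
  have inj\<sigma>: "inj_on (\<lambda>i. u (\<sigma> i)) {1..M}" and img: "(\<lambda>i. u (\<sigma> i)) ` {1..M} = u ` {1..M}"
    if "\<sigma> permutes {1..M}" for \<sigma>
    using comp_inj_on[of \<sigma> "{1..M}" u] permutes_inj_on[OF that] permutes_image[OF that] assms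
    by (auto simp: o_def image_image[symmetric])
  have "inj_on g {\<sigma>. \<sigma> permutes {1..M}}"
  proof (rule inj_onI)
    fix \<sigma> \<tau> assume *: "\<sigma> \<in> {\<sigma>. \<sigma> permutes {1..M}}" "\<tau> \<in> {\<sigma>. \<sigma> permutes {1..M}}" "g \<sigma> = g \<tau>"
    then have "u (\<sigma> i) = u (\<tau> i)" if "i \<in> {1..M}" for i
      using that by (auto simp: g_def simp del: upt_Suc)
    then have "\<sigma> i = \<tau> i" if "i \<in> {1..M}" for i
      using that assms * permutes_in_image by (metis inj_onD mem_Collect_eq)
    with * show "\<sigma> = \<tau>" by (metis ext mem_Collect_eq permutes_not_in)
  qed
  moreover have "g ` {\<sigma>. \<sigma> permutes {1..M}} \<subseteq> permutations_of_set (u ` {1..M})"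
    using inj\<sigma> img by (auto simp: g_def permutations_of_set_def distinct_map atLeastLessThanSuc_atLeastAtMost simp del: upt_Suc)
  \<comment> \<open>Injectivity and equal cardinality give a bijection, so surjectivity needs no
    separate construction.\<close>
  moreover have "card {\<sigma>. \<sigma> permutes {1..M}} = card (permutations_of_set (u ` {1..M}))"
    using assms by (simp add: card_permutations card_image)
  ultimately have bij: "bij_betw g {\<sigma>. \<sigma> permutes {1..M}} (permutations_of_set (u ` {1..M}))"
    unfolding bij_betw_def by (metis card_image card_subset_eq finite_permutations_of_set)
  have t: "(\<Prod>(i, j)\<in>{(i, j). 1 \<le> i \<and> i < j \<and> j \<le> M}. hl_factor q (u (\<sigma> i)) (u (\<sigma> j))) * (\<Prod>i=1..M. h i (u (\<sigma> i))) =
     pairprod q (g \<sigma>) * prod_list (map2 (\<lambda>h x. h x) (map h [1..<Suc M]) (g \<sigma>))" if "\<sigma> permutes {1..M}" for \<sigma>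
  proof -
    have "pairprod q (g \<sigma>) = (\<Prod>(i, j)\<in>{(i, j). 1 \<le> i \<and> i < j \<and> j \<le> M}. hl_factor q (u (\<sigma> i)) (u (\<sigma> j)))"
      unfolding g_def using inj\<sigma>[OF that]
      by (subst pairprod_map_upt) (simp_all add: atLeastLessThanSuc_atLeastAtMost less_Suc_eq_le)
    moreover have "map2 (\<lambda>h x. h x) (map h [1..<Suc M]) (g \<sigma>) = map (\<lambda>i. h i (u (\<sigma> i))) [1..<Suc M]"
      unfolding g_def by (simp add: map2_map_map del: upt_Suc)
    moreover have "prod_list (map (\<lambda>i. h i (u (\<sigma> i))) [1..<Suc M]) = (\<Prod>i=1..M. h i (u (\<sigma> i)))"
      by (subst prod.distinct_set_conv_list[symmetric]) (simp_all add: atLeastLessThanSuc_atLeastAtMost del: upt_Suc)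
    ultimately show ?thesis by simp
  qed
  have "symsum q (u ` {1..M}) (map h [1..<Suc M]) =
    (\<Sum>xs\<in>permutations_of_set (u ` {1..M}). pairprod q xs * prod_list (map2 (\<lambda>h x. h x) (map h [1..<Suc M]) xs))"
    using assms by (intro symsum_eq_sum_permutations_of_set) (simp_all add: card_image del: upt_Suc)
  also have "\<dots> = (\<Sum>\<sigma> | \<sigma> permutes {1..M}. pairprod q (g \<sigma>) * prod_list (map2 (\<lambda>h x. h x) (map h [1..<Suc M]) (g \<sigma>)))"
    by (rule sum.reindex_bij_betw[OF bij, symmetric])
  also have "\<dots> = (\<Sum>\<sigma> | \<sigma> permutes {1..M}. (\<Prod>(i, j)\<in>{(i, j). 1 \<le> i \<and> i < j \<and> j \<le> M}. hl_factor q (u (\<sigma> i)) (u (\<sigma> j))) *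
      (\<Prod>i=1..M. h i (u (\<sigma> i))))"
    by (rule sum.cong[OF refl]) (use t in simp)
  finally show ?thesis ..
qed

text \<open>\<open>J\<close> is the set of variables assigned to the first block. A pair across the
  blocks always has its first element in \<open>J\<close>, whence the factor
  \<open>cross\<close>.\<close>

lemma symsum_append:
  assumes "finite U"
  shows "symsum q U (hs @ ks) =
    (\<Sum>J\<in>Pow U. if card J = length hs then cross q J (U - J) * symsum q J hs * symsum q (U - J) ks else 0)"
  using assms
proof (induction hs arbitrary: U)
  case Nil
  have "(\<Sum>J\<in>Pow U. if card J = 0 then cross q J (U - J) * symsum q J [] * symsum q (U - J) ks else 0) =
     (\<Sum>J\<in>Pow U. if J = {} then symsum q U ks else 0)"
    using Nil finite_subset by (intro sum.cong refl) (auto simp: cross_def)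
  also have "\<dots> = symsum q U ks" using Nil by (simp add: sum.delta)
  finally show ?case by simp
next
  case (Cons h hs)
  have "symsum q U ((h # hs) @ ks) = (\<Sum>x\<in>U. \<Sum>K\<in>Pow (U - {x}). (\<Prod>y\<in>U - {x}. hl_factor q x y) * h x *
     (if card K = length hs then cross q K (U - {x} - K) * symsum q K hs * symsum q (U - {x} - K) ks else 0))"
    using Cons by (simp add: sum_distrib_left)
  also have "\<dots> = (\<Sum>K\<in>Pow U. \<Sum>x\<in>U - K. (\<Prod>y\<in>U - {x}. hl_factor q x y) * h x *
     (if card K = length hs then cross q K (U - {x} - K) * symsum q K hs * symsum q (U - {x} - K) ks else 0))"
    by (rule sum_elem_Pow[OF Cons.prems])
  \<comment> \<open>\<open>K\<close> is the first block without its first variable \<open>x\<close>,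
    so \<open>insert x K\<close> will be the set \<open>J\<close>.\<close>
  also have "\<dots> = (\<Sum>K\<in>Pow U. \<Sum>x\<in>U - K. (if card (insert x K) = length (h # hs) then
     cross q (insert x K) (U - insert x K) * ((\<Prod>y\<in>insert x K - {x}. hl_factor q x y) * h x * symsum q (insert x K - {x}) hs)
       * symsum q (U - insert x K) ks else 0))"
  proof (intro sum.cong refl)
    fix K x assume K: "K \<in> Pow U" and x: "x \<in> U - K"
    have fK: "finite K" using K Cons.prems finite_subset by auto
    have e: "U - insert x K = U - {x} - K" "insert x K - {x} = K" "U - {x} = K \<union> (U - {x} - K)"
      "K \<inter> (U - {x} - K) = {}" "card (insert x K) = Suc (card K)" using x K fK by auto
    have "(\<Prod>y\<in>U - {x}. hl_factor q x y) = (\<Prod>y\<in>K. hl_factor q x y) * (\<Prod>y\<in>U - {x} - K. hl_factor q x y)"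
      by (subst e(3), rule prod.union_disjoint) (use fK Cons.prems e(4) in auto)
    moreover have "cross q (insert x K) (U - {x} - K) = (\<Prod>y\<in>U - {x} - K. hl_factor q x y) * cross q K (U - {x} - K)"
      using x fK by (intro cross_insert) auto
    ultimately show "(\<Prod>y\<in>U - {x}. hl_factor q x y) * h x *
     (if card K = length hs then cross q K (U - {x} - K) * symsum q K hs * symsum q (U - {x} - K) ks else 0) =
     (if card (insert x K) = length (h # hs) then
     cross q (insert x K) (U - insert x K) * ((\<Prod>y\<in>insert x K - {x}. hl_factor q x y) * h x * symsum q (insert x K - {x}) hs)
       * symsum q (U - insert x K) ks else 0)"
      unfolding e(1,2,5) by (simp add: mult_ac)
  qed
  also have "\<dots> = (\<Sum>J\<in>Pow U. \<Sum>x\<in>J. (if card J = length (h # hs) then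
     cross q J (U - J) * ((\<Prod>y\<in>J - {x}. hl_factor q x y) * h x * symsum q (J - {x}) hs) * symsum q (U - J) ks else 0))"
    by (rule sum_Pow_elem[OF Cons.prems, symmetric])
  also have "\<dots> = (\<Sum>J\<in>Pow U. if card J = length (h # hs) then
     cross q J (U - J) * symsum q J (h # hs) * symsum q (U - J) ks else 0)"
    by (intro sum.cong refl) (simp add: sum_distrib_left sum_distrib_right)
  finally show ?case .
qed

text \<open>A factor common to all positions is symmetric and leaves the symmetrization.\<close>

lemma symsum_factor:
  assumes "finite U"
  shows "symsum q U (map (\<lambda>h x. g x * h x) hs) = (\<Prod>x\<in>U. g x) * symsum q U hs"
  using assms
proof (induction hs arbitrary: U)
  case (Cons h hs)
  have t: "(\<Prod>y\<in>U - {x}. hl_factor q x y) * (g x * h x) * ((\<Prod>y\<in>U - {x}. g y) * symsum q (U - {x}) hs) =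
     (\<Prod>x\<in>U. g x) * ((\<Prod>y\<in>U - {x}. hl_factor q x y) * h x * symsum q (U - {x}) hs)" if "x \<in> U" for x
    using prod.remove[OF Cons.prems that, of g] by simp
  show ?case
    using Cons.prems by (simp add: Cons.IH) (simp only: t sum_distrib_left cong: sum.cong)
qed simp

text \<open>The normalization known from Hall-Littlewood polynomials: removing the first variable
  yields a factor \<open>1 - q ^ card U\<close> by \<open>sum_prod_hl_factor\<close>.\<close>

lemma symsum_replicate_1:
  assumes "finite U" "card U = m"
  shows "(1 - q) ^ m * symsum q U (replicate m (\<lambda>_. 1)) = qpoch q q m"
  using assms
proof (induction m arbitrary: U)
  case 0
  then show ?case by (simp add: qpoch_def)
next
  case (Suc m)
  have "(1 - q) ^ m * symsum q (U - {x}) (replicate m (\<lambda>_. 1)) = qpoch q q m" if "x \<in> U" for x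
    using Suc that by simp
  note IH = this
  have "(1 - q) ^ Suc m * symsum q U (replicate (Suc m) (\<lambda>_. 1)) =
    (1 - q) * (\<Sum>x\<in>U. (\<Prod>y\<in>U - {x}. hl_factor q x y) * ((1 - q) ^ m * symsum q (U - {x}) (replicate m (\<lambda>_. 1))))"
    by (simp add: sum_distrib_left mult_ac)
  also have "\<dots> = (1 - q) * (\<Sum>x\<in>U. \<Prod>y\<in>U - {x}. hl_factor q x y) * qpoch q q m"
    by (simp add: IH sum_distrib_right)
  also have "\<dots> = qpoch q q (Suc m)"
    using sum_prod_hl_factor[OF Suc.prems(1), of q] Suc.prems(2) by (simp add: qpoch_Suc mult.commute)
  finally show ?case .
qed

lemma symsum_replicate:
  assumes "finite U" "card U = m"
  shows "(1 - q) ^ m * symsum q U (replicate m g) = (\<Prod>x\<in>U. g x) * qpoch q q m"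
proof -
  have "symsum q U (replicate m g) = (\<Prod>x\<in>U. g x) * symsum q U (replicate m (\<lambda>_. 1))"
    using symsum_factor[OF assms(1), of q g "replicate m (\<lambda>_. 1)"] by simp
  then show ?thesis using symsum_replicate_1[OF assms, of q] by (simp add: mult_ac)
qed

section \<open>Occupation numbers of a signature\<close>

definition occupation :: "nat \<Rightarrow> nat list \<Rightarrow> nat list" where
  "occupation n mu = map (count_list mu) [0..<n]"

text \<open>What remains of a signature when column 0 is removed and column 1 becomes the new column
  0.\<close>

definition unshift :: "nat list \<Rightarrow> nat list" where
  "unshift mu = map (\<lambda>e. e - 1) (filter (\<lambda>e. e \<noteq> 0) mu)"

lemma sorted_eq_filter_append_zeros:
  assumes "sorted_wrt (\<ge>) (mu :: nat list)"
  shows "filter (\<lambda>e. e \<noteq> 0) mu @ replicate (count_list mu 0) 0 = mu"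
  using assms
proof (induction mu)
  case (Cons e mu)
  show ?case
  proof (cases "e = 0")
    case True
    with Cons.prems have z: "\<forall>x\<in>set mu. x = 0" by auto
    then have "filter (\<lambda>e. e \<noteq> 0) mu = []" by (simp add: filter_empty_conv)
    with Cons.IH Cons.prems True show ?thesis by simp
  next
    case False
    with Cons.IH Cons.prems show ?thesis by simp
  qed
qed simp

lemma count_list_unshift: "count_list (unshift mu) x = count_list mu (Suc x)"
  unfolding unshift_def by (induction mu) auto

lemma occupation_Suc: "occupation (Suc n) mu = count_list mu 0 # occupation n (unshift mu)"
proof -
  have "map (count_list mu) [0..<Suc n] = count_list mu 0 # map (count_list mu) (map Suc [0..<n])"
    by (simp add: upt_conv_Cons map_Suc_upt del: upt_Suc)
  then show ?thesis by (simp add: occupation_def count_list_unshift o_def del: upt_Suc)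
qed

lemma sorted_unshift: "sorted_wrt (\<ge>) mu \<Longrightarrow> sorted_wrt (\<ge>) (unshift mu)"
  unfolding unshift_def by (induction mu) auto

lemma length_unshift: "length (unshift mu) + count_list mu 0 = length mu"
  unfolding unshift_def by (induction mu) auto

lemma unshift_less: "\<forall>e\<in>set mu. e < Suc n \<Longrightarrow> \<forall>e\<in>set (unshift mu). e < n"
  by (auto simp: unshift_def)

lemma filter_nonzero_eq_map_Suc: "filter (\<lambda>e. e \<noteq> 0) mu = map Suc (unshift mu)"
  unfolding unshift_def map_map by (rule map_idI[symmetric]) auto

lemma sorted_eq_map_Suc_append_zeros:
  assumes "sorted_wrt (\<ge>) mu"
  shows "mu = map Suc (unshift mu) @ replicate (count_list mu 0) 0"
  using sorted_eq_filter_append_zeros[OF assms, symmetric] unfolding filter_nonzero_eq_map_Suc .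

text \<open>The zero coordinates form the final block of \<open>mu\<close>;
  \<open>symsum_append\<close> splits it off, and its symmetrization is the
  \<open>qpoch q q m\<close> of \<open>psi\<close>. Every other coordinate gives one factor \<xi> to
  this column and is lowered by 1.\<close>

lemma psi_eq_symsum:
  assumes "finite U" "length mu = card U" "sorted_wrt (\<ge>) mu" "\<forall>e\<in>set mu. e < n"
  shows "psi q s U (occupation n mu) = (1 - q) ^ card U * (\<Prod>x\<in>U. 1 / (1 - s * x)) *
    symsum q U (map (\<lambda>e x. ((x - s) / (1 - s * x)) ^ e) mu)"
  using assms
proof (induction n arbitrary: U mu)
  case 0
  then show ?case by (simp add: occupation_def)
next
  case (Suc n)
  define \<xi> where "\<xi> x = (x - s) / (1 - s * x)" for x
  define m l where "m = count_list mu 0" and "l = unshift mu"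
  have mu: "mu = map Suc l @ replicate m 0"
    unfolding l_def m_def using sorted_eq_map_Suc_append_zeros[OF Suc.prems(3)] .
  have len: "length l + m = card U" using length_unshift[of mu] Suc.prems by (simp add: l_def m_def)
  have hs: "map (\<lambda>e x. \<xi> x ^ e) mu = map (\<lambda>h x. \<xi> x * h x) (map (\<lambda>e x. \<xi> x ^ e) l) @ replicate m (\<lambda>_. 1)"
    unfolding mu by simp
  have summand: "(if card (U - J) = m then qpoch q q m * psi_base q s J (U - J) else 0) * psi q s J (occupation n l) =
    (1 - q) ^ card U * (\<Prod>x\<in>U. 1 / (1 - s * x)) * (if card J = length l then cross q J (U - J) *
     symsum q J (map (\<lambda>h x. \<xi> x * h x) (map (\<lambda>e x. \<xi> x ^ e) l)) * symsum q (U - J) (replicate m (\<lambda>_. 1)) else 0)"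
    if J: "J \<in> Pow U" for J
  proof (cases "card J = length l")
    case True
    have fin: "finite J" "finite (U - J)" using J Suc.prems(1) finite_subset by auto
    have card: "card (U - J) = m" using True len J Suc.prems(1) fin by (simp add: card_Diff_subset)
    have IH: "psi q s J (occupation n l) = (1 - q) ^ length l * (\<Prod>x\<in>J. 1 / (1 - s * x)) * symsum q J (map (\<lambda>e x. \<xi> x ^ e) l)"
      unfolding \<xi>_def True[symmetric]
      by (rule Suc.IH) (use fin True Suc.prems in \<open>simp_all add: l_def sorted_unshift unshift_less\<close>)
    have "(\<Prod>x\<in>U. 1 / (1 - s * x)) = (\<Prod>x\<in>J. 1 / (1 - s * x)) * (\<Prod>x\<in>U - J. 1 / (1 - s * x))"
      using J Suc.prems(1) by (subst prod.subset_diff[of J U]) (auto simp: mult.commute)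
    then show ?thesis
      unfolding IH symsum_factor[OF fin(1)] psi_base_def \<xi>_def[symmetric] symsum_replicate_1[OF fin(2) card, symmetric] len[symmetric] power_add
      using True card by (simp only: simp_thms if_True mult_ac)
  next
    case False
    then have "card (U - J) \<noteq> m"
      using J len Suc.prems(1) card_Diff_subset[of J U] finite_subset[of J U] card_mono[of U J] by auto
    with False show ?thesis by simp
  qed
  have "psi q s U (occupation (Suc n) mu) = (\<Sum>J\<in>Pow U. (if card (U - J) = m then qpoch q q m * psi_base q s J (U - J) else 0)
     * psi q s J (occupation n l))"
    by (simp only: occupation_Suc l_def m_def psi.simps)
  also have "\<dots> = (1 - q) ^ card U * (\<Prod>x\<in>U. 1 / (1 - s * x)) * symsum q U (map (\<lambda>e x. \<xi> x ^ e) mu)"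
    unfolding hs symsum_append[OF Suc.prems(1)] sum_distrib_left length_map
    by (rule sum.cong[OF refl]) (rule summand)
  finally show ?case by (simp only: \<xi>_def)
qed

lemma qpoch_split: "k \<le> n \<Longrightarrow> qpoch a q n = qpoch a q k * (\<Prod>r=k..<n. 1 - a * q ^ r)"
  unfolding qpoch_def lessThan_atLeast0 by (simp add: prod.atLeastLessThan_concat)

text \<open>The final block now belongs to the rows in which no path leaves column 0. Its
  symmetrization brings in a factor \<open>qpoch q q (card U + k - n)\<close> that
  \<open>gam\<close> does not have, hence the denominator in (ii).\<close>

lemma gam_eq_symsum:
  fixes nu :: "nat list" and X :: nat
  defines "n \<equiv> length nu" and "k \<equiv> count_list nu 0"
  assumes U: "finite U" "n - k \<le> card U"
    and nz: "qpoch q q (card U + k - n) \<noteq> 0" "qpoch (s\<^sup>2) q k \<noteq> 0" "k < n \<Longrightarrow> \<forall>x\<in>U. x - s \<noteq> 0"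
    and nu: "sorted_wrt (\<ge>) nu" "\<forall>e\<in>set nu. e < Suc X"
  shows "gam q s n U (occupation (Suc X) nu) =
     (1 - q) ^ card U * qpoch (s\<^sup>2) q n / (qpoch q q (card U + k - n) * qpoch (s\<^sup>2) q k) *
     symsum q U (map (\<lambda>e x. x / ((1 - s * x) * (x - s)) * ((x - s) / (1 - s * x)) ^ e) (filter (\<lambda>e. e \<noteq> 0) nu) @
       replicate (card U + k - n) (\<lambda>x. (1 - q ^ k * s * x) / (1 - s * x)))"
proof -
  define \<xi> where "\<xi> x = (x - s) / (1 - s * x)" for x
  define g where "g x = x / ((1 - s * x) * (x - s)) * \<xi> x" for x
  define z where "z x = (1 - q ^ k * s * x) / (1 - s * x)" for x
  define l where "l = unshift nu"
  define m where "m = card U + k - n"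
  have len: "length l + k = n" using length_unshift[of nu] by (simp add: l_def k_def n_def)
  have len': "length l + m = card U" using len U(2) by (simp add: m_def)
  have hs: "map (\<lambda>e x. x / ((1 - s * x) * (x - s)) * \<xi> x ^ e) (filter (\<lambda>e. e \<noteq> 0) nu) =
     map (\<lambda>h x. g x * h x) (map (\<lambda>e x. \<xi> x ^ e) l)"
    unfolding filter_nonzero_eq_map_Suc l_def g_def by (simp add: mult.assoc)
  define C where "C = (1 - q) ^ card U * qpoch (s\<^sup>2) q n / (qpoch q q m * qpoch (s\<^sup>2) q k)"
  have C: "C = (1 - q) ^ card U * (\<Prod>r=k..<n. 1 - s\<^sup>2 * q ^ r) / qpoch q q m"
    using qpoch_split[of k n "s\<^sup>2" q] len nz(2) by (simp add: C_def)
  have summand: "(if card J + k = n then gam_coeff q s n k J (U - J) else 0) * psi q s J (occupation X l) =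
    C * (if card J = length l then cross q J (U - J) *
     symsum q J (map (\<lambda>h x. g x * h x) (map (\<lambda>e x. \<xi> x ^ e) l)) * symsum q (U - J) (replicate m z) else 0)"
    if J: "J \<in> Pow U" for J
  proof (cases "card J = length l")
    case True
    have fin: "finite J" "finite (U - J)" using J U(1) finite_subset by auto
    have card: "card (U - J) = m" using True len' J U(1) fin by (simp add: card_Diff_subset)
    have psi: "psi q s J (occupation X l) = (1 - q) ^ length l * (\<Prod>x\<in>J. 1 / (1 - s * x)) * symsum q J (map (\<lambda>e x. \<xi> x ^ e) l)"
      unfolding \<xi>_def True[symmetric]
      by (rule psi_eq_symsum) (use fin True nu in \<open>simp_all add: l_def sorted_unshift unshift_less\<close>)
    \<comment> \<open>The factor \<open>x - s\<close> cancels against one factor \<xi>. Of the two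
      factors \<open>1 / (1 - s * x)\<close>, one belongs to leaving column 0 and one to the
      prefactor of \<open>psi\<close>. An element of \<open>J\<close> exists only for
      \<open>k < n\<close>, which is when \<open>x - s\<close> is assumed nonzero.\<close>
    have "g x = x / (1 - s * x) * (1 / (1 - s * x))" if "x \<in> J" for x
    proof -
      have "card J \<noteq> 0" using that fin by auto
      then have "k < n" using True len by linarith
      then have "x - s \<noteq> 0" using nz(3) that J by auto
      then show ?thesis by (simp add: g_def \<xi>_def)
    qed
    then have g: "(\<Prod>x\<in>J. g x) = (\<Prod>x\<in>J. x / (1 - s * x)) * (\<Prod>x\<in>J. 1 / (1 - s * x))"
      by (simp flip: prod.distrib)
    have "(1 - q) ^ m * symsum q (U - J) (replicate m z) / qpoch q q m = (\<Prod>x\<in>U - J. z x)"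
      using symsum_replicate[OF fin(2) card, of q z] nz(1) by (simp add: m_def)
    note z = this[symmetric]
    show ?thesis
      unfolding psi symsum_factor[OF fin(1)] gam_coeff_def z_def[symmetric] z g C len'[symmetric] power_add
      using True len by (simp add: mult_ac)
  next
    case False
    then show ?thesis using len by simp
  qed
  have "gam q s n U (occupation (Suc X) nu) = (\<Sum>J\<in>Pow U. (if card J + k = n then gam_coeff q s n k J (U - J) else 0) *
     psi q s J (occupation X l))"
    by (simp only: occupation_Suc l_def k_def gam.simps)
  also have "\<dots> = C * symsum q U (map (\<lambda>h x. g x * h x) (map (\<lambda>e x. \<xi> x ^ e) l) @ replicate m z)"
    unfolding symsum_append[OF U(1)] sum_distrib_left length_map
    by (rule sum.cong[OF refl]) (rule summand)
  finally show ?thesis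
    unfolding hs[symmetric] unfolding C_def \<xi>_def z_def m_def .
qed

section \<open>Edge counts of a collection of paths\<close>

lemma successively_nth: "successively R p \<Longrightarrow> Suc i < length p \<Longrightarrow> R (p ! i) (p ! Suc i)"
  by (simp add: successively_conv_nth)

lemma up_right_nth_mono:
  assumes "successively up_right_step p" "i \<le> j" "j < length p"
  shows "fst (p ! i) \<le> fst (p ! j)" "snd (p ! i) \<le> snd (p ! j)"
    "fst (p ! j) + snd (p ! j) = fst (p ! i) + snd (p ! i) + int (j - i)"
  using assms(2,3)
proof (induction j rule: dec_induct)
  case (step j)
  {
    case 1
    then show ?case using step successively_nth[OF assms(1), of j] by (auto simp: up_right_step_def)
  next
    case 2
    then show ?case using step successively_nth[OF assms(1), of j] by (auto simp: up_right_step_def)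
  next
    case 3
    then show ?case using step successively_nth[OF assms(1), of j] by (auto simp: up_right_step_def)
  }
qed auto

text \<open>The sum of the coordinates grows by 1 in each step, so no vertex is visited
  twice.\<close>

lemma up_right_nth_eq_iff:
  assumes "successively up_right_step p" "i < length p" "j < length p"
  shows "p ! i = p ! j \<longleftrightarrow> i = j"
  using up_right_nth_mono(3)[OF assms(1), of i j] up_right_nth_mono(3)[OF assms(1), of j i] assms(2,3)
  by (cases "i \<le> j") auto

lemma path_edges_iff: "(v, w) \<in> path_edges p \<longleftrightarrow> (\<exists>i. Suc i < length p \<and> p ! i = v \<and> p ! Suc i = w)"
  by (cases p) (auto simp: path_edges_def in_set_zip)

lemma path_interior_iff:
  assumes "up_right_path p"
  shows "v \<in> path_interior p \<longleftrightarrow> (\<exists>i. 0 < i \<and> Suc i < length p \<and> p ! i = v)"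
proof -
  have p: "successively up_right_step p" "2 \<le> length p" using assms by (auto simp: up_right_path_def)
  then have ne: "p \<noteq> []" by auto
  have hl: "hd p = p ! 0" "last p = p ! (length p - 1)" using ne by (auto simp: hd_conv_nth last_conv_nth)
  show ?thesis
  proof
    assume "v \<in> path_interior p"
    then obtain i where i: "i < length p" "p ! i = v" "v \<noteq> p ! 0" "v \<noteq> p ! (length p - 1)"
      by (auto simp: path_interior_def hl in_set_conv_nth)
    have "i \<noteq> 0" using i(2,3) by (rule_tac notI) simp
    moreover have "i \<noteq> length p - 1" using i(2,4) by (rule_tac notI) simp
    ultimately show "\<exists>i. 0 < i \<and> Suc i < length p \<and> p ! i = v" using i by (intro exI[of _ i]) auto
  next
    assume "\<exists>i. 0 < i \<and> Suc i < length p \<and> p ! i = v"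
    then obtain i where i: "0 < i" "Suc i < length p" "p ! i = v" by auto
    have "p ! i \<noteq> p ! 0" "p ! i \<noteq> p ! (length p - 1)"
    proof -
      have "0 < length p" "length p - 1 < length p" "i < length p" using i by auto
      then show "p ! i \<noteq> p ! 0" "p ! i \<noteq> p ! (length p - 1)"
        using up_right_nth_eq_iff[OF p(1), of i 0] up_right_nth_eq_iff[OF p(1), of i "length p - 1"] i by simp_all
    qed
    with i show "v \<in> path_interior p" by (auto simp: path_interior_def hl)
  qed
qed

text \<open>A path visits an interior vertex exactly once, hence enters it by one edge and leaves it
  by one edge.\<close>

lemma in_edges_interior:
  assumes p: "up_right_path p" and v: "(x, y) \<in> path_interior p"
  shows "((x, y - 1), (x, y)) \<in> path_edges p \<longleftrightarrow> ((x - 1, y), (x, y)) \<notin> path_edges p"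
    "((x, y), (x, y + 1)) \<in> path_edges p \<longleftrightarrow> ((x, y), (x + 1, y)) \<notin> path_edges p"
proof -
  have s: "successively up_right_step p" using p by (auto simp: up_right_path_def)
  from v obtain i where i: "0 < i" "Suc i < length p" "p ! i = (x, y)"
    unfolding path_interior_iff[OF p] by auto
  then obtain k where k: "i = Suc k" by (cases i) auto
  have u: "j = i" if "j < length p" "p ! j = (x, y)" for j
    using up_right_nth_eq_iff[OF s, of j i] that i by (metis Suc_lessD)
  have in_edge: "(w, (x, y)) \<in> path_edges p \<longleftrightarrow> w = p ! k" for w
  proof
    assume "(w, (x, y)) \<in> path_edges p"
    then obtain j where "Suc j < length p" "p ! j = w" "p ! Suc j = (x, y)" by (auto simp: path_edges_iff)
    then show "w = p ! k" using u[of "Suc j"] k by auto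
  next
    assume "w = p ! k"
    then show "(w, (x, y)) \<in> path_edges p"
      unfolding path_edges_iff using i k by (intro exI[of _ k]) auto
  qed
  have out_edge: "((x, y), w) \<in> path_edges p \<longleftrightarrow> w = p ! Suc i" for w
  proof
    assume "((x, y), w) \<in> path_edges p"
    then obtain j where "Suc j < length p" "p ! j = (x, y)" "p ! Suc j = w" by (auto simp: path_edges_iff)
    then show "w = p ! Suc i" using u[of j] by auto
  next
    assume "w = p ! Suc i"
    then show "((x, y), w) \<in> path_edges p"
      unfolding path_edges_iff using i by (intro exI[of _ i]) auto
  qed
  have "up_right_step (p ! k) (x, y)" "up_right_step (x, y) (p ! Suc i)"
    using successively_nth[OF s, of k] successively_nth[OF s, of i] i k by auto
  then show "((x, y - 1), (x, y)) \<in> path_edges p \<longleftrightarrow> ((x - 1, y), (x, y)) \<notin> path_edges p"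
    "((x, y), (x, y + 1)) \<in> path_edges p \<longleftrightarrow> ((x, y), (x + 1, y)) \<notin> path_edges p"
    unfolding in_edge out_edge by (cases "p ! k", cases "p ! Suc i", auto simp: up_right_step_def)+
qed

lemma path_edges_endpoints: "(v, w) \<in> path_edges p \<Longrightarrow> v \<in> set p \<and> w \<in> set p"
  unfolding path_edges_iff by (metis Suc_lessD nth_mem)

lemma size_filter_disjoint:
  assumes "\<And>p. p \<in># P \<Longrightarrow> C p \<longleftrightarrow> A p \<or> B p" "\<And>p. p \<in># P \<Longrightarrow> \<not> (A p \<and> B p)"
  shows "size (filter_mset A P) + size (filter_mset B P) = size (filter_mset C P)"
  using assms by (induction P) auto

lemma size_filter_eq_count: "size {#p \<in># P. f p = e#} = count (image_mset f P) e"
  by (induction P) auto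

text \<open>The shape that the boundary edges of \<open>F\<close> and \<open>G\<close> force on a path, with \<open>N\<close> rows and \<open>n\<close> columns.\<close>

definition strip_path :: "nat \<Rightarrow> nat \<Rightarrow> vertex list \<Rightarrow> bool" where
  "strip_path n N p \<longleftrightarrow> up_right_path p \<and>
     ((\<exists>x. first_edge p = ((int x, 0), (int x, 1))) \<or>
      (\<exists>y\<in>{1..N}. first_edge p = ((- 1, int y), (0, int y)))) \<and>
     (\<exists>x<n. last_edge p = ((int x, int N), (int x, int N + 1)))"

text \<open>The first vertex lies outside the strip, in column -1 or row 0, and the last one in row
  \<open>N + 1\<close>; monotonicity confines all others.\<close>

lemma strip_path_nth:
  assumes "strip_path n N p" "0 < i" "i < length p"
  shows "0 \<le> fst (p ! i)" "1 \<le> snd (p ! i)" "fst (p ! i) < int n"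
    "Suc i < length p \<Longrightarrow> snd (p ! i) \<le> int N"
proof -
  have p: "successively up_right_step p" "2 \<le> length p"
    using assms(1) by (auto simp: strip_path_def up_right_path_def)
  from assms(1) have 1: "0 \<le> fst (p ! 1)" "1 \<le> snd (p ! 1)"
    by (auto simp: strip_path_def first_edge_def)
  from assms(1) have 2: "fst (p ! (length p - 1)) < int n" "snd (p ! (length p - 2)) = int N"
    by (auto simp: strip_path_def last_edge_def)
  show "0 \<le> fst (p ! i)" "1 \<le> snd (p ! i)"
    using up_right_nth_mono(1,2)[OF p(1), of 1 i] 1 assms by auto
  show "fst (p ! i) < int n"
    using up_right_nth_mono(1)[OF p(1), of i "length p - 1"] 2 assms by (cases "length p") auto
  show "snd (p ! i) \<le> int N" if "Suc i < length p"
    using up_right_nth_mono(2)[OF p(1), of i "length p - 2"] 2 that by auto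
qed

lemma strip_path_interior:
  assumes "strip_path n N p" "(x, y) \<in> path_interior p"
  shows "0 \<le> x" "x < int n" "1 \<le> y" "y \<le> int N"
proof -
  have "up_right_path p" using assms(1) by (simp add: strip_path_def)
  then obtain i where "0 < i" "Suc i < length p" "p ! i = (x, y)"
    using assms(2) by (auto simp: path_interior_iff)
  then show "0 \<le> x" "x < int n" "1 \<le> y" "y \<le> int N"
    using strip_path_nth[OF assms(1), of i] by auto
qed

lemma strip_path_mem_interior:
  assumes "strip_path n N p" "(x, y) \<in> set p" "0 \<le> x" "1 \<le> y" "y \<le> int N"
  shows "(x, y) \<in> path_interior p"
proof -
  have p: "successively up_right_step p" "2 \<le> length p"
    using assms(1) by (auto simp: strip_path_def up_right_path_def)
  then have "p \<noteq> []" by auto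
  then have "hd p = p ! 0" "last p = p ! (length p - 1)" by (auto simp: hd_conv_nth last_conv_nth)
  moreover have "fst (p ! 0) = - 1 \<or> snd (p ! 0) = 0" "snd (p ! (length p - 1)) = int N + 1"
    using assms(1) by (auto simp: strip_path_def first_edge_def last_edge_def)
  moreover have "(x, y) \<noteq> p ! 0" "(x, y) \<noteq> p ! (length p - 1)"
    using calculation(3,4) assms(3-5) by (metis fst_conv snd_conv neg_0_le_iff_le not_one_le_zero)
      (metis calculation(4) assms(5) snd_conv zless_add1_eq less_irrefl not_le)
  ultimately show ?thesis using assms by (auto simp: path_interior_def)
qed

section \<open>Conservation and boundary values of edge counts\<close>

definition vedge :: "nat \<Rightarrow> nat \<Rightarrow> edge" where
  "vedge x y = ((int x, int y), (int x, int y + 1))"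

text \<open>Horizontal edges are indexed by their right end and vertical ones by their lower end.
  Thus the starting edges of both kinds have natural indices: \<open>hedge 0 y\<close> comes from
  column -1 and \<open>vedge x 0\<close> from row 0.\<close>

definition hedge :: "nat \<Rightarrow> nat \<Rightarrow> edge" where
  "hedge x y = ((int x - 1, int y), (int x, int y))"

lemma vedge_eq_iff [simp]: "vedge x y = vedge x' y' \<longleftrightarrow> x = x' \<and> y = y'"
  by (auto simp: vedge_def)

lemma hedge_eq_iff [simp]: "hedge x y = hedge x' y' \<longleftrightarrow> x = x' \<and> y = y'"
  by (auto simp: hedge_def)

lemma vedge_neq_hedge [simp]: "vedge x y \<noteq> hedge x' y'" "hedge x' y' \<noteq> vedge x y"
  by (auto simp: vedge_def hedge_def)

context
  fixes n N :: nat and P :: "vertex list multiset"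
  assumes P: "\<And>p. p \<in># P \<Longrightarrow> strip_path n N p"
begin

text \<open>The entering and the leaving edges both count the paths that have the vertex in their
  interior. This gives conservation, and it lets the domain of \<open>local_config\<close> be read
  off the edge counts.\<close>

lemma edge_count_vertex:
  assumes "y < N"
  shows "edge_count P (vedge x y) + edge_count P (hedge x (Suc y)) =
      size {#p \<in># P. (int x, int (Suc y)) \<in> path_interior p#}"
    "edge_count P (vedge x (Suc y)) + edge_count P (hedge (Suc x) (Suc y)) =
      size {#p \<in># P. (int x, int (Suc y)) \<in> path_interior p#}"
proof -
  let ?v = "(int x, int (Suc y))"
  have up: "up_right_path p" if "p \<in># P" for p using P[OF that] by (simp add: strip_path_def)
  have int: "?v \<in> path_interior p" if "p \<in># P" "?v \<in> set p" for p
    using strip_path_mem_interior[OF P[OF that(1)] that(2)] assms by simp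
  show "edge_count P (vedge x y) + edge_count P (hedge x (Suc y)) =
      size {#p \<in># P. ?v \<in> path_interior p#}"
    unfolding edge_count_def
  proof (rule size_filter_disjoint)
    fix p assume p: "p \<in># P"
    have e: "?v \<in> path_interior p" if "vedge x y \<in> path_edges p \<or> hedge x (Suc y) \<in> path_edges p"
      using that int[OF p] path_edges_endpoints[of _ ?v p] by (auto simp: vedge_def hedge_def add.commute)
    then show "?v \<in> path_interior p \<longleftrightarrow> vedge x y \<in> path_edges p \<or> hedge x (Suc y) \<in> path_edges p"
      "\<not> (vedge x y \<in> path_edges p \<and> hedge x (Suc y) \<in> path_edges p)"
      using in_edges_interior(1)[OF up[OF p], of "int x" "int (Suc y)"] by (auto simp: vedge_def hedge_def add.commute)
  qed
  show "edge_count P (vedge x (Suc y)) + edge_count P (hedge (Suc x) (Suc y)) =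
      size {#p \<in># P. ?v \<in> path_interior p#}"
    unfolding edge_count_def
  proof (rule size_filter_disjoint)
    fix p assume p: "p \<in># P"
    have e: "?v \<in> path_interior p" if "vedge x (Suc y) \<in> path_edges p \<or> hedge (Suc x) (Suc y) \<in> path_edges p"
      using that int[OF p] path_edges_endpoints[of ?v _ p] by (auto simp: vedge_def hedge_def add.commute)
    then show "?v \<in> path_interior p \<longleftrightarrow> vedge x (Suc y) \<in> path_edges p \<or> hedge (Suc x) (Suc y) \<in> path_edges p"
      "\<not> (vedge x (Suc y) \<in> path_edges p \<and> hedge (Suc x) (Suc y) \<in> path_edges p)"
      using in_edges_interior(2)[OF up[OF p], of "int x" "int (Suc y)"] by (auto simp: vedge_def hedge_def add.commute)
  qed
qed

text \<open>All later vertices lie in rows from 1 on, so an edge out of row 0 can only be the first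
  one of a path. The left and the top boundary are similar: their edge counts are prescribed by the
  starts and ends.\<close>

lemma edge_count_bottom: "edge_count P (vedge x 0) = count (image_mset first_edge P) (vedge x 0)"
proof -
  have "vedge x 0 \<in> path_edges p \<longleftrightarrow> first_edge p = vedge x 0" if "p \<in># P" for p
  proof
    assume "vedge x 0 \<in> path_edges p"
    then obtain i where i: "Suc i < length p" "p ! i = (int x, 0)" "p ! Suc i = (int x, 1)"
      by (auto simp: vedge_def path_edges_iff)
    then have "i = 0" using strip_path_nth(2)[OF P[OF that], of i] by (cases i) auto
    with i show "first_edge p = vedge x 0" by (simp add: first_edge_def vedge_def)
  next
    assume "first_edge p = vedge x 0"
    moreover have "2 \<le> length p" using P[OF that] by (simp add: strip_path_def up_right_path_def)
    ultimately show "vedge x 0 \<in> path_edges p"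
      unfolding vedge_def path_edges_iff by (intro exI[of _ 0]) (auto simp: first_edge_def)
  qed
  then show ?thesis
    unfolding edge_count_def size_filter_eq_count[symmetric] by (metis (mono_tags, lifting) filter_mset_cong)
qed

lemma edge_count_left: "edge_count P (hedge 0 y) = count (image_mset first_edge P) (hedge 0 y)"
proof -
  have "hedge 0 y \<in> path_edges p \<longleftrightarrow> first_edge p = hedge 0 y" if "p \<in># P" for p
  proof
    assume "hedge 0 y \<in> path_edges p"
    then obtain i where i: "Suc i < length p" "p ! i = (- 1, int y)" "p ! Suc i = (0, int y)"
      by (auto simp: hedge_def path_edges_iff)
    then have "i = 0" using strip_path_nth(1)[OF P[OF that], of i] by (cases i) auto
    with i show "first_edge p = hedge 0 y" by (simp add: first_edge_def hedge_def)
  next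
    assume "first_edge p = hedge 0 y"
    moreover have "2 \<le> length p" using P[OF that] by (simp add: strip_path_def up_right_path_def)
    ultimately show "hedge 0 y \<in> path_edges p"
      unfolding hedge_def path_edges_iff by (intro exI[of _ 0]) (auto simp: first_edge_def)
  qed
  then show ?thesis
    unfolding edge_count_def size_filter_eq_count[symmetric] by (metis (mono_tags, lifting) filter_mset_cong)
qed

lemma edge_count_top: "edge_count P (vedge x N) = count (image_mset last_edge P) (vedge x N)"
proof -
  have "vedge x N \<in> path_edges p \<longleftrightarrow> last_edge p = vedge x N" if "p \<in># P" for p
  proof
    assume "vedge x N \<in> path_edges p"
    then obtain i where i: "Suc i < length p" "p ! i = (int x, int N)" "p ! Suc i = (int x, int N + 1)"
      by (auto simp: vedge_def path_edges_iff)
    then have "\<not> Suc (Suc i) < length p" using strip_path_nth(4)[OF P[OF that], of "Suc i"] by auto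
    then have "i = length p - 2" "Suc i = length p - 1" using i by auto
    with i show "last_edge p = vedge x N" by (simp add: last_edge_def vedge_def)
  next
    assume e: "last_edge p = vedge x N"
    moreover have l: "2 \<le> length p" using P[OF that] by (simp add: strip_path_def up_right_path_def)
    moreover have "Suc (length p - 2) = length p - 1" using l by simp
    ultimately show "vedge x N \<in> path_edges p"
      unfolding vedge_def path_edges_iff by (intro exI[of _ "length p - 2"]) (simp add: last_edge_def)
  qed
  then show ?thesis
    unfolding edge_count_def size_filter_eq_count[symmetric] by (metis (mono_tags, lifting) filter_mset_cong)
qed

lemma edge_count_right: "edge_count P (hedge n y) = 0"
proof -
  have "hedge n y \<notin> path_edges p" if "p \<in># P" for p
  proof
    assume "hedge n y \<in> path_edges p"
    then obtain i where "Suc i < length p" "p ! Suc i = (int n, int y)"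
      by (auto simp: hedge_def path_edges_iff)
    then show False using strip_path_nth(3)[OF P[OF that], of "Suc i"] by auto
  qed
  then have "{#p \<in># P. hedge n y \<in> path_edges p#} = {#p \<in># P. False#}"
    by (intro filter_mset_cong) auto
  then show ?thesis by (simp add: edge_count_def)
qed

end

section \<open>Collections with prescribed edge counts\<close>

lemma multiset_split_size:
  fixes M :: "'a multiset"
  assumes "size M = i + j"
  shows "\<exists>A B. M = A + B \<and> size A = i \<and> size B = j"
proof -
  obtain xs where xs: "M = mset xs" by (metis ex_mset)
  have "mset (take i xs) + mset (drop i xs) = M"
    by (simp only: xs mset_append[symmetric] append_take_drop_id)
  moreover have "size (mset (take i xs)) = i" "size (mset (drop i xs)) = j"
    using assms xs by simp_all
  ultimately show ?thesis by metis
qed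

lemma path_edges_snoc: "p \<noteq> [] \<Longrightarrow> path_edges (p @ [w]) = insert (last p, w) (path_edges p)"
proof (induction p)
  case (Cons a p)
  then show ?case by (cases p) (auto simp: path_edges_def)
qed simp

lemma up_right_path_snoc:
  assumes "up_right_path p" "up_right_step (last p) w"
  shows "up_right_path (p @ [w])" "first_edge (p @ [w]) = first_edge p" "last_edge (p @ [w]) = (last p, w)"
    "(last p, w) \<notin> path_edges p"
proof -
  have p: "2 \<le> length p" "successively up_right_step p" "p \<noteq> []" using assms(1) by (auto simp: up_right_path_def)
  show "up_right_path (p @ [w])"
    using p assms(2) by (auto simp: up_right_path_def successively_append_iff)
  show "first_edge (p @ [w]) = first_edge p"
    using p by (auto simp: first_edge_def nth_append)
  show "last_edge (p @ [w]) = (last p, w)"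
    using p by (auto simp: last_edge_def nth_append last_conv_nth)
  have "w \<notin> set p"
  proof
    assume "w \<in> set p"
    then have "w \<in> {fst (hd p)..fst (last p)} \<times> {snd (hd p)..snd (last p)}"
      using up_right_box[OF p(2,3)] by blast
    then show False using assms(2) by (auto simp: up_right_step_def mem_Times_iff)
  qed
  then show "(last p, w) \<notin> path_edges p" using path_edges_endpoints by blast
qed

lemma edge_count_union: "edge_count (A + B) e = edge_count A e + edge_count B e"
  by (simp add: edge_count_def)

lemma edge_count_snoc:
  assumes "\<And>p. p \<in># Q \<Longrightarrow> up_right_path p \<and> last p = v" "up_right_step v w"
  shows "edge_count (image_mset (\<lambda>p. p @ [w]) Q) e = edge_count Q e + (if e = (v, w) then size Q else 0)"
  using assms(1)
proof (induction Q)
  case (add p Q)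
  have p: "up_right_path p" "last p = v" "p \<noteq> []" using add.prems[of p] by (auto simp: up_right_path_def)
  have "path_edges (p @ [w]) = insert (v, w) (path_edges p)" "(v, w) \<notin> path_edges p"
    using path_edges_snoc[OF p(3)] up_right_path_snoc(4)[OF p(1)] assms(2) p by auto
  moreover have "edge_count (image_mset (\<lambda>p. p @ [w]) Q) e = edge_count Q e + (if e = (v, w) then size Q else 0)"
    by (rule add.IH) (use add.prems in auto)
  ultimately show ?case by (auto simp: edge_count_def)
qed (simp add: edge_count_def)

text \<open>The paths ending at a vertex may be continued in any way that respects the outgoing numbers,
  since no matching of starting and ending edges is prescribed.\<close>

lemma extend_collection:
  assumes P: "P \<in> collections S (A + replicate_mset i1 (vedge x y) + replicate_mset j1 (hedge x (Suc y)))"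
    and flow: "i1 + j1 = i2 + j2"
  shows "\<exists>P'\<in>collections S (A + replicate_mset i2 (vedge x (Suc y)) + replicate_mset j2 (hedge (Suc x) (Suc y))).
    \<forall>e. edge_count P' e = edge_count P e + (if e = vedge x (Suc y) then i2 else 0) + (if e = hedge (Suc x) (Suc y) then j2 else 0)"
proof -
  define v where "v = (int x, int (Suc y))"
  define wn we where "wn = (int x, int (Suc y) + 1)" and "we = (int (Suc x), int (Suc y))"
  have ev: "vedge x (Suc y) = (v, wn)" "hedge (Suc x) (Suc y) = (v, we)"
    by (auto simp: vedge_def hedge_def v_def wn_def we_def)
  have st: "up_right_step v wn" "up_right_step v we" by (auto simp: up_right_step_def v_def wn_def we_def)
  from P have up: "\<And>p. p \<in># P \<Longrightarrow> up_right_path p" and S: "image_mset first_edge P = S"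
    and E: "image_mset last_edge P = A + (replicate_mset i1 (vedge x y) + replicate_mset j1 (hedge x (Suc y)))"
    by (auto simp: collections_def ac_simps)
  from E obtain PA PB where PAB: "P = PA + PB" "image_mset last_edge PA = A"
    "image_mset last_edge PB = replicate_mset i1 (vedge x y) + replicate_mset j1 (hedge x (Suc y))"
    by (metis image_mset_eq_plusD)
  have "size PB = i2 + j2" using arg_cong[OF PAB(3), of size] flow by simp
  then obtain P2 P3 where P23: "PB = P2 + P3" "size P2 = i2" "size P3 = j2"
    using multiset_split_size by metis
  have last: "last p = v" if "p \<in># PB" for p
  proof -
    have "last_edge p \<in># image_mset last_edge PB" using that by simp
    then have "snd (last_edge p) = v"
      unfolding PAB(3) by (auto simp: vedge_def hedge_def v_def split: if_splits)
    moreover have "p \<noteq> []" using up that PAB(1) by (fastforce simp: up_right_path_def)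
    ultimately show ?thesis by (simp add: last_edge_def last_conv_nth)
  qed
  have 2: "up_right_path p \<and> last p = v" if "p \<in># P2" for p using that up last PAB(1) P23(1) by auto
  have 3: "up_right_path p \<and> last p = v" if "p \<in># P3" for p using that up last PAB(1) P23(1) by auto
  define P' where "P' = PA + image_mset (\<lambda>p. p @ [wn]) P2 + image_mset (\<lambda>p. p @ [we]) P3"
  have snoc2: "first_edge (p @ [wn]) = first_edge p" "last_edge (p @ [wn]) = (v, wn)" "up_right_path (p @ [wn])"
    if "p \<in># P2" for p
    using up_right_path_snoc[of p wn] 2[OF that] st by simp_all
  have snoc3: "first_edge (p @ [we]) = first_edge p" "last_edge (p @ [we]) = (v, we)" "up_right_path (p @ [we])"
    if "p \<in># P3" for p
    using up_right_path_snoc[of p we] 3[OF that] st by simp_all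
  have "image_mset (\<lambda>p. first_edge (p @ [wn])) P2 = image_mset first_edge P2"
    "image_mset (\<lambda>p. first_edge (p @ [we])) P3 = image_mset first_edge P3"
    by (auto intro!: image_mset_cong simp: snoc2 snoc3)
  then have "image_mset first_edge P' = S"
    unfolding P'_def S[symmetric] PAB(1) P23(1) by (simp add: image_mset.compositionality o_def)
  moreover have "image_mset (\<lambda>p. last_edge (p @ [wn])) P2 = image_mset (\<lambda>_. (v, wn)) P2"
    "image_mset (\<lambda>p. last_edge (p @ [we])) P3 = image_mset (\<lambda>_. (v, we)) P3"
    by (auto intro!: image_mset_cong simp: snoc2 snoc3)
  then have "image_mset last_edge P' = A + replicate_mset i2 (v, wn) + replicate_mset j2 (v, we)"
    unfolding P'_def by (simp add: image_mset.compositionality o_def PAB(2) P23 image_mset_const_eq)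
  moreover have "up_right_path p" if "p \<in># P'" for p
    using that up snoc2(3) snoc3(3) PAB(1) by (auto simp: P'_def)
  ultimately have "P' \<in> collections S (A + replicate_mset i2 (v, wn) + replicate_mset j2 (v, we))"
    by (auto simp: collections_def)
  moreover have "edge_count P' e = edge_count P e + (if e = (v, wn) then i2 else 0) + (if e = (v, we) then j2 else 0)" for e
    using edge_count_snoc[where Q = P2 and e = e, OF 2 st(1)] edge_count_snoc[where Q = P3 and e = e, OF 3 st(2)]
    unfolding P'_def PAB(1) P23(1) edge_count_union P23(2,3) by linarith
  ultimately show ?thesis unfolding ev by blast
qed

text \<open>The end edges are moved up column by column. \<open>A\<close> contains the ends not yet
  reached, including vertical edges of later columns, and therefore varies in the induction. Only
  vertical counts are recorded, since by conservation they determine the horizontal ones.\<close>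

lemma extend_collection_row:
  assumes "P \<in> collections S ((\<Sum>c<n. replicate_mset (K c) (vedge c y)) + replicate_mset (h 0) (hedge 0 (Suc y)) + A)"
    "\<And>x. x < n \<Longrightarrow> K x + h x = L x + h (Suc x)"
  shows "\<exists>P'\<in>collections S ((\<Sum>c<n. replicate_mset (L c) (vedge c (Suc y))) + replicate_mset (h n) (hedge n (Suc y)) + A).
    \<forall>c z. edge_count P' (vedge c z) = edge_count P (vedge c z) + (if z = Suc y \<and> c < n then L c else 0)"
  using assms
proof (induction n arbitrary: A)
  case 0
  then show ?case by (intro bexI[of _ P]) auto
next
  case (Suc n)
  have "P \<in> collections S ((\<Sum>c<n. replicate_mset (K c) (vedge c y)) + replicate_mset (h 0) (hedge 0 (Suc y))
     + (replicate_mset (K n) (vedge n y) + A))"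
    using Suc.prems(1) by (simp add: ac_simps)
  from Suc.IH[OF this Suc.prems(2)] obtain P1 where
    P1: "P1 \<in> collections S ((\<Sum>c<n. replicate_mset (L c) (vedge c (Suc y))) + replicate_mset (h n) (hedge n (Suc y))
     + (replicate_mset (K n) (vedge n y) + A))"
    and c1: "\<And>c z. edge_count P1 (vedge c z) = edge_count P (vedge c z) + (if z = Suc y \<and> c < n then L c else 0)"
    by auto
  have "P1 \<in> collections S (((\<Sum>c<n. replicate_mset (L c) (vedge c (Suc y))) + A) + replicate_mset (K n) (vedge n y)
     + replicate_mset (h n) (hedge n (Suc y)))"
    using P1 by (simp add: ac_simps)
  from extend_collection[OF this Suc.prems(2)[of n]] obtain P2 where
    P2: "P2 \<in> collections S (((\<Sum>c<n. replicate_mset (L c) (vedge c (Suc y))) + A) + replicate_mset (L n) (vedge n (Suc y))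
     + replicate_mset (h (Suc n)) (hedge (Suc n) (Suc y)))"
    and c2: "\<And>e. edge_count P2 e = edge_count P1 e + (if e = vedge n (Suc y) then L n else 0) +
       (if e = hedge (Suc n) (Suc y) then h (Suc n) else 0)"
    by auto
  show ?case
  proof (intro bexI allI)
    show "P2 \<in> collections S ((\<Sum>c<Suc n. replicate_mset (L c) (vedge c (Suc y))) + replicate_mset (h (Suc n)) (hedge (Suc n) (Suc y)) + A)"
      using P2 by (simp add: ac_simps)
    show "edge_count P2 (vedge c z) = edge_count P (vedge c z) + (if z = Suc y \<and> c < Suc n then L c else 0)" for c z
      unfolding c2 c1 by (auto simp: less_Suc_eq)
  qed
qed

lemma count_sum_replicate_vedge:
  "count (\<Sum>c<n. replicate_mset (K c) (vedge c y)) (vedge x z) = (if z = y \<and> x < n then K x else 0)"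
proof -
  have "count (\<Sum>c<n. replicate_mset (K c) (vedge c y)) (vedge x z) = (\<Sum>c<n. if c = x then (if z = y then K x else 0) else 0)"
    unfolding count_sum by (intro sum.cong refl) auto
  then show ?thesis by (simp add: sum.delta)
qed

lemma exists_collection:
  fixes V h :: "nat \<Rightarrow> nat \<Rightarrow> nat" and N n a :: nat
  defines "S \<equiv> (\<Sum>c<n. replicate_mset (V 0 c) (vedge c 0)) + (\<Sum>y<N. replicate_mset a (hedge 0 (Suc y)))"
  assumes flow: "\<And>x y. x < n \<Longrightarrow> y < N \<Longrightarrow> V y x + h y x = V (Suc y) x + h y (Suc x)"
    and h: "\<And>y. y < N \<Longrightarrow> h y 0 = a" "\<And>y. y < N \<Longrightarrow> h y n = 0"
  shows "\<exists>P\<in>collections S (\<Sum>c<n. replicate_mset (V N c) (vedge c N)).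
    \<forall>c<n. \<forall>y\<le>N. edge_count P (vedge c y) = V y c"
proof -
  \<comment> \<open>After \<open>k\<close> rows the ends are the vertical edges above row
    \<open>k\<close> together with the horizontal starting edges of the rows still to come.\<close>
  have "\<exists>P\<in>collections S ((\<Sum>c<n. replicate_mset (V k c) (vedge c k)) + (\<Sum>y\<in>{k..<N}. replicate_mset a (hedge 0 (Suc y)))).
    \<forall>c<n. \<forall>y. edge_count P (vedge c y) = (if y \<le> k then V y c else 0)" if "k \<le> N" for k
    using that
  proof (induction k)
    case 0
    \<comment> \<open>Before the first row each path consists of its starting edge alone, which is
      also its last edge.\<close>
    define P where "P = image_mset (\<lambda>(v, w). [v, w]) S"
    have S: "\<exists>c y. e = vedge c y \<or> e = hedge c y" if "e \<in># S" for e
      using that unfolding S_def by (auto simp: set_mset_sum split: if_splits)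
    have step: "up_right_step (fst e) (snd e)" if "e \<in># S" for e
      using S[OF that] by (auto simp: up_right_step_def vedge_def hedge_def)
    have "image_mset first_edge P = S" "image_mset last_edge P = S"
      unfolding P_def by (simp_all add: image_mset.compositionality o_def first_edge_def last_edge_def case_prod_beta)
    moreover have "up_right_path p" if "p \<in># P" for p
      using that step unfolding P_def by (fastforce simp: up_right_path_def)
    ultimately have P: "P \<in> collections S S" by (auto simp: collections_def)
    have "edge_count P e = count S e" for e
    proof -
      have "edge_count (image_mset (\<lambda>(v, w). [v, w]) T) e = count T e" for T
        by (induction T) (auto simp: edge_count_def path_edges_def)
      then show ?thesis by (simp add: P_def)
    qed
    moreover have "count (\<Sum>y<N. replicate_mset a (hedge 0 (Suc y))) (vedge c z) = 0" for c z
      by (simp add: count_sum)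
    ultimately have "edge_count P (vedge c y) = (if y \<le> 0 then V y c else 0)" if "c < n" for c y
      using that by (auto simp: S_def count_sum_replicate_vedge)
    with P show ?case by (intro bexI[of _ P]) (auto simp: S_def lessThan_atLeast0)
  next
    case (Suc k)
    then obtain P where P: "P \<in> collections S ((\<Sum>c<n. replicate_mset (V k c) (vedge c k)) + (\<Sum>y\<in>{k..<N}. replicate_mset a (hedge 0 (Suc y))))"
      and c: "\<And>c y. c < n \<Longrightarrow> edge_count P (vedge c y) = (if y \<le> k then V y c else 0)" by auto
    have kN: "k < N" using Suc.prems by simp
    have "(\<Sum>y\<in>{k..<N}. replicate_mset a (hedge 0 (Suc y))) = replicate_mset (h k 0) (hedge 0 (Suc k)) + (\<Sum>y\<in>{Suc k..<N}. replicate_mset a (hedge 0 (Suc y)))"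
      using kN h(1) by (simp add: sum.atLeast_Suc_lessThan)
    with P have "P \<in> collections S ((\<Sum>c<n. replicate_mset (V k c) (vedge c k)) + replicate_mset (h k 0) (hedge 0 (Suc k))
      + (\<Sum>y\<in>{Suc k..<N}. replicate_mset a (hedge 0 (Suc y))))" by (simp only: add.assoc)
    from extend_collection_row[where h = "h k" and K = "V k" and L = "V (Suc k)", OF this] flow[OF _ kN] obtain P' where
      P': "P' \<in> collections S ((\<Sum>c<n. replicate_mset (V (Suc k) c) (vedge c (Suc k))) + replicate_mset (h k n) (hedge n (Suc k))
      + (\<Sum>y\<in>{Suc k..<N}. replicate_mset a (hedge 0 (Suc y))))"
      and c': "\<And>c z. edge_count P' (vedge c z) = edge_count P (vedge c z) + (if z = Suc k \<and> c < n then V (Suc k) c else 0)"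
      by auto
    show ?case
    proof (intro bexI allI impI)
      show "P' \<in> collections S ((\<Sum>c<n. replicate_mset (V (Suc k) c) (vedge c (Suc k))) + (\<Sum>y\<in>{Suc k..<N}. replicate_mset a (hedge 0 (Suc y))))"
        using P' h(2)[OF kN] by simp
      show "edge_count P' (vedge c y) = (if y \<le> Suc k then V y c else 0)" if "c < n" for c y
        using that c' c by auto
    qed
  qed
  from this[of N] obtain P where P: "P \<in> collections S (\<Sum>c<n. replicate_mset (V N c) (vedge c N))"
    "\<And>c y. c < n \<Longrightarrow> edge_count P (vedge c y) = (if y \<le> N then V y c else 0)" by auto
  show ?thesis by (rule bexI[OF _ P(1)]) (simp add: P(2))
qed

lemma vertical_edges_eq_sum:
  assumes "\<forall>e\<in>set la. 0 \<le> e \<and> e < int n"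
  shows "vertical_edges la (int y) = (\<Sum>c<n. replicate_mset (count_list (map nat la) c) (vedge c y))"
  using assms
proof (induction la)
  case Nil
  then show ?case by (simp add: vertical_edges_def)
next
  case (Cons e la)
  then have e: "nat e < n" "0 \<le> e" by auto
  have "replicate_mset (count_list (map nat (e # la)) c) (vedge c y) =
     (if c = nat e then {#vedge (nat e) y#} else {#}) + replicate_mset (count_list (map nat la) c) (vedge c y)" for c
    by auto
  then have "(\<Sum>c<n. replicate_mset (count_list (map nat (e # la)) c) (vedge c y)) =
    {#vedge (nat e) y#} + (\<Sum>c<n. replicate_mset (count_list (map nat la) c) (vedge c y))"
    using e by (simp only: sum.distrib sum.delta finite_lessThan lessThan_iff if_True)
  moreover have "vertical_edges (e # la) (int y) = {#vedge (nat e) y#} + vertical_edges la (int y)"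
    using e by (simp add: vertical_edges_def vedge_def)
  ultimately show ?case using Cons by simp
qed

lemma horizontal_edges_eq_sum:
  "mset (map (\<lambda>j. ((- 1, int j), (0, int j))) [1..<Suc N]) = (\<Sum>y<N. replicate_mset 1 (hedge 0 (Suc y)))"
  by (induction N) (auto simp: hedge_def)

section \<open>Collections as sequences of rows\<close>

text \<open>The number of paths on the edge entering column \<open>x\<close> from the left. The truncated subtraction is
  harmless under \<open>row_ok\<close>.\<close>

primrec flux :: "nat \<Rightarrow> nat list \<Rightarrow> nat list \<Rightarrow> nat \<Rightarrow> nat" where
  "flux a K L 0 = a"
| "flux a K L (Suc x) = flux a K L x + K ! x - L ! x"

text \<open>More than one path on a horizontal edge to the East would give weight 0 at the next
  vertex, and none may leave the last column. The bound on \<open>L ! x\<close> makes the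
  subtraction in \<open>flux\<close> exact.\<close>

definition row_ok :: "nat \<Rightarrow> nat list \<Rightarrow> nat list \<Rightarrow> bool" where
  "row_ok a K L \<longleftrightarrow> length K = length L \<and> flux a K L (length L) = 0 \<and>
     (\<forall>x<length L. L ! x \<le> flux a K L x + K ! x \<and> flux a K L (Suc x) \<le> 1)"

definition row_wt :: "complex \<Rightarrow> complex \<Rightarrow> complex \<Rightarrow> nat \<Rightarrow> nat list \<Rightarrow> nat list \<Rightarrow> complex" where
  "row_wt q s w a K L = (\<Prod>x<length L. vertex_weight q s w (K ! x) (flux a K L x) (L ! x) (flux a K L (Suc x)))"

lemma flux_Cons: "flux a (m # K) (l # L) (Suc x) = flux (a + m - l) K L x"
  by (induction x) simp_all

lemma row_ok_Nil: "row_ok a K [] \<longleftrightarrow> K = [] \<and> a = 0"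
  by (auto simp: row_ok_def)

lemma row_ok_Cons:
  "row_ok a (m # K) (l # L) \<longleftrightarrow> l \<le> a + m \<and> a + m - l \<le> 1 \<and> row_ok (a + m - l) K L"
  unfolding row_ok_def length_Cons All_less_Suc2 flux_Cons nth_Cons_Suc by auto

lemma row_wt_Cons:
  "row_wt q s w a (m # K) (l # L) = vertex_weight q s w m a l (a + m - l) * row_wt q s w (a + m - l) K L"
  unfolding row_wt_def length_Cons prod.lessThan_Suc_shift flux_Cons nth_Cons_Suc by simp

text \<open>Conservation read downwards: with the row above given, the number \<open>b\<close> of
  paths going East fixes the occupation \<open>l + b - a\<close> below.\<close>

lemma Collect_row_ok_Cons:
  "{K. row_ok a K (l # L)} = (\<Union>b\<in>{b \<in> {0, 1}. a \<le> l + b}. (#) (l + b - a) ` {K. row_ok b K L})" (is "?A = ?B")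
proof
  show "?A \<subseteq> ?B"
  proof
    fix K assume "K \<in> ?A"
    then have ok: "row_ok a K (l # L)" by simp
    then obtain m K' where K: "K = m # K'" by (cases K) (auto simp: row_ok_def)
    define b where "b = a + m - l"
    from ok have "l \<le> a + m" "b \<le> 1" "row_ok b K' L" by (auto simp: K row_ok_Cons b_def)
    moreover from this(1) have "a \<le> l + b" "m = l + b - a" by (auto simp: b_def)
    moreover from \<open>b \<le> 1\<close> have "b \<in> {0, 1}" by auto
    ultimately show "K \<in> ?B" unfolding K by blast
  qed
  show "?B \<subseteq> ?A" by (auto simp: row_ok_Cons)
qed

text \<open>The row operator as a transfer matrix. Finiteness is proved along with it because
  splitting the sum by the first column requires it.\<close>

lemma row_op_eq_sum:
  "finite {K. row_ok a K L} \<and> row_op q s w a \<Phi> L = (\<Sum>K | row_ok a K L. row_wt q s w a K L * \<Phi> K)"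
proof (induction L arbitrary: a \<Phi>)
  case Nil
  have "{K. row_ok a K []} = (if a = 0 then {[]} else {})" by (auto simp: row_ok_Nil)
  then show ?case by (simp add: row_wt_def)
next
  case (Cons l L)
  define B where "B = {b \<in> {0, 1::nat}. a \<le> l + b}"
  have fin: "finite {K. row_ok b K L}" for b using Cons by blast
  have fin': "finite {K. row_ok a K (l # L)}"
    unfolding Collect_row_ok_Cons using fin by auto
  have "(\<Sum>K | row_ok a K (l # L). row_wt q s w a K (l # L) * \<Phi> K) =
    (\<Sum>b\<in>B. \<Sum>K\<in>(#) (l + b - a) ` {K. row_ok b K L}. row_wt q s w a K (l # L) * \<Phi> K)"
    unfolding Collect_row_ok_Cons B_def[symmetric]
    by (rule sum.UNION_disjoint) (use fin in \<open>auto simp: B_def\<close>)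
  also have "\<dots> = (\<Sum>b\<in>B. vertex_weight q s w (l + b - a) a l b * row_op q s w b (\<lambda>ks. \<Phi> ((l + b - a) # ks)) L)"
  proof (rule sum.cong[OF refl])
    fix b assume "b \<in> B"
    then have "a + (l + b - a) - l = b" by (auto simp: B_def)
    then have "(\<Sum>K\<in>(#) (l + b - a) ` {K. row_ok b K L}. row_wt q s w a K (l # L) * \<Phi> K) =
       (\<Sum>K | row_ok b K L. vertex_weight q s w (l + b - a) a l b * (row_wt q s w b K L * \<Phi> ((l + b - a) # K)))"
      by (subst sum.reindex) (simp_all add: row_wt_Cons mult.assoc)
    then show "(\<Sum>K\<in>(#) (l + b - a) ` {K. row_ok b K L}. row_wt q s w a K (l # L) * \<Phi> K) =
      vertex_weight q s w (l + b - a) a l b * row_op q s w b (\<lambda>ks. \<Phi> ((l + b - a) # ks)) L"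
      by (simp only: sum_distrib_left[symmetric] conjunct2[OF Cons.IH])
  qed
  also have "\<dots> = row_op q s w a \<Phi> (l # L)"
    unfolding row_op.simps B_def by (rule sum.mono_neutral_cong_left) auto
  finally show ?case using fin' by simp
qed

text \<open>The default \<open>[]\<close> above level \<open>N\<close> makes a sequence of rows one
  function only; finiteness of the set and injectivity of \<open>row_config\<close> depend on
  this.\<close>

definition row_seqs :: "nat \<Rightarrow> nat list \<Rightarrow> nat \<Rightarrow> nat list \<Rightarrow> (nat \<Rightarrow> nat list) set" where
  "row_seqs a K0 N L = {V. V 0 = K0 \<and> V N = L \<and> (\<forall>y>N. V y = []) \<and> (\<forall>y<N. row_ok a (V y) (V (Suc y)))}"

primrec iterate_rows :: "complex \<Rightarrow> complex \<Rightarrow> (nat \<Rightarrow> complex) \<Rightarrow> nat \<Rightarrow> nat list \<Rightarrow> nat \<Rightarrow> nat list \<Rightarrow> complex" where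
  "iterate_rows q s u a K0 0 = (\<lambda>L. if L = K0 then 1 else 0)"
| "iterate_rows q s u a K0 (Suc N) = row_op q s (u (Suc N)) a (iterate_rows q s u a K0 N)"

lemma row_seqs_Suc:
  "row_seqs a K0 (Suc N) L = (\<Union>K\<in>{K. row_ok a K L}. (\<lambda>V. V(Suc N := L)) ` row_seqs a K0 N K)" (is "?A = ?B")
proof
  show "?A \<subseteq> ?B"
  proof
    fix V assume V: "V \<in> ?A"
    have "V(Suc N := []) \<in> row_seqs a K0 N (V N)" "row_ok a (V N) L" "V = (V(Suc N := []))(Suc N := L)"
      using V by (auto simp: row_seqs_def)
    then show "V \<in> ?B" by blast
  qed
  show "?B \<subseteq> ?A" by (auto simp: row_seqs_def less_Suc_eq)
qed

lemma iterate_rows_eq_sum: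
  "finite (row_seqs a K0 N L) \<and>
   iterate_rows q s u a K0 N L = (\<Sum>V\<in>row_seqs a K0 N L. \<Prod>y<N. row_wt q s (u (Suc y)) a (V y) (V (Suc y)))"
proof (induction N arbitrary: L)
  case 0
  have "row_seqs a K0 0 L = (if L = K0 then {\<lambda>y. if y = 0 then L else []} else {})"
    by (auto simp: row_seqs_def fun_eq_iff)
  then show ?case by simp
next
  case (Suc N)
  have fin: "finite (row_seqs a K0 N K)" for K using Suc by blast
  have inj: "inj_on (\<lambda>V. V(Suc N := L)) (row_seqs a K0 N K)" for K
  proof (rule inj_onI)
    fix V W assume VW: "V \<in> row_seqs a K0 N K" "W \<in> row_seqs a K0 N K" "V(Suc N := L) = W(Suc N := L)"
    then have "V (Suc N) = W (Suc N)" by (simp add: row_seqs_def)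
    with VW(3) show "V = W" by (metis fun_upd_triv fun_upd_upd)
  qed
  have fin': "finite (row_seqs a K0 (Suc N) L)"
    unfolding row_seqs_Suc using fin row_op_eq_sum by auto
  have "(\<Sum>V\<in>row_seqs a K0 (Suc N) L. \<Prod>y<Suc N. row_wt q s (u (Suc y)) a (V y) (V (Suc y))) =
    (\<Sum>K | row_ok a K L. \<Sum>V\<in>(\<lambda>V. V(Suc N := L)) ` row_seqs a K0 N K. \<Prod>y<Suc N. row_wt q s (u (Suc y)) a (V y) (V (Suc y)))"
    unfolding row_seqs_Suc
  proof (rule sum.UNION_disjoint)
    show "\<forall>K\<in>{K. row_ok a K L}. \<forall>K'\<in>{K. row_ok a K L}. K \<noteq> K' \<longrightarrow>
      (\<lambda>V. V(Suc N := L)) ` row_seqs a K0 N K \<inter> (\<lambda>V. V(Suc N := L)) ` row_seqs a K0 N K' = {}"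
    proof (intro ballI impI equals0I)
      fix K K' V assume K: "K \<noteq> K'" and V: "V \<in> (\<lambda>V. V(Suc N := L)) ` row_seqs a K0 N K \<inter> (\<lambda>V. V(Suc N := L)) ` row_seqs a K0 N K'"
      \<comment> \<open>The level \<open>N\<close> survives the update at \<open>Suc N\<close> and
        so tells the sets for different \<open>K\<close> apart.\<close>
      have N: "V N = K" if "V \<in> (\<lambda>V. V(Suc N := L)) ` row_seqs a K0 N K" for K
        using that by (auto simp: row_seqs_def)
      from N[OF IntD1[OF V]] N[OF IntD2[OF V]] K show False by simp
    qed
  qed (use fin row_op_eq_sum in auto)
  also have "\<dots> = (\<Sum>K | row_ok a K L. row_wt q s (u (Suc N)) a K L * iterate_rows q s u a K0 N K)"
  proof (rule sum.cong[OF refl])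
    fix K
    have t: "(\<Prod>y<Suc N. row_wt q s (u (Suc y)) a ((V(Suc N := L)) y) ((V(Suc N := L)) (Suc y))) =
       row_wt q s (u (Suc N)) a K L * (\<Prod>y<N. row_wt q s (u (Suc y)) a (V y) (V (Suc y)))"
      if "V \<in> row_seqs a K0 N K" for V
      using that by (auto simp: row_seqs_def mult.commute)
    have "(\<Sum>V\<in>(\<lambda>V. V(Suc N := L)) ` row_seqs a K0 N K. \<Prod>y<Suc N. row_wt q s (u (Suc y)) a (V y) (V (Suc y))) =
      (\<Sum>V\<in>row_seqs a K0 N K. row_wt q s (u (Suc N)) a K L * (\<Prod>y<N. row_wt q s (u (Suc y)) a (V y) (V (Suc y))))"
      unfolding sum.reindex[OF inj] o_def by (rule sum.cong[OF refl]) (rule t)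
    then show "(\<Sum>V\<in>(\<lambda>V. V(Suc N := L)) ` row_seqs a K0 N K. \<Prod>y<Suc N. row_wt q s (u (Suc y)) a (V y) (V (Suc y))) =
      row_wt q s (u (Suc N)) a K L * iterate_rows q s u a K0 N K"
      by (simp only: sum_distrib_left[symmetric] conjunct2[OF Suc.IH])
  qed
  also have "\<dots> = iterate_rows q s u a K0 (Suc N) L"
    by (simp only: iterate_rows.simps conjunct2[OF row_op_eq_sum])
  finally show ?case using fin' by simp
qed

text \<open>One boundary condition for both functions: \<open>a = 1\<close> with empty
  \<open>mu\<close> for (i), \<open>a = 0\<close> with a list of zeros for (ii).\<close>

definition strip_starts :: "nat \<Rightarrow> nat \<Rightarrow> int list \<Rightarrow> edge multiset" where
  "strip_starts a N mu = vertical_edges mu 0 + (\<Sum>y<N. replicate_mset a (hedge 0 (Suc y)))"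

text \<open>Row \<open>y\<close> lies between the levels \<open>y - 1\<close> and \<open>y\<close>.
  The value is \<open>None\<close> where nothing enters a vertex, in agreement with the domain of
  \<open>local_config\<close>.\<close>

definition row_config :: "nat \<Rightarrow> nat \<Rightarrow> nat \<Rightarrow> (nat \<Rightarrow> nat list) \<Rightarrow> vertex \<Rightarrow> (nat \<times> nat \<times> nat \<times> nat) option" where
  "row_config n N a V = (\<lambda>(x, y). if 0 \<le> x \<and> x < int n \<and> 1 \<le> y \<and> y \<le> int N then
     let K = V (nat y - 1); L = V (nat y); i = nat x in
       if K ! i + flux a K L i = 0 then None else Some (K ! i, flux a K L i, L ! i, flux a K L (Suc i))
     else None)"

lemma row_config_inside:
  assumes "x < n" "y < N"
  shows "row_config n N a V (int x, int (Suc y)) =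
    (if V y ! x + flux a (V y) (V (Suc y)) x = 0 then None else
      Some (V y ! x, flux a (V y) (V (Suc y)) x, V (Suc y) ! x, flux a (V y) (V (Suc y)) (Suc x)))"
proof -
  have "nat (int (Suc y)) - 1 = y" "nat (int (Suc y)) = Suc y" "nat (int x) = x" by auto
  with assms show ?thesis by (simp only: row_config_def Let_def prod.case) auto
qed

lemma inside_strip_cases:
  assumes "0 \<le> x" "x < int n" "1 \<le> y" "y \<le> int N"
  obtains x' y' where "x = int x'" "y = int (Suc y')" "x' < n" "y' < N"
proof
  show "x = int (nat x)" "y = int (Suc (nat y - 1))" "nat x < n" "nat y - 1 < N"
    using assms by auto
qed

context
  fixes n N a :: nat and mu la :: "int list"
  assumes mu: "\<forall>e\<in>set mu. 0 \<le> e \<and> e < int n" and la: "\<forall>e\<in>set la. 0 \<le> e \<and> e < int n"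
begin

lemma strip_starts_eq_sum:
  "strip_starts a N mu = (\<Sum>c<n. replicate_mset (occupation n (map nat mu) ! c) (vedge c 0)) +
     (\<Sum>y<N. replicate_mset a (hedge 0 (Suc y)))"
  using vertical_edges_eq_sum[OF mu, of 0] by (simp add: strip_starts_def occupation_def)

lemma vertical_edges_top_eq_sum:
  "vertical_edges la (int N) = (\<Sum>c<n. replicate_mset (occupation n (map nat la) ! c) (vedge c N))"
  using vertical_edges_eq_sum[OF la, of N] by (simp add: occupation_def)

lemma strip_path_collection:
  assumes "P \<in> collections (strip_starts a N mu) (vertical_edges la (int N))" "p \<in># P"
  shows "strip_path n N p"
proof -
  have "up_right_path p" using assms by (auto simp: collections_def)
  have "first_edge p \<in># strip_starts a N mu" "last_edge p \<in># vertical_edges la (int N)"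
    using assms unfolding collections_def by (metis (mono_tags, lifting) image_eqI mem_Collect_eq set_image_mset)+
  then have 1: "(\<exists>x. first_edge p = ((int x, 0), (int x, 1))) \<or>
      (\<exists>y<N. first_edge p = ((- 1, int (Suc y)), (0, int (Suc y))))"
    and 2: "\<exists>x<n. last_edge p = ((int x, int N), (int x, int N + 1))"
    unfolding strip_starts_eq_sum vertical_edges_top_eq_sum
    by (auto simp: set_mset_sum vedge_def hedge_def split: if_splits)
  have "(\<exists>x. first_edge p = ((int x, 0), (int x, 1))) \<or>
      (\<exists>y\<in>{1..N}. first_edge p = ((- 1, int y), (0, int y)))"
    using 1 by (metis Suc_leI atLeastAtMost_iff le_add1 plus_1_eq_Suc)
  with 2 \<open>up_right_path p\<close> show ?thesis by (simp add: strip_path_def)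
qed

definition edge_rows :: "vertex list multiset \<Rightarrow> nat \<Rightarrow> nat list" where
  "edge_rows P y = (if y \<le> N then map (\<lambda>x. edge_count P (vedge x y)) [0..<n] else [])"

lemma length_edge_rows: "y \<le> N \<Longrightarrow> length (edge_rows P y) = n"
  by (simp add: edge_rows_def)

lemma nth_edge_rows: "x < n \<Longrightarrow> y \<le> N \<Longrightarrow> edge_rows P y ! x = edge_count P (vedge x y)"
  by (simp add: edge_rows_def)

context
  fixes P
  assumes P: "P \<in> collections (strip_starts a N mu) (vertical_edges la (int N))"
begin

text \<open>The left boundary gives the value \<open>a\<close>, and conservation at the vertices
  carries it through the row. Hence the vertical edge counts determine the horizontal ones.\<close>

lemma flux_edge_rows:
  assumes "y < N" "x \<le> n"
  shows "flux a (edge_rows P y) (edge_rows P (Suc y)) x = edge_count P (hedge x (Suc y))"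
  using assms(2)
proof (induction x)
  case 0
  have "edge_count P (hedge 0 (Suc y)) = count (strip_starts a N mu) (hedge 0 (Suc y))"
    using edge_count_left[of P n N "Suc y", OF strip_path_collection[OF P]] P by (simp add: collections_def)
  also have "\<dots> = (\<Sum>z<N. if z = y then a else 0)"
    unfolding strip_starts_eq_sum by (simp add: count_sum)
  also have "\<dots> = a" using assms(1) by (simp add: sum.delta)
  finally show ?case by simp
next
  case (Suc x)
  then show ?case
    using assms(1) edge_count_vertex[of P n N y x, OF strip_path_collection[OF P]]
    by (simp add: nth_edge_rows)
qed

lemma edge_rows_0: "edge_rows P 0 = occupation n (map nat mu)"
proof (rule nth_equalityI)
  show "length (edge_rows P 0) = length (occupation n (map nat mu))"
    by (simp add: edge_rows_def occupation_def)
  fix x assume "x < length (edge_rows P 0)"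
  then have x: "x < n" by (simp add: edge_rows_def)
  have "edge_rows P 0 ! x = count (strip_starts a N mu) (vedge x 0)"
    using edge_count_bottom[of P n N x, OF strip_path_collection[OF P]] P x by (simp add: nth_edge_rows collections_def)
  also have "\<dots> = occupation n (map nat mu) ! x"
    unfolding strip_starts_eq_sum using x by (simp add: count_sum_replicate_vedge) (simp add: count_sum)
  finally show "edge_rows P 0 ! x = occupation n (map nat mu) ! x" .
qed

lemma edge_rows_top: "edge_rows P N = occupation n (map nat la)"
proof (rule nth_equalityI)
  show "length (edge_rows P N) = length (occupation n (map nat la))"
    by (simp add: edge_rows_def occupation_def)
  fix x assume "x < length (edge_rows P N)"
  then have x: "x < n" by (simp add: edge_rows_def)
  have "edge_rows P N ! x = count (vertical_edges la (int N)) (vedge x N)"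
    using edge_count_top[of P n N x, OF strip_path_collection[OF P]] P x by (simp add: nth_edge_rows collections_def)
  also have "\<dots> = occupation n (map nat la) ! x"
    unfolding vertical_edges_top_eq_sum using x by (simp add: count_sum_replicate_vedge)
  finally show "edge_rows P N ! x = occupation n (map nat la) ! x" .
qed

lemma local_config_eq_row_config: "local_config P = row_config n N a (edge_rows P)"
proof (rule ext)
  fix v :: vertex
  obtain x y where v: "v = (x, y)" by (cases v)
  show "local_config P v = row_config n N a (edge_rows P) v"
  proof (cases "0 \<le> x \<and> x < int n \<and> 1 \<le> y \<and> y \<le> int N")
    case True
    then obtain x' y' where xy: "x = int x'" "y = int (Suc y')" "x' < n" "y' < N"
      using inside_strip_cases by blast
    have "(x, y) \<in> (\<Union>p \<in> set_mset P. path_interior p) \<longleftrightarrow> size {#p \<in># P. (x, y) \<in> path_interior p#} \<noteq> 0"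
      unfolding size_eq_0_iff_empty by (auto simp: filter_mset_eq_mempty_iff)
    also have "\<dots> \<longleftrightarrow> edge_rows P y' ! x' + flux a (edge_rows P y') (edge_rows P (Suc y')) x' \<noteq> 0"
      using edge_count_vertex(1)[of P n N y' x', OF strip_path_collection[OF P]] xy
      by (simp add: nth_edge_rows flux_edge_rows)
    finally have i: "(int x', int (Suc y')) \<in> (\<Union>p \<in> set_mset P. path_interior p) \<longleftrightarrow>
      edge_rows P y' ! x' + flux a (edge_rows P y') (edge_rows P (Suc y')) x' \<noteq> 0"
      using xy by simp
    have e: "edge_count P ((int x', int (Suc y') - 1), (int x', int (Suc y'))) = edge_rows P y' ! x'"
      "edge_count P ((int x' - 1, int (Suc y')), (int x', int (Suc y'))) = flux a (edge_rows P y') (edge_rows P (Suc y')) x'"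
      "edge_count P ((int x', int (Suc y')), (int x', int (Suc y') + 1)) = edge_rows P (Suc y') ! x'"
      "edge_count P ((int x', int (Suc y')), (int x' + 1, int (Suc y'))) = flux a (edge_rows P y') (edge_rows P (Suc y')) (Suc x')"
      using xy by (simp_all add: nth_edge_rows flux_edge_rows vedge_def hedge_def add.commute del: flux.simps)
    show ?thesis
      unfolding v xy(1,2) row_config_inside[OF xy(3,4)] local_config_def prod.case e i by simp
  next
    case False
    then have "(x, y) \<notin> (\<Union>p \<in> set_mset P. path_interior p)"
      using strip_path_interior[OF strip_path_collection[OF P]] by auto
    then have "local_config P v = None" unfolding v local_config_def prod.case by (rule if_not_P)
    moreover have "row_config n N a (edge_rows P) v = None"
      unfolding v row_config_def prod.case using False by (rule if_not_P)
    ultimately show ?thesis by simp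
  qed
qed

lemma row_ok_edge_rows:
  assumes "y < N" "\<And>x. x < n \<Longrightarrow> edge_count P (hedge (Suc x) (Suc y)) \<le> 1"
  shows "row_ok a (edge_rows P y) (edge_rows P (Suc y))"
proof -
  have len: "length (edge_rows P y) = n" "length (edge_rows P (Suc y)) = n"
    using assms(1) by (simp_all add: length_edge_rows)
  have "flux a (edge_rows P y) (edge_rows P (Suc y)) n = 0"
    using flux_edge_rows[OF assms(1), of n] edge_count_right[of P n N, OF strip_path_collection[OF P]] by simp
  moreover have "edge_rows P (Suc y) ! x \<le> flux a (edge_rows P y) (edge_rows P (Suc y)) x + edge_rows P y ! x \<and>
    flux a (edge_rows P y) (edge_rows P (Suc y)) (Suc x) \<le> 1" if "x < n" for x
    using that assms edge_count_vertex[of P n N y x, OF strip_path_collection[OF P]]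
      flux_edge_rows[OF assms(1), of x] flux_edge_rows[OF assms(1), of "Suc x"]
    by (simp add: nth_edge_rows del: flux.simps)
  ultimately show ?thesis unfolding row_ok_def len by auto
qed

end

lemma row_seqs_length:
  assumes "V \<in> row_seqs a (occupation n (map nat mu)) N (occupation n (map nat la))" "y \<le> N"
  shows "length (V y) = n"
  using assms(2)
proof (induction y)
  case 0
  then show ?case using assms(1) by (simp add: row_seqs_def occupation_def)
next
  case (Suc y)
  then have "row_ok a (V y) (V (Suc y))" using assms(1) by (simp add: row_seqs_def)
  then show ?case using Suc by (simp add: row_ok_def)
qed

lemma row_ok_flow:
  assumes "row_ok a K L" "x < length L"
  shows "K ! x + flux a K L x = L ! x + flux a K L (Suc x)"
  using assms by (auto simp: row_ok_def)

lemma exists_collection_row_seq: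
  assumes V: "V \<in> row_seqs a (occupation n (map nat mu)) N (occupation n (map nat la))"
  shows "\<exists>P\<in>collections (strip_starts a N mu) (vertical_edges la (int N)). edge_rows P = V"
proof -
  have ok: "row_ok a (V y) (V (Suc y))" if "y < N" for y using V that by (simp add: row_seqs_def)
  have len: "length (V y) = n" if "y \<le> N" for y using row_seqs_length[OF V that] .
  have "\<exists>P\<in>collections ((\<Sum>c<n. replicate_mset (V 0 ! c) (vedge c 0)) + (\<Sum>y<N. replicate_mset a (hedge 0 (Suc y))))
      (\<Sum>c<n. replicate_mset (V N ! c) (vedge c N)).
    \<forall>c<n. \<forall>y\<le>N. edge_count P (vedge c y) = V y ! c"
  proof (rule exists_collection)
    show "V y ! x + flux a (V y) (V (Suc y)) x = V (Suc y) ! x + flux a (V y) (V (Suc y)) (Suc x)"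
      if "x < n" "y < N" for x y
      using row_ok_flow[OF ok[OF that(2)], of x] that len[of "Suc y"] by simp
    show "flux a (V y) (V (Suc y)) n = 0" if "y < N" for y
      using ok[OF that] len[of "Suc y"] that by (simp add: row_ok_def)
  qed simp
  moreover have "V 0 = occupation n (map nat mu)" "V N = occupation n (map nat la)"
    using V by (simp_all add: row_seqs_def)
  ultimately obtain P where P: "P \<in> collections (strip_starts a N mu) (vertical_edges la (int N))"
    and c: "\<And>c y. c < n \<Longrightarrow> y \<le> N \<Longrightarrow> edge_count P (vedge c y) = V y ! c"
    unfolding strip_starts_eq_sum vertical_edges_top_eq_sum by auto
  have "edge_rows P y = V y" for y
  proof (cases "y \<le> N")
    case True
    then show ?thesis by (intro nth_equalityI) (simp_all add: length_edge_rows len nth_edge_rows c)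
  next
    case False
    then show ?thesis using V by (simp add: edge_rows_def row_seqs_def)
  qed
  with P show ?thesis by blast
qed

lemma inj_on_row_config:
  "inj_on (row_config n N a) (row_seqs a (occupation n (map nat mu)) N (occupation n (map nat la)))"
proof (rule inj_onI)
  fix V W assume V: "V \<in> row_seqs a (occupation n (map nat mu)) N (occupation n (map nat la))"
    and W: "W \<in> row_seqs a (occupation n (map nat mu)) N (occupation n (map nat la))"
    and eq: "row_config n N a V = row_config n N a W"
  \<comment> \<open>The row above is given by the North numbers. At an empty vertex nothing enters,
    so by conservation the North number is 0 as well.\<close>
  have top: "U (Suc y) ! x = (case row_config n N a U (int x, int (Suc y)) of None \<Rightarrow> 0 | Some (i1, j1, i2, j2) \<Rightarrow> i2)"
    if U: "U \<in> row_seqs a (occupation n (map nat mu)) N (occupation n (map nat la))" and xy: "x < n" "y < N" for U x y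
  proof -
    have "row_ok a (U y) (U (Suc y))" "length (U (Suc y)) = n"
      using U xy row_seqs_length[OF U] by (simp_all add: row_seqs_def)
    then show ?thesis unfolding row_config_inside[OF xy] using row_ok_flow[of "U y" "U (Suc y)" x] xy by auto
  qed
  have "V y = W y" for y
  proof (cases "y \<le> N")
    case True
    show ?thesis
    proof (cases y)
      case 0
      then show ?thesis using V W by (simp add: row_seqs_def)
    next
      case (Suc z)
      show ?thesis
      proof (rule nth_equalityI)
        show "length (V y) = length (W y)" using row_seqs_length[OF V True] row_seqs_length[OF W True] by simp
        fix x assume "x < length (V y)"
        then have "x < n" using row_seqs_length[OF V True] by simp
        then show "V y ! x = W y ! x" using top[OF V, of x z] top[OF W, of x z] eq True Suc by simp
      qed
    qed
  next
    case False
    then show ?thesis using V W by (simp add: row_seqs_def)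
  qed
  then show "V = W" by (rule ext)
qed

lemma dom_row_config_subset:
  "dom (row_config n N a V) \<subseteq> (\<lambda>(x, y). (int x, int (Suc y))) ` ({..<n} \<times> {..<N})"
proof
  fix v assume "v \<in> dom (row_config n N a V)"
  then obtain x y where v: "v = (x, y)" and "0 \<le> x" "x < int n" "1 \<le> y" "y \<le> int N"
    by (cases v) (auto simp: row_config_def split: if_splits)
  then obtain x' y' where "x = int x'" "y = int (Suc y')" "x' < n" "y' < N"
    by (elim inside_strip_cases[of x n y N])
  then show "v \<in> (\<lambda>(x, y). (int x, int (Suc y))) ` ({..<n} \<times> {..<N})"
    unfolding v by (intro image_eqI[of _ _ "(x', y')"]) auto
qed

lemma config_weight_row_config:
  assumes V: "V \<in> row_seqs a (occupation n (map nat mu)) N (occupation n (map nat la))"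
    and nz: "\<forall>i\<in>{1..N}. 1 - s * u i \<noteq> 0"
  shows "config_weight q s u (row_config n N a V) = (\<Prod>y<N. row_wt q s (u (Suc y)) a (V y) (V (Suc y)))"
proof -
  define w where "w = (\<lambda>(x, y). vertex_weight q s (u (Suc y)) (V y ! x) (flux a (V y) (V (Suc y)) x)
     (V (Suc y) ! x) (flux a (V y) (V (Suc y)) (Suc x)))"
  define g where "g = (\<lambda>(x :: nat, y :: nat). (int x, int (Suc y)))"
  define f where "f v = (case the (row_config n N a V v) of (i1, j1, i2, j2) \<Rightarrow>
        vertex_weight q s (u (nat (snd v))) i1 j1 i2 j2)" for v
  define D where "D = {z \<in> {..<n} \<times> {..<N}. g z \<in> dom (row_config n N a V)}"
  have inj: "inj_on g A" for A by (auto simp: g_def inj_on_def)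
  have "dom (row_config n N a V) = g ` D"
    using dom_row_config_subset[of V] unfolding D_def g_def by blast
  then have "config_weight q s u (row_config n N a V) = (\<Prod>z\<in>D. f (g z))"
    unfolding config_weight_def f_def[symmetric] by (simp add: prod.reindex[OF inj])
  also have "\<dots> = (\<Prod>z\<in>{..<n} \<times> {..<N}. w z)"
  proof (rule prod.mono_neutral_cong_left)
    \<comment> \<open>An empty vertex has weight \<open>(1 - s * u) / (1 - s * u) = 1\<close> since
      the denominator is nonzero, so the product may run over the whole strip.\<close>
    show "\<forall>z\<in>{..<n} \<times> {..<N} - D. w z = 1"
    proof
      fix z assume z: "z \<in> {..<n} \<times> {..<N} - D"
      then obtain x y where xy: "z = (x, y)" "x < n" "y < N" by auto
      have "row_config n N a V (int x, int (Suc y)) = None"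
        using z xy by (auto simp: D_def g_def)
      then have 0: "V y ! x = 0" "flux a (V y) (V (Suc y)) x = 0"
        unfolding row_config_inside[OF xy(2,3)] by (auto split: if_splits)
      have "row_ok a (V y) (V (Suc y))" "length (V (Suc y)) = n"
        using V xy row_seqs_length[OF V] by (simp_all add: row_seqs_def)
      then have "V (Suc y) ! x = 0" "flux a (V y) (V (Suc y)) (Suc x) = 0"
        using row_ok_flow[of "V y" "V (Suc y)" x] xy 0 by simp_all
      with 0 show "w z = 1" using nz xy(3) by (simp add: w_def xy(1) vertex_weight_def del: flux.simps)
    qed
    show "f (g z) = w z" if "z \<in> D" for z
    proof -
      from that obtain x y where xy: "z = (x, y)" "x < n" "y < N" by (auto simp: D_def)
      have "row_config n N a V (int x, int (Suc y)) \<noteq> None" using that xy by (auto simp: D_def g_def)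
      then have "row_config n N a V (int x, int (Suc y)) = Some (V y ! x, flux a (V y) (V (Suc y)) x, V (Suc y) ! x, flux a (V y) (V (Suc y)) (Suc x))"
        unfolding row_config_inside[OF xy(2,3)] by (auto split: if_splits)
      moreover have "nat (int (Suc y)) = Suc y" by simp
      ultimately show ?thesis by (simp only: f_def g_def w_def xy(1) prod.case option.sel snd_conv)
    qed
  qed (auto simp: D_def)
  also have "\<dots> = (\<Prod>y<N. \<Prod>x<n. w (x, y))"
    by (subst prod.swap, subst prod.cartesian_product) simp
  also have "\<dots> = (\<Prod>y<N. row_wt q s (u (Suc y)) a (V y) (V (Suc y)))"
    by (intro prod.cong refl) (use row_seqs_length[OF V] in \<open>simp add: row_wt_def w_def del: flux.simps\<close>)
  finally show ?thesis .
qed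

text \<open>These are the collections that do not come from a row sequence.\<close>

lemma config_weight_eq_0:
  assumes P: "P \<in> collections (strip_starts a N mu) (vertical_edges la (int N))"
    and x: "x < n" "y < N" "1 < edge_count P (hedge (Suc x) (Suc y))"
  shows "config_weight q s u (local_config P) = 0"
proof -
  \<comment> \<open>No path crosses the right boundary, so the crowded edge leads to another vertex
    of the strip, whose West number exceeds 1.\<close>
  have "Suc x \<noteq> n"
    using x(3) edge_count_right[of P n N, OF strip_path_collection[OF P]] by auto
  then have x': "Suc x < n" using x(1) by simp
  define v where "v = (int (Suc x), int (Suc y))"
  define K L where "K = edge_rows P y" and "L = edge_rows P (Suc y)"
  have f: "1 < flux a K L (Suc x)" unfolding K_def L_def using flux_edge_rows[OF P x(2), of "Suc x"] x by simp
  then have c: "local_config P v = Some (K ! Suc x, flux a K L (Suc x), L ! Suc x, flux a K L (Suc (Suc x)))"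
    unfolding local_config_eq_row_config[OF P] v_def row_config_inside[OF x' x(2)] K_def L_def by simp
  have "finite (dom (local_config P))"
    unfolding local_config_eq_row_config[OF P] by (rule finite_subset[OF dom_row_config_subset]) simp
  moreover have "v \<in> dom (local_config P)" using c by blast
  moreover have "vertex_weight q s w i1 (flux a K L (Suc x)) i2 j2 = 0" for w i1 i2 j2
    using f by (simp add: vertex_weight_def del: flux.simps)
  then have "(case the (local_config P v) of (i1, j1, i2, j2) \<Rightarrow> vertex_weight q s (u (nat (snd v))) i1 j1 i2 j2) = 0"
    unfolding c by (simp del: flux.simps)
  ultimately show ?thesis unfolding config_weight_def by (intro prod_zero) blast+
qed

text \<open>Configurations of row sequences are pairwise distinct and come from collections. Every
  other configuration has a horizontal edge with more than one path, hence weight 0.\<close>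

theorem path_sum_eq_iterate_rows:
  assumes nz: "\<forall>i\<in>{1..N}. 1 - s * u i \<noteq> 0"
  shows "path_sum q s u (strip_starts a N mu) (vertical_edges la (int N)) =
    iterate_rows q s u a (occupation n (map nat mu)) N (occupation n (map nat la))"
proof -
  define C where "C = collections (strip_starts a N mu) (vertical_edges la (int N))"
  define R where "R = row_seqs a (occupation n (map nat mu)) N (occupation n (map nat la))"
  have "path_sum q s u (strip_starts a N mu) (vertical_edges la (int N)) =
    (\<Sum>c\<in>local_config ` C. config_weight q s u c)"
    by (simp add: path_sum_def C_def)
  also have "\<dots> = (\<Sum>c\<in>row_config n N a ` R. config_weight q s u c)"
  proof (rule sum.mono_neutral_right)
    show "finite (local_config ` C)" unfolding C_def by (intro finite_imageI finite_collections)
    show "row_config n N a ` R \<subseteq> local_config ` C"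
    proof
      fix c assume "c \<in> row_config n N a ` R"
      then obtain V where V: "V \<in> R" "c = row_config n N a V" by auto
      from exists_collection_row_seq[OF V(1)[unfolded R_def]] obtain P where "P \<in> C" "edge_rows P = V"
        by (auto simp: C_def)
      then show "c \<in> local_config ` C"
        using local_config_eq_row_config V(2) by (auto simp: C_def)
    qed
    show "\<forall>c\<in>local_config ` C - row_config n N a ` R. config_weight q s u c = 0"
    proof
      fix c assume c: "c \<in> local_config ` C - row_config n N a ` R"
      then obtain P where P: "P \<in> collections (strip_starts a N mu) (vertical_edges la (int N))" "c = local_config P"
        by (auto simp: C_def)
      have "\<not> (\<forall>x<n. \<forall>y<N. edge_count P (hedge (Suc x) (Suc y)) \<le> 1)"
      proof
        assume "\<forall>x<n. \<forall>y<N. edge_count P (hedge (Suc x) (Suc y)) \<le> 1"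
        then have "edge_rows P \<in> R"
          using edge_rows_0[OF P(1)] edge_rows_top[OF P(1)] row_ok_edge_rows[OF P(1)]
          by (auto simp: R_def row_seqs_def edge_rows_def)
        then show False using c P local_config_eq_row_config[OF P(1)] by auto
      qed
      then show "config_weight q s u c = 0"
        using config_weight_eq_0[OF P(1)] P(2) by (auto simp: not_le)
    qed
  qed
  also have "\<dots> = (\<Sum>V\<in>R. config_weight q s u (row_config n N a V))"
    using inj_on_row_config by (simp add: sum.reindex R_def)
  also have "\<dots> = iterate_rows q s u a (occupation n (map nat mu)) N (occupation n (map nat la))"
    unfolding conjunct2[OF iterate_rows_eq_sum] R_def
    by (intro sum.cong refl config_weight_row_config nz)
  finally show ?thesis .
qed

end

section \<open>The symmetrization formulas\<close>

lemma row_op_cong: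
  assumes "\<And>ks. length ks = length ms \<Longrightarrow> \<Phi> ks = \<Psi> ks"
  shows "row_op q s w a \<Phi> ms = row_op q s w a \<Psi> ms"
  using assms
proof (induction ms arbitrary: a \<Phi> \<Psi>)
  case (Cons m ms)
  have "row_op q s w b (\<lambda>ks. \<Phi> ((m + b - a) # ks)) ms = row_op q s w b (\<lambda>ks. \<Psi> ((m + b - a) # ks)) ms" for b
    by (rule Cons.IH) (simp add: Cons.prems)
  then show ?case by (simp only: row_op.simps)
qed simp

lemma psi_empty: "psi q s {} ms = (if ms = replicate (length ms) 0 then 1 else 0)"
  by (induction ms) (auto simp: qpoch_def psi_base_def cross_def)

lemma gam_empty: "gam q s n {} (k # ks) = (if k = n then psi q s {} ks else 0)"
  by (simp add: gam_coeff_def cross_def)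

lemma atLeastAtMost_Suc_image:
  assumes "inj_on u {1..Suc N}"
  shows "u ` {1..Suc N} = insert (u (Suc N)) (u ` {1..N})" "u (Suc N) \<notin> u ` {1..N}"
    "inj_on u {1..N}"
proof -
  have *: "{1..Suc N} = insert (Suc N) {1..N}" by (simp add: atLeastAtMostSuc_conv)
  then show "u ` {1..Suc N} = insert (u (Suc N)) (u ` {1..N})" by simp
  show "u (Suc N) \<notin> u ` {1..N}" "inj_on u {1..N}"
    using assms unfolding * inj_on_insert by simp_all
qed

lemma occupation_Nil: "occupation n [] = replicate n 0"
  by (rule nth_equalityI) (simp_all add: occupation_def)

text \<open>With no variables, \<open>psi\<close> is the indicator of the empty configuration. Each
  row inserts its variable, which is new because \<open>u\<close> is injective.\<close>

lemma iterate_rows_eq_psi: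
  assumes "inj_on u {1..N}" "\<forall>i\<in>{1..N}. 1 - s * u i \<noteq> 0" "length L = n"
  shows "iterate_rows q s u 1 (occupation n []) N L = psi q s (u ` {1..N}) L"
  using assms
proof (induction N arbitrary: L)
  case 0
  then show ?case by (simp add: psi_empty occupation_Nil)
next
  case (Suc N)
  note U = atLeastAtMost_Suc_image[OF Suc.prems(1)]
  have "iterate_rows q s u 1 (occupation n []) (Suc N) L = row_op q s (u (Suc N)) (Suc 0) (psi q s (u ` {1..N})) L"
    using Suc.IH[OF U(3)] Suc.prems by (simp, intro row_op_cong) auto
  also have "\<dots> = psi q s (u ` {1..Suc N}) L"
    unfolding U(1) by (intro conjunct1[OF row_op_psi] U(2)) (use Suc.prems in auto)
  finally show ?case .
qed

text \<open>With no variables, \<open>gam\<close> is the indicator of the configuration with all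
  \<open>n\<close> paths in column 0, which is where the rows start.\<close>

lemma iterate_rows_eq_gam:
  assumes "inj_on u {1..N}" "\<forall>i\<in>{1..N}. 1 - s * u i \<noteq> 0" "length L = Suc X"
  shows "iterate_rows q s u 0 (occupation (Suc X) (replicate n 0)) N L = gam q s n (u ` {1..N}) L"
  using assms
proof (induction N arbitrary: L)
  case 0
  then obtain k ks where L: "L = k # ks" "length ks = X" by (cases L) auto
  have "count_list (replicate n (0::nat)) 0 = n" "unshift (replicate n 0) = []"
    by (induction n) (auto simp: unshift_def)
  then have "occupation (Suc X) (replicate n 0) = n # replicate X 0"
    by (simp add: occupation_Suc occupation_Nil)
  with L show ?case by (simp add: gam_empty psi_empty del: gam.simps)
next
  case (Suc N)
  note U = atLeastAtMost_Suc_image[OF Suc.prems(1)]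
  obtain k ks where L: "L = k # ks" using Suc.prems(3) by (cases L) auto
  have "iterate_rows q s u 0 (occupation (Suc X) (replicate n 0)) (Suc N) L = row_op q s (u (Suc N)) 0 (gam q s n (u ` {1..N})) L"
    unfolding iterate_rows.simps by (rule row_op_cong, rule Suc.IH[OF U(3)]) (use Suc.prems in auto)
  also have "\<dots> = gam q s n (u ` {1..Suc N}) L"
    unfolding U(1) L by (intro row_op_gam U(2)) (use Suc.prems in auto)
  finally show ?case .
qed

lemma sorted_map_nat: "sorted_wrt (\<ge>) (la :: int list) \<Longrightarrow> sorted_wrt (\<ge>) (map nat la)"
  by (induction la) auto

text \<open>This bounds the number of columns. The additional 0 gives the empty signature a maximum
  too.\<close>

lemma less_Suc_nat_Max:
  fixes la :: "int list"
  assumes "\<forall>e\<in>set la. 0 \<le> e"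
  shows "\<forall>e\<in>set la. 0 \<le> e \<and> e < int (Suc (nat (Max (set (0 # la)))))"
proof
  fix e assume "e \<in> set la"
  then have "e \<le> Max (set (0 # la))" "0 \<le> e" using assms by (auto intro!: Max_ge)
  then show "0 \<le> e \<and> e < int (Suc (nat (Max (set (0 # la)))))" by linarith
qed

lemma F_fun_eq_symmetrization:
  assumes mu: "mu \<in> Sign_plus M" and inj: "inj_on u {1..M}" and nz: "\<forall>i\<in>{1..M}. 1 - s * u i \<noteq> 0"
  shows "F_fun q s mu u = (1 - q) ^ M / (\<Prod>i=1..M. 1 - s * u i) *
          (\<Sum>\<sigma> | \<sigma> permutes {1..M}.
             perm_act \<sigma> (\<lambda>x.
               (\<Prod>(i, j)\<in>{(i, j). 1 \<le> i \<and> i < j \<and> j \<le> M}. (x i - q * x j) / (x i - x j)) *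
               (\<Prod>i=1..M. ((x i - s) / (1 - s * x i)) ^ nat (mu ! (i - 1)))) u)"
proof -
  have len: "length mu = M" and sorted: "sorted_wrt (\<ge>) mu" and nonneg: "\<forall>e\<in>set mu. 0 \<le> e"
    using mu by (auto simp: Sign_plus_def Sign_def)
  define n where "n = Suc (nat (Max (set (0 # mu))))"
  have bound: "\<forall>e\<in>set mu. 0 \<le> e \<and> e < int n" unfolding n_def by (rule less_Suc_nat_Max[OF nonneg])
  define \<xi> where "\<xi> x = (x - s) / (1 - s * x)" for x
  have "vertical_edges [] 0 + mset (map (\<lambda>j. ((- 1, int j), (0, int j))) [1..<Suc (length mu - length [])]) = strip_starts 1 M []"
    unfolding horizontal_edges_eq_sum len strip_starts_def by simp
  then have "F_fun q s mu u = path_sum q s u (strip_starts 1 M []) (vertical_edges mu (int M))"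
    by (simp add: F_fun_def F_skew_def len)
  also have "\<dots> = iterate_rows q s u 1 (occupation n (map nat [])) M (occupation n (map nat mu))"
    by (rule path_sum_eq_iterate_rows) (use bound nz in auto)
  also have "\<dots> = psi q s (u ` {1..M}) (occupation n (map nat mu))"
    unfolding list.map(1) by (rule iterate_rows_eq_psi) (use inj nz in \<open>auto simp: occupation_def\<close>)
  also have "\<dots> = (1 - q) ^ M * (\<Prod>x\<in>u ` {1..M}. 1 / (1 - s * x)) * symsum q (u ` {1..M}) (map (\<lambda>e x. \<xi> x ^ e) (map nat mu))"
  proof -
    have card: "card (u ` {1..M}) = M" using inj by (simp add: card_image)
    have "psi q s (u ` {1..M}) (occupation n (map nat mu)) = (1 - q) ^ card (u ` {1..M}) *
      (\<Prod>x\<in>u ` {1..M}. 1 / (1 - s * x)) * symsum q (u ` {1..M}) (map (\<lambda>e x. ((x - s) / (1 - s * x)) ^ e) (map nat mu))"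
    proof (rule psi_eq_symsum)
      show "sorted_wrt (\<ge>) (map nat mu)" by (rule sorted_map_nat[OF sorted])
      show "\<forall>e\<in>set (map nat mu). e < n" using bound by auto
    qed (simp_all only: card len length_map finite_imageI finite_atLeastAtMost)
    then show ?thesis by (simp only: card \<xi>_def)
  qed
  also have "(\<Prod>x\<in>u ` {1..M}. 1 / (1 - s * x)) = 1 / (\<Prod>i=1..M. 1 - s * u i)"
    using inj by (simp add: prod.reindex prod_dividef)
  also have "map (\<lambda>e x. \<xi> x ^ e) (map nat mu) = map (\<lambda>i x. \<xi> x ^ nat (mu ! (i - 1))) [1..<Suc M]"
    by (rule nth_equalityI) (simp_all add: len del: upt_Suc)
  also have "symsum q (u ` {1..M}) \<dots> = (\<Sum>\<sigma> | \<sigma> permutes {1..M}.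
     (\<Prod>(i, j)\<in>{(i, j). 1 \<le> i \<and> i < j \<and> j \<le> M}. hl_factor q (u (\<sigma> i)) (u (\<sigma> j))) *
     (\<Prod>i=1..M. \<xi> (u (\<sigma> i)) ^ nat (mu ! (i - 1))))"
    by (rule sum_permutes_eq_symsum[OF inj, symmetric])
  finally show ?thesis by (simp add: perm_act_def hl_factor_def \<xi>_def)
qed

lemma G_fun_eq_symmetrization:
  assumes nu: "nu \<in> Sign_plus n" and k: "k = card {i \<in> {1..n}. nu ! (i - 1) = 0}" and N: "n - k \<le> N"
    and q: "qpoch q q (N + k - n) \<noteq> 0" "qpoch (s\<^sup>2) q k \<noteq> 0"
    and inj: "inj_on v {1..N}" and nz: "\<forall>i\<in>{1..N}. 1 - s * v i \<noteq> 0"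
    and nz': "k < n \<longrightarrow> (\<forall>i\<in>{1..N}. v i - s \<noteq> 0)"
  shows "G_fun q s N nu v =
          (1 - q) ^ N * qpoch (s\<^sup>2) q n / (qpoch q q (N + k - n) * qpoch (s\<^sup>2) q k) *
          (\<Sum>\<sigma> | \<sigma> permutes {1..N}.
             perm_act \<sigma> (\<lambda>x.
               (\<Prod>(i, j)\<in>{(i, j). 1 \<le> i \<and> i < j \<and> j \<le> N}. (x i - q * x j) / (x i - x j)) *
               (\<Prod>i=1..n - k. x i / ((1 - s * x i) * (x i - s)) *
                  ((x i - s) / (1 - s * x i)) ^ nat (nu ! (i - 1))) *
               (\<Prod>j=n - k + 1..N. (1 - q ^ k * s * x j) / (1 - s * x j))) v)"
proof -
  have len: "length nu = n" and sorted: "sorted_wrt (\<ge>) nu" and nonneg: "\<forall>e\<in>set nu. 0 \<le> e"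
    using nu by (auto simp: Sign_plus_def Sign_def)
  define X where "X = nat (Max (set (0 # nu)))"
  have bound: "\<forall>e\<in>set nu. 0 \<le> e \<and> e < int (Suc X)" unfolding X_def by (rule less_Suc_nat_Max[OF nonneg])
  define l where "l = map nat nu"
  define p where "p = n - k"
  \<comment> \<open>The theorem counts positions starting from 1, the list version counts
    entries.\<close>
  have kc: "k = count_list l 0"
  proof -
    have "count_list l 0 = card {i. i < length l \<and> l ! i = 0}"
      by (simp add: count_list_eq_length_filter length_filter_conv_card)
    also have "{i. i < length l \<and> l ! i = 0} = {i. i < n \<and> nu ! i = 0}"
    proof -
      have "0 \<le> nu ! i" if "i < n" for i using nonneg nth_mem[of i nu] that len by blast
      then have "l ! i = 0 \<longleftrightarrow> nu ! i = 0" if "i < n" for i using that by (fastforce simp: l_def len)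
      moreover have "length l = n" by (simp add: l_def len)
      ultimately show ?thesis by blast
    qed
    also have "card \<dots> = card (Suc ` {i. i < n \<and> nu ! i = 0})" by (simp add: card_image)
    also have "Suc ` {i. i < n \<and> nu ! i = 0} = {i \<in> {1..n}. nu ! (i - 1) = 0}"
    proof (intro set_eqI iffI)
      fix i assume i: "i \<in> {i \<in> {1..n}. nu ! (i - 1) = 0}"
      then obtain j where "i = Suc j" by (cases i) auto
      with i show "i \<in> Suc ` {i. i < n \<and> nu ! i = 0}" by auto
    qed auto
    finally show ?thesis unfolding k ..
  qed
  define fl where "fl = filter (\<lambda>e. e \<noteq> 0) l"
  have lsort: "fl @ replicate k 0 = l"
    unfolding kc l_def fl_def by (rule sorted_eq_filter_append_zeros[OF sorted_map_nat[OF sorted]])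
  have plen: "length fl = p" and kn: "k \<le> n"
    using arg_cong[OF lsort, of length] by (simp_all add: p_def l_def len)
  have fnth: "fl ! i = nat (nu ! i)" if "i < p" for i
  proof -
    have "l ! i = fl ! i" using that plen by (subst lsort[symmetric]) (simp only: nth_append if_True)
    then show ?thesis using that by (simp add: l_def len p_def)
  qed
  define y where "y e x = x / ((1 - s * x) * (x - s)) * ((x - s) / (1 - s * x)) ^ e" for e :: nat and x
  define z where "z x = (1 - q ^ k * s * x) / (1 - s * x)" for x
  \<comment> \<open>One family of factors for all positions: the first \<open>p\<close> carry the
    nonzero coordinates, the others the factor \<open>z\<close>.\<close>
  define h where "h i = (if i \<le> p then y (nat (nu ! (i - 1))) else z)" for i
  have hprod: "(\<Prod>i=1..N. h i (v (\<sigma> i))) = (\<Prod>i=1..p. y (nat (nu ! (i - 1))) (v (\<sigma> i))) * (\<Prod>i=p + 1..N. z (v (\<sigma> i)))" for \<sigma>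
  proof -
    have "{1..N} = {1..p} \<union> {p + 1..N}" using N by (auto simp: p_def)
    then have "(\<Prod>i=1..N. h i (v (\<sigma> i))) = (\<Prod>i=1..p. h i (v (\<sigma> i))) * (\<Prod>i=p + 1..N. h i (v (\<sigma> i)))"
      by (simp add: prod.union_disjoint)
    then show ?thesis by (simp add: h_def)
  qed
  have card: "card (v ` {1..N}) = N" using inj by (simp add: card_image)
  have "vertical_edges (replicate n 0) 0 = strip_starts 0 N (replicate n 0)"
    by (simp add: strip_starts_def)
  then have "G_fun q s N nu v = path_sum q s v (strip_starts 0 N (replicate n 0)) (vertical_edges nu (int N))"
    by (simp add: G_fun_def G_skew_def len)
  also have "\<dots> = iterate_rows q s v 0 (occupation (Suc X) (map nat (replicate n 0))) N (occupation (Suc X) l)"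
    unfolding l_def by (rule path_sum_eq_iterate_rows) (use bound nz in auto)
  also have "map nat (replicate n 0) = replicate n 0" by simp
  also have "iterate_rows q s v 0 (occupation (Suc X) (replicate n 0)) N (occupation (Suc X) l)
     = gam q s (length l) (v ` {1..N}) (occupation (Suc X) l)"
    using iterate_rows_eq_gam[OF inj nz, of "occupation (Suc X) l" X q n] by (simp add: l_def len occupation_def del: upt_Suc)
  also have "\<dots> = (1 - q) ^ N * qpoch (s\<^sup>2) q n / (qpoch q q (N + k - n) * qpoch (s\<^sup>2) q k) *
     symsum q (v ` {1..N}) (map y fl @ replicate (N + k - n) z)"
  proof -
    have ln: "length l = n" by (simp add: l_def len)
    have "gam q s (length l) (v ` {1..N}) (occupation (Suc X) l) =
     (1 - q) ^ card (v ` {1..N}) * qpoch (s\<^sup>2) q (length l) / (qpoch q q (card (v ` {1..N}) + count_list l 0 - length l) * qpoch (s\<^sup>2) q (count_list l 0)) *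
     symsum q (v ` {1..N}) (map (\<lambda>e x. x / ((1 - s * x) * (x - s)) * ((x - s) / (1 - s * x)) ^ e) (filter (\<lambda>e. e \<noteq> 0) l) @
       replicate (card (v ` {1..N}) + count_list l 0 - length l) (\<lambda>x. (1 - q ^ count_list l 0 * s * x) / (1 - s * x)))"
    proof (rule gam_eq_symsum)
      show "\<forall>x\<in>v ` {1..N}. x - s \<noteq> 0" if "count_list l 0 < length l" using that nz' by (simp add: kc ln)
      show "sorted_wrt (\<ge>) l" unfolding l_def by (rule sorted_map_nat[OF sorted])
      show "\<forall>e\<in>set l. e < Suc X" using bound by (auto simp: l_def)
    qed (use N q in \<open>simp_all only: card ln kc[symmetric] finite_imageI finite_atLeastAtMost simp_thms\<close>)
    then show ?thesis by (simp only: card ln kc[symmetric] y_def[abs_def] z_def[abs_def] fl_def)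
  qed
  also have "map y fl @ replicate (N + k - n) z = map h [1..<Suc N]"
  proof (rule nth_equalityI)
    \<comment> \<open>The natural subtractions are exact because \<open>k \<le> n\<close> and
      \<open>n - k \<le> N\<close>.\<close>
    have "p + (N + k - n) = N" using N kn by (simp add: p_def)
    then show "length (map y fl @ replicate (N + k - n) z) = length (map h [1..<Suc N])"
      by (simp add: plen del: upt_Suc)
    fix i assume "i < length (map y fl @ replicate (N + k - n) z)"
    then have i: "i < p + (N + k - n)" "i < N" using \<open>p + (N + k - n) = N\<close> by (simp_all add: plen)
    then show "(map y fl @ replicate (N + k - n) z) ! i = map h [1..<Suc N] ! i"
      by (cases "i < p") (simp_all add: nth_append plen fnth h_def del: upt_Suc)
  qed
  also have "symsum q (v ` {1..N}) \<dots> = (\<Sum>\<sigma> | \<sigma> permutes {1..N}.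
     (\<Prod>(i, j)\<in>{(i, j). 1 \<le> i \<and> i < j \<and> j \<le> N}. hl_factor q (v (\<sigma> i)) (v (\<sigma> j))) * (\<Prod>i=1..N. h i (v (\<sigma> i))))"
    by (rule sum_permutes_eq_symsum[OF inj, symmetric])
  finally show ?thesis unfolding hprod by (simp add: perm_act_def hl_factor_def y_def z_def p_def mult.assoc)
qed

theorem theorem5p1:
  fixes q s :: complex
  shows
    "(\<forall>(M::nat) (mu::int list) (u::nat \<Rightarrow> complex).
        mu \<in> Sign_plus M \<longrightarrow>
        inj_on u {1..M} \<longrightarrow>
        (\<forall>i\<in>{1..M}. 1 - s * u i \<noteq> 0) \<longrightarrow>
        F_fun q s mu u =
          (1 - q) ^ M / (\<Prod>i=1..M. 1 - s * u i) *
          (\<Sum>\<sigma> | \<sigma> permutes {1..M}.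
             perm_act \<sigma> (\<lambda>x.
               (\<Prod>(i, j)\<in>{(i, j). 1 \<le> i \<and> i < j \<and> j \<le> M}. (x i - q * x j) / (x i - x j)) *
               (\<Prod>i=1..M. ((x i - s) / (1 - s * x i)) ^ nat (mu ! (i - 1)))) u))
     \<and>
     (\<forall>(n::nat) (nu::int list) (k::nat) (N::nat) (v::nat \<Rightarrow> complex).
        nu \<in> Sign_plus n \<longrightarrow>
        k = card {i \<in> {1..n}. nu ! (i - 1) = 0} \<longrightarrow>
        n - k \<le> N \<longrightarrow>
        qpoch q q (N + k - n) \<noteq> 0 \<longrightarrow>
        qpoch (s\<^sup>2) q k \<noteq> 0 \<longrightarrow>
        inj_on v {1..N} \<longrightarrow>
        (\<forall>i\<in>{1..N}. 1 - s * v i \<noteq> 0) \<longrightarrow>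
        (k < n \<longrightarrow> (\<forall>i\<in>{1..N}. v i - s \<noteq> 0)) \<longrightarrow>
        G_fun q s N nu v =
          (1 - q) ^ N * qpoch (s\<^sup>2) q n / (qpoch q q (N + k - n) * qpoch (s\<^sup>2) q k) *
          (\<Sum>\<sigma> | \<sigma> permutes {1..N}.
             perm_act \<sigma> (\<lambda>x.
               (\<Prod>(i, j)\<in>{(i, j). 1 \<le> i \<and> i < j \<and> j \<le> N}. (x i - q * x j) / (x i - x j)) *
               (\<Prod>i=1..n - k. x i / ((1 - s * x i) * (x i - s)) *
                  ((x i - s) / (1 - s * x i)) ^ nat (nu ! (i - 1))) *
               (\<Prod>j=n - k + 1..N. (1 - q ^ k * s * x j) / (1 - s * x j))) v))"
  by (intro conjI allI impI F_fun_eq_symmetrization G_fun_eq_symmetrization) blast+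

end
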